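(* Let $k\ge 0$ be an integer, let $u\in H_0^1(\Omega)$ be the weak solution of $-\nabla\cdot(a\nabla u)=f$ in $\Omega$, $u=0$ on $\partial\Omega$, and suppose $u=u_r+u_s$ with $u_r\in H^{k+2}(\Omega)$ (regular part) and $u_s$ a singular component. Assume that the consistency functional $\ell_u(v)=a_w(Q_hu,v)-(f,v_0)$ is controlled by the regular part, i.e. there is a constant $C_0$ independent of $h$ with \[ |\ell_u(v)|\le C_0h^{k+1}\|u_r\|_{H^{k+2}(\Omega)}\|v\|_{1,h}\qquad\text{for all }v\in V_h^0 . \] Let $n_1,\dots,n_m\in\mathcal N_M$, let $W_h^m=V_h^0+Z_h^m$ be the corresponding enriched weak Galerkin space, and let $u_h^{(m)}\in W_h^m$ be the neural-enhanced weak Galerkin solution, i.e. $a_w(u_h^{(m)},v)=(f,v_0)$ for all $v=\{v_0,v_b\}\in W_h^m$. If there exists $z_m\in Z_h^m$ such that \[ \|Q_hu_s-z_m\|_{a_w}\le\varepsilon_m, \] then \[ \|Q_hu-u_h^{(m)}\|_{a_w}\le C\big(h^{k+1}\|u_r\|_{H^{k+2}(\Omega)}+\varepsilon_m\big), \] where $C>0$ is a constant independent of $h$, $m$, $u_r$, $u_s$ and $\varepsilon_m$ (but possibly depending on $C_0$).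
   Context: Problem. $\Omega\subset\mathbb R^d$ ($d=2,3$) is a bounded polygonal or polyhedral domain, $a(x)$ is a symmetric, uniformly positive definite matrix-valued coefficient, $f\in L^2(\Omega)$. The weak solution $u\in H_0^1(\Omega)$ satisfies $(a\nabla u,\nabla v)=(f,v)$ for all $v\in H_0^1(\Omega)$, where $(\cdot,\cdot)$ is the $L^2(\Omega)$ inner product. It is assumed that $a$ is piecewise constant, i.e. constant on each element of the mesh below. Mesh and spaces. $\mathcal T_h$ is a shape-regular partition of $\Omega$ into polygons ($d=2$) or polyhedra ($d=3$), in the usual sense of the weak Galerkin literature with regularity parameters uniform in $h$; $h_T$ is the diameter of $T\in\mathcal T_h$ and $h=\max_T h_T$. $P_j(T)$, $P_j(e)$ are the polynomials of total degree at most $j$ on an element $T$, resp. an edge/face $e$, with $P_{-1}=\{0\}$. $V_h$ is the space of weak functions $v=\{v_0,v_b\}$ with $v_0|_T\in P_k(T)$ for every $T\in\mathcal T_h$ and $v_b|_e\in P_k(e)$ for every edge/face $e$, where $v_b$ is single-valued on each interior edge/face. $V_h^0=\{v\in V_h: v_b=0\text{ on }\partial\Omega\}$. Weak gradient, forms and norms. For $v\in V_h$, $\nabla_w v|_T\in[P_{k-1}(T)]^d$ is the unique polynomial with $(\nabla_w v,\mathbf q)_T=-(v_0,\nabla\cdot\mathbf q)_T+\langle v_b,\mathbf q\cdot\mathbf n\rangle_{\partial T}$ for all $\mathbf q\in[P_{k-1}(T)]^d$, where $\mathbf n$ is the outward unit normal on $\partial T$. For $w,v\in V_h$, \[ s(w,v)=\sum_{T\in\mathcal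 T_h}h_T^{-1}\langle w_0-w_b,v_0-v_b\rangle_{\partial T},\qquad a_w(w,v)=\sum_{T\in\mathcal T_h}(a\nabla_w w,\nabla_w v)_T+s(w,v), \] $\|v\|_{a_w}=a_w(v,v)^{1/2}$, and $\|v\|_{1,h}^2=\sum_{T\in\mathcal T_h}\big(\|\nabla_wv\|_T^2+h_T^{-1}\|v_0-v_b\|_{\partial T}^2\big)$. Projection. $Q_hw=\{Q_0w,Q_bw\}$, where $Q_0$ is the elementwise $L^2$ projection onto $P_k(T)$ and $Q_b$ is the $L^2$ projection onto $P_k(e)$ on each edge/face $e$. Neural enrichment. $\widetilde{\mathcal N}_M$ is a class of feedforward neural networks, $\phi\in H_0^1(\Omega)$ is a fixed function vanishing on $\partial\Omega$, and $\mathcal N_M=\{\phi\,\tilde n:\tilde n\in\widetilde{\mathcal N}_M\}$, which is assumed to be contained in $H_0^1(\Omega)$. For $n_i\in\mathcal N_M$ put $\widehat n_i=\{Q_0n_i,Q_bn_i\}\in V_h^0$; then $Z_h^m=\operatorname{span}\{\widehat n_1,\dots,\widehat n_m\}$ and $W_h^m=V_h^0+Z_h^m\subset V_h^0$. *)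

theory Defs
  imports "HOL-Analysis.Analysis" "HOL-Library.Function_Algebras"
begin

section \<open>Functions as a real vector space\<close>

instantiation "fun" :: (type, real_vector) real_vector
begin

definition scaleR_fun :: "real \<Rightarrow> ('a \<Rightarrow> 'b) \<Rightarrow> 'a \<Rightarrow> 'b"
  where "scaleR_fun c f = (\<lambda>x. c *\<^sub>R f x)"

instance
  by standard (simp_all add: scaleR_fun_def fun_eq_iff scaleR_add_right scaleR_add_left)

end


section \<open>Sobolev spaces\<close>

text \<open>Multi-indices are functions \<open>'n \<Rightarrow> nat\<close>. The bound is an integer so that \<open>P\<^bsub>-1\<^esub>\<close> makes sense below.\<close>

definition multi_indices :: "int \<Rightarrow> ('n::finite \<Rightarrow> nat) set"
  where "multi_indices j = {\<alpha>. int (\<Sum>i\<in>UNIV. \<alpha> i) \<le> j}"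

primrec iter_partial :: "'n::finite list \<Rightarrow> (real^'n \<Rightarrow> real) \<Rightarrow> real^'n \<Rightarrow> real"
  where
    "iter_partial [] f = f"
  | "iter_partial (i # is) f = (\<lambda>x. frechet_derivative (iter_partial is f) (at x) (axis i 1))"

definition smooth_fun :: "(real^'n::finite \<Rightarrow> real) \<Rightarrow> bool"
  where "smooth_fun f \<longleftrightarrow> (\<forall>is x. iter_partial is f differentiable (at x))"

definition test_functions :: "(real^'n::finite) set \<Rightarrow> (real^'n \<Rightarrow> real) set"
  where "test_functions \<Omega> =
    {\<psi>. smooth_fun \<psi> \<and> (\<exists>K. compact K \<and> K \<subseteq> \<Omega> \<and> (\<forall>x. x \<notin> K \<longrightarrow> \<psi> x = 0))}"

definition L2_space :: "'a measure \<Rightarrow> ('a \<Rightarrow> real) set"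
  where "L2_space M = {w \<in> borel_measurable M. integrable M (\<lambda>x. (w x)\<^sup>2)}"

text \<open>The list \<open>is\<close> ranges over all orders in which \<open>\<partial>\<^sup>\<alpha>\<close> can be applied to the (smooth) test
  function; they all give the same result.\<close>

definition has_weak_deriv ::
    "(real^'n::finite) set \<Rightarrow> ('n \<Rightarrow> nat) \<Rightarrow> (real^'n \<Rightarrow> real) \<Rightarrow> (real^'n \<Rightarrow> real) \<Rightarrow> bool"
  where "has_weak_deriv \<Omega> \<alpha> w g \<longleftrightarrow>
    (\<forall>\<psi>\<in>test_functions \<Omega>. \<forall>is. (\<forall>i. count_list is i = \<alpha> i) \<longrightarrow>
      (LINT x|lebesgue_on \<Omega>. w x * iter_partial is \<psi> x) =
        (-1) ^ length is * (LINT x|lebesgue_on \<Omega>. g x * \<psi> x))"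

text \<open>A representative of the weak derivative, which is unique up to null sets.\<close>

definition weak_deriv ::
    "(real^'n::finite) set \<Rightarrow> ('n \<Rightarrow> nat) \<Rightarrow> (real^'n \<Rightarrow> real) \<Rightarrow> real^'n \<Rightarrow> real"
  where "weak_deriv \<Omega> \<alpha> w = (SOME g. g \<in> L2_space (lebesgue_on \<Omega>) \<and> has_weak_deriv \<Omega> \<alpha> w g)"

definition sobolev :: "(real^'n::finite) set \<Rightarrow> nat \<Rightarrow> (real^'n \<Rightarrow> real) set"
  where "sobolev \<Omega> s = {w \<in> L2_space (lebesgue_on \<Omega>).
    \<forall>\<alpha>\<in>multi_indices (int s). \<exists>g\<in>L2_space (lebesgue_on \<Omega>). has_weak_deriv \<Omega> \<alpha> w g}"

definition sobolev_norm :: "(real^'n::finite) set \<Rightarrow> nat \<Rightarrow> (real^'n \<Rightarrow> real) \<Rightarrow> real"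
  where "sobolev_norm \<Omega> s w =
    sqrt (\<Sum>\<alpha>\<in>multi_indices (int s). LINT x|lebesgue_on \<Omega>. (weak_deriv \<Omega> \<alpha> w x)\<^sup>2)"

definition H10 :: "(real^'n::finite) set \<Rightarrow> (real^'n \<Rightarrow> real) set"
  where "H10 \<Omega> = {w \<in> sobolev \<Omega> 1. \<forall>\<epsilon>>0. \<exists>\<psi>\<in>test_functions \<Omega>. sobolev_norm \<Omega> 1 (w - \<psi>) < \<epsilon>}"

definition gradient :: "(real^'n::finite) set \<Rightarrow> (real^'n \<Rightarrow> real) \<Rightarrow> real^'n \<Rightarrow> real^'n"
  where "gradient \<Omega> w x = (\<chi> i. weak_deriv \<Omega> (\<lambda>j. if j = i then 1 else 0) w x)"

definition weak_solution ::
    "(real^'n::finite) set \<Rightarrow> (real^'n \<Rightarrow> real^'n^'n) \<Rightarrow> (real^'n \<Rightarrow> real) \<Rightarrow> (real^'n \<Rightarrow> real) \<Rightarrow> bool"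
  where "weak_solution \<Omega> a f u \<longleftrightarrow> u \<in> H10 \<Omega> \<and>
    (\<forall>v\<in>H10 \<Omega>. (LINT x|lebesgue_on \<Omega>. (a x *v gradient \<Omega> u x) \<bullet> gradient \<Omega> v x) =
      (LINT x|lebesgue_on \<Omega>. f x * v x))"


section \<open>Surface measure and traces on flat faces\<close>

text \<open>The \<open>(d-1)\<close>-dimensional Lebesgue measure on a compact set \<open>e\<close> lying in a hyperplane: \<open>slab e\<close>
  is the right prism of height 1 with mid-section \<open>e\<close>, and \<open>face_measure e\<close> is the image of the volume
  measure on it under the orthogonal projection onto the hyperplane.\<close>

definition slab :: "(real^'n::finite) set \<Rightarrow> (real^'n) set"
  where "slab e = {x. closest_point (affine hull e) x \<in> e \<and> infdist x (affine hull e) \<le> 1/2}"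

definition face_measure :: "(real^'n::finite) set \<Rightarrow> (real^'n) measure"
  where "face_measure e =
    distr (lebesgue_on (slab e)) (restrict_space borel e) (closest_point (affine hull e))"

text \<open>Continuous extension of the restriction map from functions smooth up to the boundary
  to \<open>H\<^sup>1(\<Omega>)\<close>; here \<open>e\<close> is a flat piece of the closure of \<open>\<Omega>\<close>. Traces are unique up to null sets
  of \<open>face_measure e\<close>; outside the domain of the trace operator \<open>trace_on\<close> is totalised by 0.\<close>

definition has_trace ::
    "(real^'n::finite) set \<Rightarrow> (real^'n) set \<Rightarrow> (real^'n \<Rightarrow> real) \<Rightarrow> (real^'n \<Rightarrow> real) \<Rightarrow> bool"
  where "has_trace \<Omega> e w g \<longleftrightarrow> g \<in> L2_space (face_measure e) \<and>
    (\<exists>\<psi> :: nat \<Rightarrow> real^'n \<Rightarrow> real. (\<forall>j. smooth_fun (\<psi> j)) \<and>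
      (\<lambda>j. sobolev_norm \<Omega> 1 (w - \<psi> j)) \<longlonglongrightarrow> 0 \<and>
      (\<lambda>j. LINT x|face_measure e. (g x - \<psi> j x)\<^sup>2) \<longlonglongrightarrow> 0)"

definition trace_on :: "(real^'n::finite) set \<Rightarrow> (real^'n) set \<Rightarrow> (real^'n \<Rightarrow> real) \<Rightarrow> real^'n \<Rightarrow> real"
  where "trace_on \<Omega> e w = (if \<exists>g. has_trace \<Omega> e w g then SOME g. has_trace \<Omega> e w g else 0)"


section \<open>Domain and mesh\<close>

definition polytope_union :: "(real^'n::finite) set \<Rightarrow> bool"
  where "polytope_union S \<longleftrightarrow> (\<exists>F. finite F \<and> (\<forall>P\<in>F. polytope P) \<and> S = \<Union>F)"

text \<open>\<open>\<Omega> = interior (closure \<Omega>)\<close> excludes slits, i.e. \<open>\<Omega>\<close> lies on one side of its boundary faces.\<close>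

definition polyhedral_domain :: "(real^'n::finite) set \<Rightarrow> bool"
  where "polyhedral_domain \<Omega> \<longleftrightarrow>
    open \<Omega> \<and> connected \<Omega> \<and> bounded \<Omega> \<and> \<Omega> \<noteq> {} \<and>
    \<Omega> = interior (closure \<Omega>) \<and> polytope_union (closure \<Omega>)"

text \<open>Elements are closed, simply connected, not necessarily convex polygons/polyhedra.\<close>

definition element_shape :: "(real^'n::finite) set \<Rightarrow> bool"
  where "element_shape T \<longleftrightarrow>
    polytope_union T \<and> T \<noteq> {} \<and> closure (interior T) = T \<and> connected (interior T) \<and> simply_connected T"

definition face_shape :: "(real^'n::finite) set \<Rightarrow> bool"
  where "face_shape e \<longleftrightarrow>
    polytope_union e \<and> aff_dim e = int CARD('n) - 1 \<and>
    closure (rel_interior e) = e \<and> connected (rel_interior e)"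

definition faces_of :: "(real^'n::finite) set set \<Rightarrow> (real^'n) set \<Rightarrow> (real^'n) set set"
  where "faces_of Eh T = {e \<in> Eh. e \<subseteq> frontier T}"

text \<open>\<open>Th\<close> is the set of elements, \<open>Eh\<close> the set of edges/faces. An interior face is a single
  member of \<open>Eh\<close> shared by both neighbours; hanging nodes are allowed and subdivide faces
  into coplanar ones.\<close>

definition partition_of ::
    "(real^'n::finite) set \<Rightarrow> (real^'n) set set \<Rightarrow> (real^'n) set set \<Rightarrow> bool"
  where "partition_of \<Omega> Th Eh \<longleftrightarrow>
    finite Th \<and> finite Eh \<and> (\<forall>T\<in>Th. element_shape T) \<and> (\<forall>e\<in>Eh. face_shape e) \<and>
    \<Union>Th = closure \<Omega> \<and>
    (\<forall>T\<in>Th. \<forall>T'\<in>Th. T \<noteq> T' \<longrightarrow> interior T \<inter> interior T' = {}) \<and>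
    (\<forall>T\<in>Th. frontier T = \<Union>(faces_of Eh T)) \<and>
    (\<forall>e\<in>Eh. \<exists>T\<in>Th. e \<in> faces_of Eh T) \<and>
    (\<forall>e\<in>Eh. \<forall>e'\<in>Eh. e \<noteq> e' \<longrightarrow> rel_interior e \<inter> e' = {})"

definition mesh_size :: "(real^'n::finite) set set \<Rightarrow> real"
  where "mesh_size Th = Max (diameter ` Th)"

definition outward_normal :: "(real^'n::finite) set \<Rightarrow> (real^'n) set \<Rightarrow> real^'n"
  where "outward_normal T e = (THE \<nu>. norm \<nu> = 1 \<and> (\<forall>x\<in>e. \<forall>y\<in>e. \<nu> \<bullet> (x - y) = 0) \<and>
    (\<forall>x\<in>rel_interior e. \<exists>\<delta>>0. \<forall>t. 0 < t \<and> t < \<delta> \<longrightarrow>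
      x - t *\<^sub>R \<nu> \<in> interior T \<and> x + t *\<^sub>R \<nu> \<notin> T))"

text \<open>The shape regularity conditions A1--A4 of Wang and Ye (Math. Comp. 83, 2014) that are
  standard for weak Galerkin methods, with their constants collected in a record.\<close>

record regularity =
  rho_v :: real      \<comment> \<open>A1: volume of the elements\<close>
  rho_e :: real      \<comment> \<open>A1: measure of the faces\<close>
  kappa :: real      \<comment> \<open>A2: diameter of the faces\<close>
  sigma :: real      \<comment> \<open>A3: relative height of the pyramids\<close>
  theta :: real      \<comment> \<open>A3: maximal opening angle of the pyramids\<close>
  gamma :: real      \<comment> \<open>A4: relative size of the circumscribed simplices\<close>
  rho_s :: real      \<comment> \<open>A4: relative inradius of the circumscribed simplices\<close>
  overlap :: nat     \<comment> \<open>A4: number of other simplices met by a circumscribed simplex\<close>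

definition shape_regular ::
    "regularity \<Rightarrow> (real^'n::finite) set set \<Rightarrow> (real^'n) set set \<Rightarrow> bool"
  where "shape_regular R Th Eh \<longleftrightarrow>
    (\<forall>T\<in>Th. rho_v R * diameter T ^ CARD('n) \<le> measure lebesgue T) \<and>
    (\<forall>e\<in>Eh. rho_e R * diameter e ^ (CARD('n) - 1) \<le> measure (face_measure e) e) \<and>
    (\<forall>T\<in>Th. \<forall>e\<in>faces_of Eh T. kappa R * diameter T \<le> diameter e) \<and>
    (\<forall>T\<in>Th. \<forall>e\<in>faces_of Eh T. \<exists>A\<in>T.
      (\<Union>x\<in>e. closed_segment A x) \<subseteq> T \<and>
      sigma R * diameter T \<le> infdist A (affine hull e) \<and>
      (\<forall>x\<in>e. cos (theta R) * norm (x - A) \<le> (x - A) \<bullet> outward_normal T e)) \<and>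
    (\<exists>S. (\<forall>T\<in>Th. int CARD('n) simplex S T \<and> T \<subseteq> S T \<and>
        diameter (S T) \<le> gamma R * diameter T \<and>
        (\<exists>c. cball c (rho_s R * diameter (S T)) \<subseteq> S T) \<and>
        card {T'\<in>Th - {T}. S T \<inter> S T' \<noteq> {}} \<le> overlap R))"

definition admissible_constants :: "regularity \<Rightarrow> bool"
  where "admissible_constants R \<longleftrightarrow>
    0 < rho_v R \<and> 0 < rho_e R \<and> 0 < kappa R \<and> 0 < sigma R \<and>
    0 \<le> theta R \<and> theta R < pi / 2 \<and> 0 < gamma R \<and> 0 < rho_s R"

definition uniformly_spd :: "(real^'n::finite) set \<Rightarrow> (real^'n \<Rightarrow> real^'n^'n) \<Rightarrow> bool"
  where "uniformly_spd \<Omega> a \<longleftrightarrow> (\<forall>x\<in>\<Omega>. transpose (a x) = a x) \<and>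
    (\<exists>a0>0. \<forall>x\<in>\<Omega>. \<forall>\<xi>. a0 * (\<xi> \<bullet> \<xi>) \<le> (a x *v \<xi>) \<bullet> \<xi>)"

text \<open>Constancy on the interiors: neighbouring elements share boundary points, so constancy on
  the closed elements would force the coefficient to be globally constant.\<close>

definition piecewise_constant :: "(real^'n::finite) set set \<Rightarrow> (real^'n \<Rightarrow> 'b) \<Rightarrow> bool"
  where "piecewise_constant Th a \<longleftrightarrow> (\<forall>T\<in>Th. \<forall>x\<in>interior T. \<forall>y\<in>interior T. a x = a y)"


section \<open>Weak Galerkin spaces, weak gradient and forms\<close>

text \<open>\<open>polys j\<close> is \<open>{0}\<close> for \<open>j = -1\<close>.\<close>

definition polys :: "int \<Rightarrow> (real^'n::finite \<Rightarrow> real) set"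
  where "polys j = span ((\<lambda>\<alpha> x. \<Prod>i\<in>UNIV. (x $ i) ^ \<alpha> i) ` multi_indices j)"

definition vector_polys :: "int \<Rightarrow> (real^'n::finite \<Rightarrow> real^'n) set"
  where "vector_polys j = {q. \<forall>i. (\<lambda>x. q x $ i) \<in> polys j}"

definition divergence :: "(real^'n::finite \<Rightarrow> real^'n) \<Rightarrow> real^'n \<Rightarrow> real"
  where "divergence q x = (\<Sum>i\<in>UNIV. frechet_derivative (\<lambda>y. q y $ i) (at x) (axis i 1))"

text \<open>A weak function \<open>{v\<^sub>0, v\<^sub>b}\<close>: \<open>fst v T\<close> is \<open>v\<^sub>0\<close> on the element \<open>T\<close> and \<open>snd v e\<close> is \<open>v\<^sub>b\<close> on the
  face \<open>e\<close>. Only the values on \<open>T\<close> and \<open>e\<close>, respectively, matter. Since \<open>v\<^sub>b\<close> is indexed by faces and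
  not by element/face pairs, it is single-valued.\<close>

type_synonym 'n weak_fun =
  "((real^'n) set \<Rightarrow> real^'n \<Rightarrow> real) \<times> ((real^'n) set \<Rightarrow> real^'n \<Rightarrow> real)"

definition Vh :: "nat \<Rightarrow> (real^'n::finite) set set \<Rightarrow> (real^'n) set set \<Rightarrow> 'n weak_fun set"
  where "Vh k Th Eh = {v.
    (\<forall>T\<in>Th. \<exists>p\<in>polys (int k). \<forall>x\<in>T. fst v T x = p x) \<and>
    (\<forall>e\<in>Eh. \<exists>p\<in>polys (int k). \<forall>x\<in>e. snd v e x = p x)}"

definition Vh0 ::
    "nat \<Rightarrow> (real^'n::finite) set \<Rightarrow> (real^'n) set set \<Rightarrow> (real^'n) set set \<Rightarrow> 'n weak_fun set"
  where "Vh0 k \<Omega> Th Eh =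
    {v \<in> Vh k Th Eh. \<forall>e\<in>Eh. e \<subseteq> frontier \<Omega> \<longrightarrow> (\<forall>x\<in>e. snd v e x = 0)}"

definition wgrad ::
    "nat \<Rightarrow> (real^'n::finite) set set \<Rightarrow> 'n weak_fun \<Rightarrow> (real^'n) set \<Rightarrow> real^'n \<Rightarrow> real^'n"
  where "wgrad k Eh v T = (THE g. g \<in> vector_polys (int k - 1) \<and>
    (\<forall>q\<in>vector_polys (int k - 1).
      (LINT x|lebesgue_on T. g x \<bullet> q x) =
        - (LINT x|lebesgue_on T. fst v T x * divergence q x) +
        (\<Sum>e\<in>faces_of Eh T. LINT x|face_measure e. snd v e x * (q x \<bullet> outward_normal T e))))"

definition jump_form ::
    "(real^'n::finite) set set \<Rightarrow> 'n weak_fun \<Rightarrow> 'n weak_fun \<Rightarrow> (real^'n) set \<Rightarrow> real"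
  where "jump_form Eh w v T =
    (\<Sum>e\<in>faces_of Eh T. LINT x|face_measure e. (fst w T x - snd w e x) * (fst v T x - snd v e x))"

definition stabilizer ::
    "(real^'n::finite) set set \<Rightarrow> (real^'n) set set \<Rightarrow> 'n weak_fun \<Rightarrow> 'n weak_fun \<Rightarrow> real"
  where "stabilizer Th Eh w v = (\<Sum>T\<in>Th. inverse (diameter T) * jump_form Eh w v T)"

definition aw ::
    "nat \<Rightarrow> (real^'n::finite \<Rightarrow> real^'n^'n) \<Rightarrow> (real^'n) set set \<Rightarrow> (real^'n) set set \<Rightarrow>
      'n weak_fun \<Rightarrow> 'n weak_fun \<Rightarrow> real"
  where "aw k a Th Eh w v =
    (\<Sum>T\<in>Th. LINT x|lebesgue_on T. (a x *v wgrad k Eh w T x) \<bullet> wgrad k Eh v T x) +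
    stabilizer Th Eh w v"

definition aw_norm ::
    "nat \<Rightarrow> (real^'n::finite \<Rightarrow> real^'n^'n) \<Rightarrow> (real^'n) set set \<Rightarrow> (real^'n) set set \<Rightarrow>
      'n weak_fun \<Rightarrow> real"
  where "aw_norm k a Th Eh v = sqrt (aw k a Th Eh v v)"

definition norm1h ::
    "nat \<Rightarrow> (real^'n::finite) set set \<Rightarrow> (real^'n) set set \<Rightarrow> 'n weak_fun \<Rightarrow> real"
  where "norm1h k Th Eh v = sqrt (\<Sum>T\<in>Th.
    (LINT x|lebesgue_on T. wgrad k Eh v T x \<bullet> wgrad k Eh v T x) +
    inverse (diameter T) * jump_form Eh v v T)"

definition load :: "(real^'n::finite) set set \<Rightarrow> (real^'n \<Rightarrow> real) \<Rightarrow> 'n weak_fun \<Rightarrow> real"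
  where "load Th f v = (\<Sum>T\<in>Th. LINT x|lebesgue_on T. f x * fst v T x)"

text \<open>On a face several polynomials in the ambient variables represent the projection;
  they agree on the face.\<close>

definition L2_proj ::
    "(real^'n::finite) measure \<Rightarrow> nat \<Rightarrow> (real^'n \<Rightarrow> real) \<Rightarrow> real^'n \<Rightarrow> real"
  where "L2_proj M k w = (SOME p. p \<in> polys (int k) \<and>
    (\<forall>q\<in>polys (int k). (LINT x|M. p x * q x) = (LINT x|M. w x * q x)))"

definition Qh :: "nat \<Rightarrow> (real^'n::finite) set \<Rightarrow> (real^'n \<Rightarrow> real) \<Rightarrow> 'n weak_fun"
  where "Qh k \<Omega> w =
    (\<lambda>T. L2_proj (lebesgue_on T) k w, \<lambda>e. L2_proj (face_measure e) k (trace_on \<Omega> e w))"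

definition consistency ::
    "nat \<Rightarrow> (real^'n::finite) set \<Rightarrow> (real^'n \<Rightarrow> real^'n^'n) \<Rightarrow> (real^'n) set set \<Rightarrow> (real^'n) set set \<Rightarrow>
      (real^'n \<Rightarrow> real) \<Rightarrow> (real^'n \<Rightarrow> real) \<Rightarrow> 'n weak_fun \<Rightarrow> real"
  where "consistency k \<Omega> a Th Eh f u v = aw k a Th Eh (Qh k \<Omega> u) v - load Th f v"


section \<open>Neural enrichment\<close>

text \<open>\<open>hidden_layer \<rho> N A W b l x j\<close> is the output of neuron \<open>j\<close> of hidden layer \<open>l\<close>
  (counting from 0, of width \<open>N l\<close>) for activation \<open>\<rho>\<close>, input weights \<open>A\<close>, weights \<open>W l\<close>
  from layer \<open>l\<close> to layer \<open>l + 1\<close> and biases \<open>b\<close>.\<close>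

primrec hidden_layer ::
    "(real \<Rightarrow> real) \<Rightarrow> (nat \<Rightarrow> nat) \<Rightarrow> (nat \<Rightarrow> 'n::finite \<Rightarrow> real) \<Rightarrow> (nat \<Rightarrow> nat \<Rightarrow> nat \<Rightarrow> real) \<Rightarrow>
      (nat \<Rightarrow> nat \<Rightarrow> real) \<Rightarrow> nat \<Rightarrow> real^'n \<Rightarrow> nat \<Rightarrow> real"
  where
    "hidden_layer \<rho> N A W b 0 x = (\<lambda>j. \<rho> ((\<Sum>i\<in>UNIV. A j i * x $ i) + b 0 j))"
  | "hidden_layer \<rho> N A W b (Suc l) x =
      (\<lambda>j. \<rho> ((\<Sum>i<N l. W l j i * hidden_layer \<rho> N A W b l x i) + b (Suc l) j))"

definition feedforward_networks :: "(real \<Rightarrow> real) \<Rightarrow> (real^'n::finite \<Rightarrow> real) set"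
  where "feedforward_networks \<rho> =
    {(\<lambda>x. (\<Sum>i<N L. c i * hidden_layer \<rho> N A W b L x i) + c0) | L N A W b c c0. True}"

definition neural_space ::
    "(real^'n::finite \<Rightarrow> real) \<Rightarrow> (real^'n \<Rightarrow> real) set \<Rightarrow> (real^'n \<Rightarrow> real) set"
  where "neural_space \<phi> NN = {(\<lambda>x. \<phi> x * g x) | g. g \<in> NN}"

definition Zh ::
    "nat \<Rightarrow> (real^'n::finite) set \<Rightarrow> nat \<Rightarrow> (nat \<Rightarrow> real^'n \<Rightarrow> real) \<Rightarrow> 'n weak_fun set"
  where "Zh k \<Omega> m n = span ((\<lambda>i. Qh k \<Omega> (n i)) ` {1..m})"

definition Wh ::
    "nat \<Rightarrow> (real^'n::finite) set \<Rightarrow> (real^'n) set set \<Rightarrow> (real^'n) set set \<Rightarrow>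
      nat \<Rightarrow> (nat \<Rightarrow> real^'n \<Rightarrow> real) \<Rightarrow> 'n weak_fun set"
  where "Wh k \<Omega> Th Eh m n = {v + z | v z. v \<in> Vh0 k \<Omega> Th Eh \<and> z \<in> Zh k \<Omega> m n}"

definition enriched_solution ::
    "nat \<Rightarrow> (real^'n::finite) set \<Rightarrow> (real^'n \<Rightarrow> real^'n^'n) \<Rightarrow> (real^'n) set set \<Rightarrow> (real^'n) set set \<Rightarrow>
      (real^'n \<Rightarrow> real) \<Rightarrow> nat \<Rightarrow> (nat \<Rightarrow> real^'n \<Rightarrow> real) \<Rightarrow> 'n weak_fun \<Rightarrow> bool"
  where "enriched_solution k \<Omega> a Th Eh f m n uh \<longleftrightarrow> uh \<in> Wh k \<Omega> Th Eh m n \<and>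
    (\<forall>v\<in>Wh k \<Omega> Th Eh m n. aw k a Th Eh uh v = load Th f v)"

end

theory Submission
  imports Defs
begin

text \<open>
  The error \<open>E = Q\<^sub>h u - u\<^sub>h\<close> is itself an admissible test function: \<open>u\<close> and the networks
  \<open>n\<^sub>i\<close> lie in \<open>H\<^sup>1\<^sub>0(\<Omega>)\<close>, so \<open>Q\<^sub>h u\<close> and all of \<open>Z\<^sub>h\<close> belong to \<open>V\<^sub>h\<^sup>0\<close>, and hence
  \<open>W\<^sub>h = V\<^sub>h\<^sup>0\<close> contains \<open>E\<close>. Testing the discrete equation with \<open>E\<close> gives the energy identity
  \<open>a\<^sub>w(E, E) = a\<^sub>w(Q\<^sub>h u, E) - (f, E\<^sub>0) = \<ell>\<^sub>u(E)\<close>. Let \<open>a\<^sub>0\<close> be an ellipticity constant. The right-hand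
  side is at most \<open>\<bar>C\<^sub>0\<bar> X \<parallel>E\<parallel>\<close> in the norm \<open>norm1h\<close>, where \<open>X = h\<^bsup>k+1\<^esup> \<parallel>u\<^sub>r\<parallel>\<close>, and
  \<open>min a\<^sub>0 1\<close> times the square of \<open>norm1h\<close> is bounded by \<open>a\<^sub>w(E, E)\<close>. Dividing by the energy norm of \<open>E\<close>
  yields the bound \<open>C X\<close> with \<open>C = \<bar>C\<^sub>0\<bar> / sqrt (min a\<^sub>0 1)\<close> (lemma \<open>enriched_error_estimate\<close>); it
  may be enlarged by a multiple of \<open>\<epsilon>\<close>, which bounds a norm and is therefore nonnegative.

  Two facts make this argument rigorous. The first is that \<open>aw\<close> is linear in its first argument,
  which requires the weak gradient to exist and to be unique (\<open>wgrad_wgrad_equation\<close>). This is Riesz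
  representation on the finite-dimensional space of polynomials (\<open>polys_representation\<close>), combined
  with the fact that a polynomial vanishing almost everywhere on an element is zero.

  The second, and the longer one, is that the face part of \<open>Q\<^sub>h w\<close> vanishes on \<open>\<partial>\<Omega>\<close> for \<open>w\<close> in
  \<open>H\<^sup>1\<^sub>0(\<Omega>)\<close> (\<open>Qh_in_Vh0\<close>). Approximating \<open>w\<close> by test functions shows that 0 is a trace of
  \<open>w\<close>, but the trace is defined by choice, so every trace has to vanish almost everywhere
  (\<open>trace_on_boundary_face\<close>). Two approximating sequences differ by smooth functions that tend to 0 in
  \<open>H\<^sup>1(\<Omega>)\<close>; that this smallness can be read off their classical derivatives is the uniqueness of
  weak derivatives, i.e. the fundamental lemma of the calculus of variations. Such a sequence tends
  to 0 in \<open>L\<^sup>2\<close> of a face by the trace inequality on a thin cylinder that has the face as its base and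
  lies in an adjacent element (\<open>trace_inequality\<close>, \<open>half_ball_in_element\<close>). The Fubini theorem for
  this cylinder, whose axis is in general not a coordinate direction, comes from a rotation in the plane
  of the normal and one auxiliary coordinate, written as a product of three shears
  (\<open>nn_integral_rotate\<close>), so that only Fubini in product coordinates and translation invariance are
  used.
\<close>

section \<open>Smooth bump functions\<close>

text \<open>The whole family is needed rather than the single function \<open>exp (- 1 / t)\<close>: it is closed under
  differentiation, which makes smoothness immediate.\<close>

definition flat :: "real poly \<Rightarrow> real \<Rightarrow> real"
  where "flat p t = (if t > 0 then poly p (1 / t) * exp (- (1 / t)) else 0)"

lemma poly_times_exp_minus_tendsto_0: "((\<lambda>x. poly p x * exp (- x)) \<longlongrightarrow> (0::real)) at_top"
proof -
  have "((\<lambda>x::real. \<Sum>i\<le>degree p. coeff p i * (x ^ i / exp x)) \<longlongrightarrow> (\<Sum>i\<le>degree p. coeff p i * 0)) at_top"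
    by (intro tendsto_sum tendsto_mult tendsto_const tendsto_power_div_exp_0)
  then show ?thesis
    by (simp add: poly_altdef sum_divide_distrib exp_minus divide_inverse sum_distrib_right mult.assoc)
qed

text \<open>After the substitution \<open>x = 1 / t\<close> this is the decay of \<open>poly p x * exp (- x)\<close> at infinity.\<close>

lemma flat_tendsto_0: "(flat p \<longlongrightarrow> 0) (at 0)"
proof -
  have "((\<lambda>t. poly p (1 / t) * exp (- (1 / t))) \<longlongrightarrow> 0) (at_right 0)"
    using filterlim_compose[OF poly_times_exp_minus_tendsto_0 filterlim_inverse_at_top_right]
    by (simp add: divide_inverse)
  then have "(flat p \<longlongrightarrow> 0) (at_right 0)"
    by (rule Lim_transform_eventually) (auto simp: flat_def eventually_at_right_field intro: exI[of _ 1])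
  moreover have "(flat p \<longlongrightarrow> 0) (at_left 0)"
    by (rule Lim_transform_eventually[OF tendsto_const])
      (auto simp: flat_def eventually_at_left_field intro: exI[of _ "-1"])
  ultimately show ?thesis
    by (simp add: filterlim_split_at)
qed

text \<open>At 0 the difference quotient of \<open>flat p\<close> is again a member of the family, namely for the
  polynomial \<open>X p\<close>, so that the derivative there is covered by \<open>flat_tendsto_0\<close>.\<close>

lemma DERIV_flat: "(flat p has_real_derivative flat ([:0, 0, 1:] * (p - pderiv p)) t) (at t)"
proof -
  consider "t > 0" | "t < 0" | "t = 0" by linarith
  then show ?thesis
  proof cases
    case 1
    have "((\<lambda>t. poly p (1 / t) * exp (- (1 / t))) has_real_derivative
        flat ([:0, 0, 1:] * (p - pderiv p)) t) (at t)"
      using 1 by (auto intro!: derivative_eq_intros DERIV_chain'[OF _ poly_DERIV]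
          simp: flat_def field_simps power2_eq_square)
    then show ?thesis
      by (rule has_field_derivative_transform_within_open[of _ _ _ "{0<..}"])
        (use 1 in \<open>auto simp: flat_def\<close>)
  next
    case 2
    have "((\<lambda>t. 0) has_real_derivative flat ([:0, 0, 1:] * (p - pderiv p)) t) (at t)"
      using 2 by (simp add: flat_def)
    then show ?thesis
      by (rule has_field_derivative_transform_within_open[of _ _ _ "{..<0}"])
        (use 2 in \<open>auto simp: flat_def\<close>)
  next
    case 3
    have "flat ([:0, 1:] * p) = (\<lambda>h. (flat p (0 + h) - flat p 0) / h)"
      by (auto simp: flat_def fun_eq_iff)
    moreover have "flat ([:0, 0, 1:] * (p - pderiv p)) 0 = 0"
      by (simp add: flat_def)
    ultimately show ?thesis
      using flat_tendsto_0[of "[:0, 1:] * p"] 3 unfolding DERIV_def by simp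
  qed
qed

text \<open>A set of differentiable functions that is closed under partial derivatives consists of smooth
  functions. This algebra has these properties and contains the polynomials as well as the cut-off
  functions of boxes.\<close>

inductive_set smooth_algebra :: "(real^'n::finite \<Rightarrow> real) set"
  where
    const: "(\<lambda>x. c) \<in> smooth_algebra"
  | coord: "(\<lambda>x. x $ i) \<in> smooth_algebra"
  | flat: "(\<lambda>x. flat p (c * (x $ i) + d)) \<in> smooth_algebra"
  | add: "f \<in> smooth_algebra \<Longrightarrow> g \<in> smooth_algebra \<Longrightarrow> (\<lambda>x. f x + g x) \<in> smooth_algebra"
  | mult: "f \<in> smooth_algebra \<Longrightarrow> g \<in> smooth_algebra \<Longrightarrow> (\<lambda>x. f x * g x) \<in> smooth_algebra"

lemma has_derivative_flat_coord:
  "((\<lambda>x. flat p (c * (x $ i) + d)) has_derivative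
    (\<lambda>h. c * (h $ i) * flat ([:0, 0, 1:] * (p - pderiv p)) (c * (x $ i) + d))) (at x)"
proof -
  have "((\<lambda>x. c * (x $ i) + d) has_derivative (\<lambda>h. c * (h $ i))) (at x)"
    by (auto intro!: derivative_eq_intros bounded_linear.has_derivative[OF bounded_linear_vec_nth])
  from has_derivative_compose[OF this DERIV_flat[of p, unfolded has_field_derivative_def]]
  show ?thesis by (simp add: mult.commute)
qed

lemma smooth_algebra_partial:
  fixes f :: "real^'n::finite \<Rightarrow> real"
  assumes "f \<in> smooth_algebra"
  shows "(\<forall>x. f differentiable (at x)) \<and>
    (\<lambda>x. frechet_derivative f (at x) (axis i 1)) \<in> smooth_algebra"
  using assms
proof induction
  case (const c)
  then show ?case using smooth_algebra.const[of 0] by (simp add: frechet_derivative_const)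
next
  case (coord j)
  have "((\<lambda>x::real^'n. x $ j) has_derivative (\<lambda>h. h $ j)) (at x)" for x
    by (intro bounded_linear_imp_has_derivative bounded_linear_vec_nth)
  then have "(\<lambda>x::real^'n. x $ j) differentiable (at x)"
    "frechet_derivative (\<lambda>x::real^'n. x $ j) (at x) = (\<lambda>h. h $ j)" for x
    by (auto simp: differentiable_def intro!: frechet_derivative_at[symmetric])
  then show ?case using smooth_algebra.const by simp
next
  case (flat p c j d)
  have "(\<lambda>x. flat p (c * (x $ j) + d)) differentiable (at x)"
    "frechet_derivative (\<lambda>x. flat p (c * (x $ j) + d)) (at x) =
      (\<lambda>h. c * (h $ j) * flat ([:0, 0, 1:] * (p - pderiv p)) (c * (x $ j) + d))" for x :: "real^'n"
    using has_derivative_flat_coord frechet_derivative_at differentiable_def by metis+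
  then show ?case
    using smooth_algebra.mult[OF smooth_algebra.const[of "c * axis i 1 $ j"] smooth_algebra.flat]
    by simp
next
  case (add f g)
  have "((\<lambda>x. f x + g x) has_derivative
      (\<lambda>h. frechet_derivative f (at x) h + frechet_derivative g (at x) h)) (at x)" for x
    using add.IH by (intro has_derivative_add) (auto simp flip: frechet_derivative_works)
  then have "(\<lambda>x. f x + g x) differentiable (at x)"
    "frechet_derivative (\<lambda>x. f x + g x) (at x) =
      (\<lambda>h. frechet_derivative f (at x) h + frechet_derivative g (at x) h)" for x
    by (auto simp: differentiable_def intro!: frechet_derivative_at[symmetric])
  then show ?case
    using add.IH smooth_algebra.add[of "\<lambda>x. frechet_derivative f (at x) (axis i 1)"
        "\<lambda>x. frechet_derivative g (at x) (axis i 1)"] by simp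
next
  case (mult f g)
  have "((\<lambda>x. f x * g x) has_derivative
      (\<lambda>h. f x * frechet_derivative g (at x) h + frechet_derivative f (at x) h * g x)) (at x)" for x
    using mult.IH by (intro has_derivative_mult) (auto simp flip: frechet_derivative_works)
  then have "(\<lambda>x. f x * g x) differentiable (at x)"
    "frechet_derivative (\<lambda>x. f x * g x) (at x) =
      (\<lambda>h. f x * frechet_derivative g (at x) h + frechet_derivative f (at x) h * g x)" for x
    by (auto simp: differentiable_def intro!: frechet_derivative_at[symmetric])
  then show ?case
    using mult smooth_algebra.add[of "\<lambda>x. f x * frechet_derivative g (at x) (axis i 1)"
        "\<lambda>x. frechet_derivative f (at x) (axis i 1) * g x"]
      smooth_algebra.mult[of f "\<lambda>x. frechet_derivative g (at x) (axis i 1)"]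
      smooth_algebra.mult[of "\<lambda>x. frechet_derivative f (at x) (axis i 1)" g] by simp
qed

lemma smooth_algebra_smooth: assumes "f \<in> smooth_algebra" shows "smooth_fun f"
proof -
  have "iter_partial is f \<in> smooth_algebra" for "is"
    by (induction "is") (use assms smooth_algebra_partial in auto)
  then show ?thesis using smooth_algebra_partial by (auto simp: smooth_fun_def)
qed

lemma smooth_algebra_prod:
  "finite I \<Longrightarrow> (\<And>i. i \<in> I \<Longrightarrow> F i \<in> smooth_algebra) \<Longrightarrow> (\<lambda>x. \<Prod>i\<in>I. F i x) \<in> smooth_algebra"
  by (induction I rule: finite_induct) (auto intro: smooth_algebra.const smooth_algebra.mult)

lemma smooth_algebra_power: "f \<in> smooth_algebra \<Longrightarrow> (\<lambda>x. f x ^ m) \<in> smooth_algebra"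
  by (induction m) (auto intro: smooth_algebra.const smooth_algebra.mult)

text \<open>Since \<open>flat 1 (m t) = (flat 1 t)\<^bsup>1/m\<^esup>\<close> for \<open>m > 0\<close>, these functions increase to the indicator
  of the box.\<close>

definition box_bump :: "real^'n::finite \<Rightarrow> real^'n \<Rightarrow> nat \<Rightarrow> real^'n \<Rightarrow> real"
  where "box_bump a b m x =
    (\<Prod>i\<in>UNIV. flat 1 (real m * (x $ i - a $ i)) * flat 1 (real m * (b $ i - x $ i)))"

lemma flat_1_bounds: "0 \<le> flat 1 t" "flat 1 t \<le> 1"
  by (auto simp: flat_def)

lemma box_bump_bounds: "0 \<le> box_bump a b m x" "box_bump a b m x \<le> 1"
  unfolding box_bump_def by (simp_all add: prod_nonneg prod_le_1 mult_le_one flat_1_bounds)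

lemma box_bump_outside: "x \<notin> box a b \<Longrightarrow> box_bump a b m x = 0"
proof -
  assume "x \<notin> box a b"
  then obtain i where "x $ i \<le> a $ i \<or> b $ i \<le> x $ i"
    by (auto simp: mem_box_cart not_less)
  then have "flat 1 (real m * (x $ i - a $ i)) * flat 1 (real m * (b $ i - x $ i)) = 0"
    by (auto simp: flat_def zero_less_mult_iff)
  then show ?thesis
    unfolding box_bump_def by (intro prod_zero) auto
qed

lemma box_bump_test_function: "cbox a b \<subseteq> \<Omega> \<Longrightarrow> box_bump a b m \<in> test_functions \<Omega>"
proof -
  assume "cbox a b \<subseteq> \<Omega>"
  moreover have "box_bump a b m \<in> smooth_algebra"
  proof -
    have "(\<lambda>x. flat 1 (real m * (x $ i) + (- real m * a $ i)) * flat 1 (- real m * (x $ i) + real m * b $ i))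
        \<in> smooth_algebra" for i
      by (intro smooth_algebra.mult smooth_algebra.flat)
    from smooth_algebra_prod[OF finite this]
    have "(\<lambda>x. \<Prod>i\<in>UNIV. flat 1 (real m * (x $ i) + (- real m * a $ i)) *
        flat 1 (- real m * (x $ i) + real m * b $ i)) \<in> smooth_algebra" .
    also have "(\<lambda>x. \<Prod>i\<in>UNIV. flat 1 (real m * (x $ i) + (- real m * a $ i)) *
        flat 1 (- real m * (x $ i) + real m * b $ i)) = box_bump a b m"
      unfolding box_bump_def[abs_def] right_diff_distrib by simp
    finally show ?thesis .
  qed
  moreover have "x \<notin> cbox a b \<Longrightarrow> box_bump a b m x = 0" for x
    using box_bump_outside[of x a b m] box_subset_cbox[of a b] by auto
  ultimately show ?thesis
    unfolding test_functions_def using smooth_algebra_smooth by (intro CollectI conjI exI[of _ "cbox a b"]) simp_all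
qed

lemma flat_1_tendsto: "0 < s \<Longrightarrow> (\<lambda>m. flat 1 (real m * s)) \<longlonglongrightarrow> 1"
proof -
  assume s: "0 < s"
  have "(\<lambda>m. exp (- (1 / s * (1 / real m)))) \<longlonglongrightarrow> exp (- (1 / s * 0))"
    by (intro tendsto_intros lim_1_over_n)
  then have "(\<lambda>m. exp (- (1 / (real m * s)))) \<longlonglongrightarrow> 1" by (simp add: field_simps)
  then show ?thesis
    by (rule Lim_transform_eventually)
      (use s in \<open>auto simp: flat_def intro!: eventually_sequentiallyI[of 1]\<close>)
qed

lemma box_bump_tendsto: "(\<lambda>m. box_bump a b m x) \<longlonglongrightarrow> indicator (box a b) x"
proof (cases "x \<in> box a b")
  case True
  then have "(\<lambda>m. box_bump a b m x) \<longlonglongrightarrow> (\<Prod>i\<in>(UNIV::'a set). 1 * 1)"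
    unfolding box_bump_def by (intro tendsto_prod tendsto_mult flat_1_tendsto) (auto simp: mem_box_cart)
  then show ?thesis using True by simp
qed (simp add: box_bump_outside)

section \<open>The fundamental lemma of the calculus of variations\<close>

lemma integral_lebesgue_on_indicator:
  fixes f :: "'a::euclidean_space \<Rightarrow> real"
  assumes "S \<in> sets lebesgue"
  shows "integral\<^sup>L (lebesgue_on S) f = (LINT x|lebesgue. indicator S x * f x)"
    and "integrable (lebesgue_on S) f \<longleftrightarrow> integrable lebesgue (\<lambda>x. indicator S x * f x)"
  using assms by (simp_all add: integral_restrict_space integrable_restrict_space)

text \<open>The sets over whose intersection with the box \<open>d\<close> integrates to 0 form a Dynkin system, and the
  boxes are a generator of the Borel sets that is stable under intersections. Applied to the sets
  where a Borel version of \<open>d\<close> is nonnegative or nonpositive this gives \<open>d = 0\<close>.\<close>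

lemma box_integrals_zero_imp_AE_zero:
  fixes d :: "'a::euclidean_space \<Rightarrow> real"
  assumes int: "integrable lebesgue d"
    and zero: "\<And>p q. box p q \<subseteq> box a b \<Longrightarrow> (LINT x|lebesgue. indicator (box p q) x * d x) = 0"
  shows "AE x in lebesgue. x \<in> box a b \<longrightarrow> d x = 0"
proof -
  let ?U = "box a b"
  have [measurable]: "d \<in> borel_measurable lebesgue" using int by auto
  have int': "integrable lebesgue (\<lambda>x. indicator A x * d x)" if "A \<in> sets borel" for A
    using integrable_mult_indicator[OF _ int, of A] that by simp
  have A0: "(LINT x|lebesgue. indicator (A \<inter> ?U) x * d x) = 0" if "A \<in> sets borel" for A
  proof -
    let ?G = "range (\<lambda>(a, b). box a b) :: 'a set set"
    have "Int_stable ?G" by (auto simp: Int_stable_def box_Int_box)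
    moreover have "?G \<subseteq> Pow UNIV" by auto
    moreover have "A \<in> sigma_sets UNIV ?G" using that by (simp add: borel_eq_box)
    ultimately show ?thesis
    proof (induction A rule: sigma_sets_induct_disjoint)
      case (basic A)
      then obtain p q where A: "A = box p q" by auto
      obtain p' q' where pq: "A \<inter> ?U = box p' q'"
        unfolding A box_Int_box by blast
      then have "box p' q' \<subseteq> ?U" by blast
      then show ?case unfolding pq by (rule zero)
    next
      case empty show ?case by simp
    next
      case (compl A)
      then have A: "A \<in> sets borel" by (simp add: borel_eq_box)
      have "(LINT x|lebesgue. indicator ((UNIV - A) \<inter> ?U) x * d x)
        = (LINT x|lebesgue. indicator ?U x * d x - indicator (A \<inter> ?U) x * d x)"
        by (intro Bochner_Integration.integral_cong) (auto simp: indicator_def)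
      also have "\<dots> = 0"
        using compl zero[of a b] A by (subst Bochner_Integration.integral_diff) (auto intro!: int')
      finally show ?case .
    next
      case (union A)
      then have A: "\<And>i. A i \<in> sets borel"
        by (auto simp: borel_eq_box)
      have "(LINT x:(\<Union>i. A i \<inter> ?U)|lebesgue. d x) = (\<Sum>i. LINT x:(A i \<inter> ?U)|lebesgue. d x)"
      proof (rule lebesgue_integral_countable_add)
        show "A i \<inter> ?U \<in> sets lebesgue" for i using A by auto
        show "(A i \<inter> ?U) \<inter> (A j \<inter> ?U) = {}" if "i \<noteq> j" for i j
          using union that by (auto simp: disjoint_family_on_def)
        show "set_integrable lebesgue (\<Union>i. A i \<inter> ?U) d"
          unfolding set_integrable_def using int'[of "\<Union>i. A i \<inter> ?U"] A by auto
      qed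
      then show ?case
        using union by (simp add: set_lebesgue_integral_def)
    qed
  qed
  obtain d' where d'[measurable]: "d' \<in> borel_measurable lborel" and dd': "AE x in lborel. d x = d' x"
    using completion_ex_borel_measurable_real[of d lborel] int by auto
  have dd'': "AE x in lebesgue. d x = d' x" using dd' by (rule AE_completion)
  have sgn: "AE x in lebesgue. indicator (A \<inter> ?U) x * d x = 0"
    if A: "A \<in> sets borel" and s: "\<And>x. x \<in> A \<Longrightarrow> 0 \<le> s * d' x" and s1: "s \<noteq> 0" for A and s :: real
  proof -
    let ?f = "\<lambda>x. indicator (A \<inter> ?U) x * (s * d x)"
    have "integrable lebesgue (\<lambda>x. s * (indicator (A \<inter> ?U) x * d x))"
      using A by (intro integrable_mult_right int') auto
    then have i: "integrable lebesgue ?f" by (simp add: mult.left_commute)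
    have "(LINT x|lebesgue. ?f x) = s * (LINT x|lebesgue. indicator (A \<inter> ?U) x * d x)"
      by (simp add: mult.left_commute)
    then have "(LINT x|lebesgue. ?f x) = 0" using A0[OF A] by simp
    moreover have "AE x in lebesgue. 0 \<le> ?f x"
      using dd'' s by (auto simp: indicator_def elim!: eventually_mono)
    ultimately have "AE x in lebesgue. ?f x = 0"
      using integral_nonneg_eq_0_iff_AE[OF i] by simp
    then show ?thesis using s1 by (auto simp: indicator_def elim!: eventually_mono)
  qed
  have "{x. 0 \<le> d' x} \<in> sets borel" "{x. 0 \<ge> d' x} \<in> sets borel"
    using d' by (auto simp: measurable_lborel1)
  from sgn[OF this(1), of 1] sgn[OF this(2), of "-1"]
  have "AE x in lebesgue. indicator ({x. 0 \<le> d' x} \<inter> ?U) x * d x = 0"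
    "AE x in lebesgue. indicator ({x. 0 \<ge> d' x} \<inter> ?U) x * d x = 0"
    by auto
  then show ?thesis
    by eventually_elim (auto simp: indicator_def split: if_splits)
qed

text \<open>By dominated convergence along \<open>box_bump\<close> the hypothesis passes from test functions to indicators of
  boxes whose closure lies in \<open>\<Omega>\<close>, and countably many closed boxes cover \<open>\<Omega>\<close>.\<close>

lemma fundamental_lemma_calculus_of_variations:
  fixes \<Omega> :: "(real^'n::finite) set"
  assumes \<Omega>: "open \<Omega>" and int: "integrable (lebesgue_on \<Omega>) d"
    and zero: "\<And>\<psi>. \<psi> \<in> test_functions \<Omega> \<Longrightarrow> (LINT x|lebesgue_on \<Omega>. d x * \<psi> x) = 0"
  shows "AE x in lebesgue_on \<Omega>. d x = 0"
proof -
  have \<Omega>L: "\<Omega> \<in> sets lebesgue" using \<Omega> by auto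
  define D where "D x = indicator \<Omega> x * d x" for x
  have D: "integrable lebesgue D"
    using int \<Omega>L by (simp add: D_def[abs_def] integral_lebesgue_on_indicator)
  have [measurable]: "D \<in> borel_measurable lebesgue" using D by auto
  have bump_meas[measurable]: "box_bump p q m \<in> borel_measurable lebesgue" for p q :: "real^'n" and m
  proof -
    have "smooth_fun (box_bump p q m)"
      using box_bump_test_function[of p q UNIV m] by (simp add: test_functions_def)
    then have "box_bump p q m differentiable (at x)" for x
      unfolding smooth_fun_def by (metis iter_partial.simps(1))
    then have "continuous_on UNIV (box_bump p q m)"
      by (simp add: continuous_at_imp_continuous_on differentiable_imp_continuous_within)
    then show ?thesis by (simp add: borel_measurable_continuous_onI measurable_completion)
  qed
  have box0: "(LINT x|lebesgue. indicator (box p q) x * D x) = 0" if "cbox p q \<subseteq> \<Omega>" for p q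
  proof (rule LIMSEQ_unique)
    show "(\<lambda>m. LINT x|lebesgue. box_bump p q m x * D x) \<longlonglongrightarrow> (LINT x|lebesgue. indicator (box p q) x * D x)"
    proof (rule integral_dominated_convergence[where w="\<lambda>x. norm (D x)"])
      show "AE x in lebesgue. (\<lambda>m. box_bump p q m x * D x) \<longlonglongrightarrow> indicator (box p q) x * D x"
        by (intro AE_I2 tendsto_mult box_bump_tendsto tendsto_const)
      show "AE x in lebesgue. norm (box_bump p q m x * D x) \<le> norm (D x)" for m
        using box_bump_bounds[of p q m] by (auto simp: abs_mult intro!: mult_left_le_one_le)
      show "(\<lambda>x. indicator (box p q) x * D x) \<in> borel_measurable lebesgue"
        by (intro borel_measurable_times borel_measurable_indicator) auto
    qed (use D in auto)
    have "(LINT x|lebesgue. box_bump p q m x * D x) = 0" for m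
      using zero[OF box_bump_test_function[OF that, of m]] \<Omega>L
      by (simp add: integral_lebesgue_on_indicator D_def mult_ac)
    then show "(\<lambda>m. LINT x|lebesgue. box_bump p q m x * D x) \<longlonglongrightarrow> 0" by simp
  qed
  obtain \<D> where \<D>: "countable \<D>" "\<D> \<subseteq> Pow \<Omega>" "\<And>X. X \<in> \<D> \<Longrightarrow> \<exists>a b. X = cbox a b" "\<Union>\<D> = \<Omega>"
    using open_countable_Union_open_cbox[OF \<Omega>] by blast
  have "AE x in lebesgue. x \<in> X \<longrightarrow> D x = 0" if "X \<in> \<D>" for X
  proof -
    obtain p q where X: "X = cbox p q" using \<D>(3) \<open>X \<in> \<D>\<close> by blast
    have "AE x in lebesgue. x \<in> box p q \<longrightarrow> D x = 0"
    proof (rule box_integrals_zero_imp_AE_zero[OF D])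
      fix r s assume rs: "box r s \<subseteq> box p q"
      show "(LINT x|lebesgue. indicator (box r s) x * D x) = 0"
      proof (cases "box r s = {}")
        case False
        then have "cbox r s \<subseteq> closure (box p q)"
          using rs by (metis closure_box closure_mono)
        then have "cbox r s \<subseteq> \<Omega>"
          using \<D>(2) \<open>X \<in> \<D>\<close> X box_subset_cbox[of p q] closure_minimal[OF _ closed_cbox] by blast
        then show ?thesis by (rule box0)
      qed simp
    qed
    moreover have "AE x in lebesgue. x \<notin> cbox p q - box p q"
      by (intro AE_not_in) (simp add: negligible_iff_null_sets[symmetric] negligible_frontier_interval)
    ultimately show ?thesis unfolding X by eventually_elim auto
  qed
  then have "AE x in lebesgue. \<forall>X\<in>\<D>. x \<in> X \<longrightarrow> D x = 0"
    by (subst AE_ball_countable[OF \<D>(1)]) blast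
  then have "AE x in lebesgue. x \<in> \<Omega> \<longrightarrow> d x = 0"
    using \<D>(4) by (auto simp: D_def indicator_def elim!: eventually_mono)
  then show ?thesis using \<Omega>L by (simp add: AE_restrict_space_iff)
qed

section \<open>Square integrable functions\<close>

lemma integrable_mult_L2:
  assumes "f \<in> L2_space M" "g \<in> L2_space M"
  shows "integrable M (\<lambda>x. f x * g x)"
proof (rule Bochner_Integration.integrable_bound)
  show "integrable M (\<lambda>x. (f x)\<^sup>2 + (g x)\<^sup>2)"
    using assms by (simp add: L2_space_def)
  have "\<bar>s * t\<bar> \<le> s\<^sup>2 + t\<^sup>2" for s t :: real
  proof -
    have "2 * (\<bar>s\<bar> * \<bar>t\<bar>) \<le> s\<^sup>2 + t\<^sup>2"
      using sum_squares_bound[of "\<bar>s\<bar>" "\<bar>t\<bar>"] by (simp add: mult.assoc)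
    moreover have "0 \<le> \<bar>s\<bar> * \<bar>t\<bar>" by simp
    ultimately show ?thesis unfolding abs_mult by linarith
  qed
  then show "AE x in M. norm (f x * g x) \<le> norm ((f x)\<^sup>2 + (g x)\<^sup>2)"
    by (intro AE_I2) (simp add: order_trans[OF _ abs_ge_self])
qed (use assms in \<open>auto simp: L2_space_def\<close>)

lemma L2_space_add:
  assumes "f \<in> L2_space M" "g \<in> L2_space M"
  shows "(\<lambda>x. f x + g x) \<in> L2_space M"
proof -
  have "integrable M (\<lambda>x. (f x)\<^sup>2 + (g x)\<^sup>2 + 2 * (f x * g x))"
    using assms integrable_mult_L2[OF assms] by (auto simp: L2_space_def)
  then show ?thesis
    using assms unfolding L2_space_def
    by (simp add: power2_sum mult.assoc borel_measurable_add)
qed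

lemma L2_space_scale: "f \<in> L2_space M \<Longrightarrow> (\<lambda>x. c * f x) \<in> L2_space M"
  by (simp add: L2_space_def power_mult_distrib borel_measurable_times)

lemma L2_space_diff:
  assumes "f \<in> L2_space M" "g \<in> L2_space M"
  shows "(\<lambda>x. f x - g x) \<in> L2_space M"
  using L2_space_add[OF assms(1) L2_space_scale[OF assms(2), of "-1"]] by simp

lemma L2_space_cong:
  assumes "\<And>x. x \<in> space M \<Longrightarrow> f x = g x" "g \<in> L2_space M"
  shows "f \<in> L2_space M"
proof -
  have "f \<in> borel_measurable M \<longleftrightarrow> g \<in> borel_measurable M"
    using assms(1) by (intro measurable_cong)
  moreover have "integrable M (\<lambda>x. (f x)\<^sup>2) \<longleftrightarrow> integrable M (\<lambda>x. (g x)\<^sup>2)"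
    using assms(1) by (intro Bochner_Integration.integrable_cong) auto
  ultimately show ?thesis using assms(2) by (simp add: L2_space_def)
qed

lemma integrable_L2:
  assumes "finite_measure M" "f \<in> L2_space M"
  shows "integrable M f"
  using integrable_mult_L2[OF assms(2), of "\<lambda>_. 1"] assms(1)
  by (simp add: L2_space_def finite_measure.integrable_const)

lemma continuous_measurable_lebesgue_on:
  "continuous_on UNIV f \<Longrightarrow> (f :: 'a::euclidean_space \<Rightarrow> real) \<in> borel_measurable (lebesgue_on S)"
  by (intro measurable_restrict_space1 measurable_completion) (simp add: borel_measurable_continuous_onI)

lemma continuous_L2_lebesgue_on:
  fixes f :: "'a::euclidean_space \<Rightarrow> real"
  assumes "continuous_on UNIV f" "bounded S" "S \<in> sets lebesgue"
  shows "f \<in> L2_space (lebesgue_on S)"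
proof -
  have "S \<in> lmeasurable" using assms bounded_set_imp_lmeasurable by blast
  then have fin: "finite_measure (lebesgue_on S)" by (rule finite_measure_lebesgue_on)
  have "compact (f ` closure S)"
    using assms by (intro compact_continuous_image) (auto intro: continuous_on_subset)
  then obtain B where "\<And>x. x \<in> closure S \<Longrightarrow> norm (f x) \<le> B"
    by (fastforce dest!: compact_imp_bounded simp: bounded_iff)
  then have B: "\<And>x. x \<in> S \<Longrightarrow> \<bar>f x\<bar> \<le> B" using closure_subset by force
  have "integrable (lebesgue_on S) (\<lambda>x. (f x)\<^sup>2)"
  proof (rule finite_measure.integrable_const_bound[OF fin, where B="B\<^sup>2"])
    show "AE x in lebesgue_on S. norm ((f x)\<^sup>2) \<le> B\<^sup>2"
    proof (rule AE_I2)
      fix x assume "x \<in> space (lebesgue_on S)"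
      then have "\<bar>f x\<bar>\<^sup>2 \<le> B\<^sup>2" using B by (intro power_mono) auto
      then show "norm ((f x)\<^sup>2) \<le> B\<^sup>2" by simp
    qed
  qed (intro borel_measurable_power continuous_measurable_lebesgue_on assms(1))
  then show ?thesis
    using continuous_measurable_lebesgue_on[OF assms(1)] by (simp add: L2_space_def)
qed

section \<open>Partial derivatives of smooth functions\<close>

lemma smooth_fun_differentiable: "smooth_fun f \<Longrightarrow> f differentiable (at x)"
  unfolding smooth_fun_def by (metis iter_partial.simps(1))

lemma smooth_fun_continuous: "smooth_fun f \<Longrightarrow> continuous_on UNIV f"
  by (simp add: continuous_at_imp_continuous_on differentiable_imp_continuous_within smooth_fun_differentiable)

lemma smooth_fun_iter_partial: "smooth_fun f \<Longrightarrow> smooth_fun (iter_partial is f)"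
proof -
  assume f: "smooth_fun f"
  have "iter_partial js (iter_partial is f) = iter_partial (js @ is) f" for js
    by (induction js) auto
  then show ?thesis using f by (simp add: smooth_fun_def)
qed

abbreviation partial :: "(real^'n::finite \<Rightarrow> real) \<Rightarrow> 'n \<Rightarrow> real^'n \<Rightarrow> real"
  where "partial f i x \<equiv> frechet_derivative f (at x) (axis i 1)"

lemma smooth_fun_partial: "smooth_fun f \<Longrightarrow> smooth_fun (\<lambda>x. partial f i x)"
  using smooth_fun_iter_partial[of f "[i]"] by simp

lemma partial_mult:
  fixes f g :: "real^'n::finite \<Rightarrow> real"
  assumes "f differentiable (at x)" "g differentiable (at x)"
  shows "(\<lambda>x. f x * g x) differentiable (at x)"
    "partial (\<lambda>x. f x * g x) i x = f x * partial g i x + partial f i x * g x"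
proof -
  have "((\<lambda>x. f x * g x) has_derivative
      (\<lambda>h. f x * frechet_derivative g (at x) h + frechet_derivative f (at x) h * g x)) (at x)"
    using assms by (intro has_derivative_mult) (auto simp flip: frechet_derivative_works)
  from frechet_derivative_at[OF this, symmetric] this
  show "(\<lambda>x. f x * g x) differentiable (at x)"
    "partial (\<lambda>x. f x * g x) i x = f x * partial g i x + partial f i x * g x"
    by (auto simp: differentiable_def)
qed

lemma partial_add:
  fixes f g :: "real^'n::finite \<Rightarrow> real"
  assumes "f differentiable (at x)" "g differentiable (at x)"
  shows "partial (\<lambda>x. f x + g x) i x = partial f i x + partial g i x"
proof -
  have "((\<lambda>x. f x + g x) has_derivative
      (\<lambda>h. frechet_derivative f (at x) h + frechet_derivative g (at x) h)) (at x)"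
    using assms by (intro has_derivative_add) (auto simp flip: frechet_derivative_works)
  from frechet_derivative_at[OF this, symmetric] show ?thesis by simp
qed

lemma partial_scale:
  fixes f :: "real^'n::finite \<Rightarrow> real"
  assumes "f differentiable (at x)"
  shows "partial (\<lambda>x. c * f x) i x = c * partial f i x"
proof -
  have "((\<lambda>x. c * f x) has_derivative (\<lambda>h. c * frechet_derivative f (at x) h)) (at x)"
    using assms by (intro has_derivative_mult_right) (auto simp flip: frechet_derivative_works)
  from frechet_derivative_at[OF this, symmetric] show ?thesis by simp
qed

lemma partial_diff:
  fixes f g :: "real^'n::finite \<Rightarrow> real"
  assumes "f differentiable (at x)" "g differentiable (at x)"
  shows "(\<lambda>x. f x - g x) differentiable (at x)"
    "partial (\<lambda>x. f x - g x) i x = partial f i x - partial g i x"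
proof -
  have "((\<lambda>x. f x - g x) has_derivative
      (\<lambda>h. frechet_derivative f (at x) h - frechet_derivative g (at x) h)) (at x)"
    using assms by (intro has_derivative_diff) (auto simp flip: frechet_derivative_works)
  from frechet_derivative_at[OF this, symmetric] this
  show "(\<lambda>x. f x - g x) differentiable (at x)"
    "partial (\<lambda>x. f x - g x) i x = partial f i x - partial g i x"
    by (auto simp: differentiable_def)
qed

lemma smooth_fun_diff:
  assumes f: "smooth_fun f" and g: "smooth_fun g"
  shows "smooth_fun (\<lambda>x. f x - g x)"
proof -
  note diff = smooth_fun_differentiable[OF smooth_fun_iter_partial]
  have "iter_partial is (\<lambda>x. f x - g x) = (\<lambda>x. iter_partial is f x - iter_partial is g x)" for "is"
    using diff[OF f] diff[OF g] by (induction "is") (auto simp: partial_diff(2))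
  then show ?thesis
    unfolding smooth_fun_def using diff[OF f] diff[OF g] by (auto intro!: partial_diff(1))
qed

lemma partial_eq_0_outside:
  fixes F :: "real^'n::finite \<Rightarrow> real"
  assumes "closed K" "\<And>x. x \<notin> K \<Longrightarrow> F x = 0" "x \<notin> K"
  shows "partial F i x = 0"
proof -
  have "(F has_derivative (\<lambda>h. 0)) (at x)"
    by (rule has_derivative_transform_within_open[where f="\<lambda>x. 0" and s="-K"]) (use assms in auto)
  from frechet_derivative_at[OF this, symmetric] show ?thesis by simp
qed

lemma has_derivative_along_line:
  fixes F :: "real^'n::finite \<Rightarrow> real"
  assumes "\<And>x. F differentiable (at x)"
  shows "((\<lambda>s. F (x + s *\<^sub>R v)) has_real_derivative frechet_derivative F (at (x + s *\<^sub>R v)) v) (at s)"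
proof -
  have F: "(F has_derivative frechet_derivative F (at (x + s *\<^sub>R v))) (at (x + s *\<^sub>R v))"
    using assms frechet_derivative_works by blast
  have l: "linear (frechet_derivative F (at (x + s *\<^sub>R v)))"
    using F has_derivative_linear by blast
  have "((\<lambda>s. x + s *\<^sub>R v) has_derivative (\<lambda>t. t *\<^sub>R v)) (at s)"
    by (auto intro!: derivative_eq_intros)
  from has_derivative_compose[OF this F]
  have "((\<lambda>s. F (x + s *\<^sub>R v)) has_derivative (\<lambda>t. frechet_derivative F (at (x + s *\<^sub>R v)) (t *\<^sub>R v))) (at s)" .
  moreover have "(\<lambda>t. frechet_derivative F (at (x + s *\<^sub>R v)) (t *\<^sub>R v))
     = (*) (frechet_derivative F (at (x + s *\<^sub>R v)) v)"
    using l by (auto simp: linear_scale)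
  ultimately show ?thesis by (simp add: has_field_derivative_def)
qed

section \<open>Integration by parts\<close>

lemma lborel_integral_translate:
  fixes f :: "'a::euclidean_space \<Rightarrow> real"
  assumes "f \<in> borel_measurable borel"
  shows "(LINT x|lborel. f (x + c)) = (LINT x|lborel. f x)"
    and "integrable lborel f \<Longrightarrow> integrable lborel (\<lambda>x. f (x + c))"
proof -
  have d: "distr lborel borel ((+) c) = lborel" by (rule lborel_distr_plus)
  show "(LINT x|lborel. f (x + c)) = (LINT x|lborel. f x)"
    using assms by (subst d[symmetric], subst integral_distr) (auto simp: add.commute)
  show "integrable lborel f \<Longrightarrow> integrable lborel (\<lambda>x. f (x + c))"
    using assms by (subst (asm) d[symmetric], subst (asm) integrable_distr_eq) (auto simp: add.commute)
qed

lemma continuous_compact_support_integrable: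
  fixes f :: "'a::euclidean_space \<Rightarrow> real"
  assumes "continuous_on UNIV f" "compact K" "\<And>x. x \<notin> K \<Longrightarrow> f x = 0"
  shows "integrable lborel f"
proof -
  have "set_integrable lborel K f"
    using assms borel_integrable_compact[of K f] continuous_on_subset
    unfolding set_integrable_def by (metis (no_types, lifting) subset_UNIV Bochner_Integration.integrable_cong
        indicator_simps mult_1 mult_zero_left real_scaleR_def)
  moreover have "(\<lambda>x. indicator K x *\<^sub>R f x) = f"
    using assms(3) by (fastforce simp: fun_eq_iff indicator_def)
  ultimately show ?thesis by (simp add: set_integrable_def)
qed

text \<open>The integral of the difference quotient in direction \<open>i\<close> vanishes by translation invariance of the
  measure; the mean value theorem supplies the dominating function for passing to the limit.\<close>

lemma integral_partial_compact_support:
  fixes F :: "real^'n::finite \<Rightarrow> real"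
  assumes diff: "\<And>x. F differentiable (at x)"
    and cont: "continuous_on UNIV (\<lambda>x. partial F i x)"
    and K: "compact K" "\<And>x. x \<notin> K \<Longrightarrow> F x = 0"
  shows "(LINT x|lborel. partial F i x) = 0"
proof -
  let ?e = "axis i 1 :: real^'n"
  define s where "s n = 1 / (real n + 1)" for n
  have s: "0 < s n" "s n \<le> 1" for n by (auto simp: s_def)
  have s0: "filterlim s (at 0) sequentially"
  proof -
    have "s \<longlonglongrightarrow> 0" unfolding s_def
      using LIMSEQ_inverse_real_of_nat by (simp add: inverse_eq_divide add.commute)
    moreover have "s n \<noteq> 0" for n using s(1)[of n] by simp
    ultimately show ?thesis by (simp add: filterlim_at)
  qed
  have contF: "continuous_on UNIV F"
    using diff by (simp add: continuous_at_imp_continuous_on differentiable_imp_continuous_within)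
  have [measurable]: "F \<in> borel_measurable borel" "(\<lambda>x. partial F i x) \<in> borel_measurable borel"
    using contF cont by (auto intro: borel_measurable_continuous_onI)
  have F: "integrable lborel F"
    using contF K by (rule continuous_compact_support_integrable)
  obtain B where B: "\<And>x. \<bar>partial F i x\<bar> \<le> B" "0 \<le> B"
  proof -
    have "compact ((\<lambda>x. partial F i x) ` K)"
      using cont K by (intro compact_continuous_image) (auto intro: continuous_on_subset)
    then obtain B where B: "\<And>x. x \<in> K \<Longrightarrow> \<bar>partial F i x\<bar> \<le> B"
      by (fastforce dest!: compact_imp_bounded simp: bounded_iff)
    have "\<bar>partial F i x\<bar> \<le> max B 0" for x
      using B[of x] partial_eq_0_outside[OF compact_imp_closed[OF K(1)] K(2), where x=x and i=i]
      by (cases "x \<in> K") auto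
    then show ?thesis by (intro that[of "max B 0"]) auto
  qed
  obtain r where r: "\<forall>x\<in>K. norm x \<le> r"
    using compact_imp_bounded[OF K(1)] by (auto simp: bounded_iff)
  let ?D = "\<lambda>n x. (F (x + s n *\<^sub>R ?e) - F x) / s n"
  have lim: "(\<lambda>n. LINT x|lborel. ?D n x) \<longlonglongrightarrow> (LINT x|lborel. partial F i x)"
  proof (rule integral_dominated_convergence[where w="\<lambda>x. indicator (cball 0 (r + 1)) x * B"])
    show "integrable lborel (\<lambda>x. indicator (cball 0 (r + 1)) x * B)"
      using emeasure_bounded_finite[OF bounded_cball] by (intro integrable_mult_left integrable_real_indicator) auto
    show "AE x in lborel. (\<lambda>n. ?D n x) \<longlonglongrightarrow> partial F i x"
    proof (rule AE_I2)
      fix x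
      have "(\<lambda>t. (F (x + t *\<^sub>R ?e) - F x) / t) \<midarrow>0\<rightarrow> partial F i x"
        using has_derivative_along_line[OF diff, of x ?e 0] by (simp add: DERIV_def)
      then show "(\<lambda>n. ?D n x) \<longlonglongrightarrow> partial F i x"
        using s0 by (rule filterlim_compose)
    qed
    show "AE x in lborel. norm (?D n x) \<le> indicator (cball 0 (r + 1)) x * B" for n
    proof (rule AE_I2)
      fix x
      show "norm (?D n x) \<le> indicator (cball 0 (r + 1)) x * B"
      proof (cases "x \<in> cball 0 (r + 1)")
        case True
        obtain t where "F (x + s n *\<^sub>R ?e) - F (x + 0 *\<^sub>R ?e) = (s n - 0) * partial F i (x + t *\<^sub>R ?e)"
          using MVT2[OF s(1)[of n], of "\<lambda>t. F (x + t *\<^sub>R ?e)" "\<lambda>t. partial F i (x + t *\<^sub>R ?e)"]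
            has_derivative_along_line[OF diff] by blast
        then have "?D n x = partial F i (x + t *\<^sub>R ?e)" using s(1)[of n] by simp
        then show ?thesis using True B by simp
      next
        case False
        then have nx: "norm x > r + 1" by simp
        have "norm x \<le> norm (x + s n *\<^sub>R ?e) + norm (s n *\<^sub>R ?e)"
          by (metis add_diff_cancel_right' norm_triangle_ineq4)
        then have "norm (x + s n *\<^sub>R ?e) > r" using nx s[of n] by simp
        then have "x + s n *\<^sub>R ?e \<notin> K" "x \<notin> K" using r nx by force+
        then show ?thesis using K(2) False by simp
      qed
    qed
  qed measurable
  have "(LINT x|lborel. ?D n x) = 0" for n
    using lborel_integral_translate[of F "s n *\<^sub>R ?e"] F by simp
  with lim show ?thesis by (simp only: LIMSEQ_const_iff)
qed

section \<open>Weak derivatives of smooth functions\<close>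

lemma test_functionD:
  assumes "\<psi> \<in> test_functions \<Omega>"
  shows "smooth_fun \<psi>" and "\<exists>K. compact K \<and> K \<subseteq> \<Omega> \<and> (\<forall>x. x \<notin> K \<longrightarrow> \<psi> x = 0)"
    and "x \<notin> \<Omega> \<Longrightarrow> \<psi> x = 0" "open \<Omega> \<Longrightarrow> x \<notin> \<Omega> \<Longrightarrow> partial \<psi> i x = 0"
proof -
  show "smooth_fun \<psi>" and ex: "\<exists>K. compact K \<and> K \<subseteq> \<Omega> \<and> (\<forall>x. x \<notin> K \<longrightarrow> \<psi> x = 0)"
    using assms by (auto simp: test_functions_def)
  then obtain K where K: "compact K" "K \<subseteq> \<Omega>" "\<And>x. x \<notin> K \<Longrightarrow> \<psi> x = 0" by blast
  show "x \<notin> \<Omega> \<Longrightarrow> \<psi> x = 0" "x \<notin> \<Omega> \<Longrightarrow> partial \<psi> i x = 0"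
    using K partial_eq_0_outside[of K \<psi> x i] compact_imp_closed by blast+
qed

lemma smooth_L2:
  "smooth_fun f \<Longrightarrow> bounded \<Omega> \<Longrightarrow> open \<Omega> \<Longrightarrow> f \<in> L2_space (lebesgue_on \<Omega>)"
  by (intro continuous_L2_lebesgue_on smooth_fun_continuous) auto

definition unit_index :: "'n \<Rightarrow> 'n \<Rightarrow> nat"
  where "unit_index i = (\<lambda>j. if j = i then 1 else 0)"

lemma count_list_unit_index:
  assumes "\<forall>j. count_list is j = unit_index i j"
  shows "is = [i]"
proof (cases "is")
  case (Cons j js)
  have "j = i" using assms[rule_format, of j] Cons by (auto simp: unit_index_def split: if_splits)
  moreover have "count_list js l = 0" for l
    using assms[rule_format, of l] Cons \<open>j = i\<close> by (auto simp: unit_index_def split: if_splits)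
  then have "js = []" by (metis count_list_0_iff list.set_intros(1) neq_Nil_conv)
  ultimately show ?thesis using Cons by simp
next
  case Nil
  then show ?thesis using assms[rule_format, of i] by (simp add: unit_index_def)
qed

text \<open>Integration by parts, i.e. \<open>integral_partial_compact_support\<close> for the product of \<open>f\<close> with a test
  function.\<close>

lemma has_weak_deriv_partial:
  fixes \<Omega> :: "(real^'n::finite) set"
  assumes f: "smooth_fun f" and \<Omega>: "open \<Omega>"
  shows "has_weak_deriv \<Omega> (unit_index i) f (partial f i)"
  unfolding has_weak_deriv_def
proof (intro ballI allI impI)
  fix \<psi> "is" assume \<psi>: "\<psi> \<in> test_functions \<Omega>" and "\<forall>j. count_list is j = unit_index i j"
  then have "is": "is = [i]" by (simp add: count_list_unit_index)
  note t = test_functionD[OF \<psi>]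
  obtain K where K: "compact K" "K \<subseteq> \<Omega>" "\<And>x. x \<notin> K \<Longrightarrow> \<psi> x = 0" using t(2) by blast
  have cont: "continuous_on UNIV f" "continuous_on UNIV \<psi>" "continuous_on UNIV (partial f i)"
      "continuous_on UNIV (partial \<psi> i)"
    using f t(1) smooth_fun_partial smooth_fun_continuous by blast+
  have p: "partial (\<lambda>x. f x * \<psi> x) i x = f x * partial \<psi> i x + partial f i x * \<psi> x" for x
    using f t(1) by (intro partial_mult smooth_fun_differentiable)
  have int: "integrable lborel (\<lambda>x. f x * partial \<psi> i x)" "integrable lborel (\<lambda>x. partial f i x * \<psi> x)"
    using K cont partial_eq_0_outside[OF compact_imp_closed[OF K(1)] K(3)]
    by (auto intro!: continuous_compact_support_integrable[OF _ K(1)] continuous_intros)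
  have "(LINT x|lborel. partial (\<lambda>x. f x * \<psi> x) i x) = 0"
  proof (rule integral_partial_compact_support[OF _ _ K(1)])
    show "(\<lambda>x. f x * \<psi> x) differentiable (at x)" for x
      using f t(1) by (intro partial_mult smooth_fun_differentiable)
    show "continuous_on UNIV (\<lambda>x. partial (\<lambda>x. f x * \<psi> x) i x)"
      unfolding p using cont by (intro continuous_intros)
  qed (simp add: K(3))
  then have "(LINT x|lborel. f x * partial \<psi> i x) = - (LINT x|lborel. partial f i x * \<psi> x)"
    unfolding p using int by (simp add: Bochner_Integration.integral_add)
  moreover have "(LINT x|lborel. g x) = (LINT x|lebesgue_on \<Omega>. g x)"
    if "integrable lborel g" "\<And>x. x \<notin> \<Omega> \<Longrightarrow> g x = 0" for g :: "real^'n \<Rightarrow> real"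
  proof -
    have "(LINT x|lebesgue_on \<Omega>. g x) = (LINT x|lebesgue. indicator \<Omega> x * g x)"
      using \<Omega> by (intro integral_lebesgue_on_indicator) auto
    also have "(\<lambda>x. indicator \<Omega> x * g x) = g"
      using that(2) by (fastforce simp: fun_eq_iff indicator_def)
    finally show ?thesis using that(1) by (simp add: integral_completion borel_measurable_integrable)
  qed
  ultimately have "(LINT x|lebesgue_on \<Omega>. f x * partial \<psi> i x) = - (LINT x|lebesgue_on \<Omega>. partial f i x * \<psi> x)"
    using int t(3) t(4)[OF \<Omega>] by simp
  then show "(LINT x|lebesgue_on \<Omega>. f x * iter_partial is \<psi> x) =
      (-1) ^ length is * (LINT x|lebesgue_on \<Omega>. partial f i x * \<psi> x)"
    by (simp add: "is")
qed

lemma has_weak_deriv_0: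
  fixes f :: "real^'n::finite \<Rightarrow> real"
  shows "has_weak_deriv \<Omega> (\<lambda>_. 0) f f"
proof -
  have "\<forall>j. count_list is j = 0 \<Longrightarrow> is = []" for "is" :: "'n list"
  proof (cases "is")
    case (Cons a js)
    assume "\<forall>j. count_list is j = 0"
    then have "count_list is a = 0" by blast
    then show ?thesis using Cons by simp
  qed simp
  then show ?thesis unfolding has_weak_deriv_def by fastforce
qed

lemma has_weak_deriv_diff:
  assumes "open \<Omega>" "bounded \<Omega>"
    and L2: "w \<in> L2_space (lebesgue_on \<Omega>)" "w' \<in> L2_space (lebesgue_on \<Omega>)"
      "g \<in> L2_space (lebesgue_on \<Omega>)" "g' \<in> L2_space (lebesgue_on \<Omega>)"
    and weak: "has_weak_deriv \<Omega> \<alpha> w g" "has_weak_deriv \<Omega> \<alpha> w' g'"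
  shows "has_weak_deriv \<Omega> \<alpha> (\<lambda>x. w x - w' x) (\<lambda>x. g x - g' x)"
  unfolding has_weak_deriv_def
proof (intro ballI allI impI)
  fix \<psi> "is" assume \<psi>: "\<psi> \<in> test_functions \<Omega>" and "is": "\<forall>j. count_list is j = \<alpha> j"
  have s: "\<psi> \<in> L2_space (lebesgue_on \<Omega>)" "iter_partial is \<psi> \<in> L2_space (lebesgue_on \<Omega>)"
    using test_functionD(1)[OF \<psi>] assms(1,2) smooth_L2 smooth_fun_iter_partial by blast+
  have "(LINT x|lebesgue_on \<Omega>. (w x - w' x) * iter_partial is \<psi> x)
    = (LINT x|lebesgue_on \<Omega>. w x * iter_partial is \<psi> x) - (LINT x|lebesgue_on \<Omega>. w' x * iter_partial is \<psi> x)"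
    using integrable_mult_L2[OF L2(1) s(2)] integrable_mult_L2[OF L2(2) s(2)]
    by (simp add: left_diff_distrib)
  moreover have "(LINT x|lebesgue_on \<Omega>. (g x - g' x) * \<psi> x)
    = (LINT x|lebesgue_on \<Omega>. g x * \<psi> x) - (LINT x|lebesgue_on \<Omega>. g' x * \<psi> x)"
    using integrable_mult_L2[OF L2(3) s(1)] integrable_mult_L2[OF L2(4) s(1)]
    by (simp add: left_diff_distrib)
  moreover have "(LINT x|lebesgue_on \<Omega>. w x * iter_partial is \<psi> x) =
        (-1) ^ length is * (LINT x|lebesgue_on \<Omega>. g x * \<psi> x)"
    "(LINT x|lebesgue_on \<Omega>. w' x * iter_partial is \<psi> x) =
        (-1) ^ length is * (LINT x|lebesgue_on \<Omega>. g' x * \<psi> x)"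
    using weak \<psi> "is" unfolding has_weak_deriv_def by blast+
  ultimately show "(LINT x|lebesgue_on \<Omega>. (w x - w' x) * iter_partial is \<psi> x) =
        (-1) ^ length is * (LINT x|lebesgue_on \<Omega>. (g x - g' x) * \<psi> x)"
    by (simp add: right_diff_distrib)
qed

text \<open>Read along one order of differentiation \<open>is\<close> that realises \<open>\<alpha>\<close>, the identities defining the two weak
  derivatives have the same left-hand side, so \<open>g - h\<close> annihilates all test functions.\<close>

lemma weak_deriv_unique:
  assumes \<Omega>: "open \<Omega>" "bounded \<Omega>" and "is": "\<forall>j. count_list is j = \<alpha> j"
    and L2: "g \<in> L2_space (lebesgue_on \<Omega>)" "h \<in> L2_space (lebesgue_on \<Omega>)"
    and weak: "has_weak_deriv \<Omega> \<alpha> w g" "has_weak_deriv \<Omega> \<alpha> w h"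
  shows "AE x in lebesgue_on \<Omega>. g x = h x"
proof -
  have fin: "finite_measure (lebesgue_on \<Omega>)"
    using \<Omega> by (intro finite_measure_lebesgue_on bounded_set_imp_lmeasurable) auto
  have "AE x in lebesgue_on \<Omega>. g x - h x = 0"
  proof (rule fundamental_lemma_calculus_of_variations[OF \<Omega>(1)])
    show "integrable (lebesgue_on \<Omega>) (\<lambda>x. g x - h x)"
      using L2 by (intro integrable_L2 fin L2_space_diff)
    fix \<psi> assume \<psi>: "\<psi> \<in> test_functions \<Omega>"
    have s: "\<psi> \<in> L2_space (lebesgue_on \<Omega>)"
      using test_functionD(1)[OF \<psi>] \<Omega> smooth_L2 by blast
    have "(LINT x|lebesgue_on \<Omega>. w x * iter_partial is \<psi> x)
        = (-1) ^ length is * (LINT x|lebesgue_on \<Omega>. g x * \<psi> x)"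
      "(LINT x|lebesgue_on \<Omega>. w x * iter_partial is \<psi> x)
        = (-1) ^ length is * (LINT x|lebesgue_on \<Omega>. h x * \<psi> x)"
      using weak \<psi> "is" unfolding has_weak_deriv_def by blast+
    then have "(LINT x|lebesgue_on \<Omega>. g x * \<psi> x) = (LINT x|lebesgue_on \<Omega>. h x * \<psi> x)"
      by simp
    then show "(LINT x|lebesgue_on \<Omega>. (g x - h x) * \<psi> x) = 0"
      using integrable_mult_L2[OF L2(1) s] integrable_mult_L2[OF L2(2) s]
      by (simp add: left_diff_distrib)
  qed
  then show ?thesis by (auto elim!: eventually_mono)
qed

lemma finite_multi_indices: "finite (multi_indices j :: ('n::finite \<Rightarrow> nat) set)"
proof (rule finite_subset)
  show "multi_indices j \<subseteq> (UNIV :: 'n set) \<rightarrow>\<^sub>E {..nat j}"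
  proof
    fix \<alpha> :: "'n \<Rightarrow> nat" assume "\<alpha> \<in> multi_indices j"
    then have "(\<Sum>i\<in>UNIV. \<alpha> i) \<le> nat j"
      unfolding multi_indices_def mem_Collect_eq by linarith
    moreover have "\<alpha> i \<le> (\<Sum>i\<in>UNIV. \<alpha> i)" for i
      by (rule member_le_sum) auto
    ultimately have "\<alpha> i \<le> nat j" for i by (rule order_trans[rotated])
    then show "\<alpha> \<in> UNIV \<rightarrow>\<^sub>E {..nat j}" by auto
  qed
qed (simp add: finite_PiE)

lemma weak_deriv_L2_le_sobolev_norm:
  fixes \<Omega> :: "(real^'n::finite) set"
  assumes "\<alpha> \<in> multi_indices 1"
  shows "(LINT x|lebesgue_on \<Omega>. (weak_deriv \<Omega> \<alpha> v x)\<^sup>2) \<le> (sobolev_norm \<Omega> 1 v)\<^sup>2"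
proof -
  have "(LINT x|lebesgue_on \<Omega>. (weak_deriv \<Omega> \<alpha> v x)\<^sup>2)
      \<le> (\<Sum>\<alpha>\<in>multi_indices (int 1). LINT x|lebesgue_on \<Omega>. (weak_deriv \<Omega> \<alpha> v x)\<^sup>2)"
    using assms by (intro member_le_sum finite_multi_indices) auto
  also have "\<dots> = (sobolev_norm \<Omega> 1 v)\<^sup>2"
    unfolding sobolev_norm_def by (simp add: sum_nonneg)
  finally show ?thesis .
qed

lemma weak_deriv_of_difference:
  fixes \<Omega> :: "(real^'n::finite) set"
  assumes \<Omega>: "open \<Omega>" "bounded \<Omega>" and w: "w \<in> sobolev \<Omega> 1" and \<alpha>: "\<alpha> \<in> multi_indices 1"
    and sm: "smooth_fun \<psi>" "smooth_fun \<psi>'" "has_weak_deriv \<Omega> \<alpha> \<psi> \<psi>'"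
  shows "weak_deriv \<Omega> \<alpha> (w - \<psi>) \<in> L2_space (lebesgue_on \<Omega>)"
    "has_weak_deriv \<Omega> \<alpha> (w - \<psi>) (weak_deriv \<Omega> \<alpha> (w - \<psi>))"
proof -
  have wL2: "w \<in> L2_space (lebesgue_on \<Omega>)" using w by (simp add: sobolev_def)
  obtain g where g: "g \<in> L2_space (lebesgue_on \<Omega>)" "has_weak_deriv \<Omega> \<alpha> w g"
    using w \<alpha> by (auto simp: sobolev_def)
  have "has_weak_deriv \<Omega> \<alpha> (w - \<psi>) (\<lambda>x. g x - \<psi>' x)"
    unfolding fun_diff_def using \<Omega> wL2 g sm smooth_L2 by (intro has_weak_deriv_diff) auto
  moreover have "(\<lambda>x. g x - \<psi>' x) \<in> L2_space (lebesgue_on \<Omega>)"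
    using g \<Omega> sm smooth_L2 by (intro L2_space_diff) auto
  ultimately have "\<exists>g. g \<in> L2_space (lebesgue_on \<Omega>) \<and> has_weak_deriv \<Omega> \<alpha> (w - \<psi>) g" by blast
  from someI_ex[OF this]
  show "weak_deriv \<Omega> \<alpha> (w - \<psi>) \<in> L2_space (lebesgue_on \<Omega>)"
    "has_weak_deriv \<Omega> \<alpha> (w - \<psi>) (weak_deriv \<Omega> \<alpha> (w - \<psi>))"
    unfolding weak_deriv_def by blast+
qed

lemma power2_diff_le: "(s - t)\<^sup>2 \<le> 2 * (s\<^sup>2 + t\<^sup>2)" for s t :: real
  using zero_le_power2[of "s + t"] by (simp add: power2_eq_square algebra_simps)

text \<open>\<open>w\<close> cancels in \<open>(w - \<eta>) - (w - \<psi>)\<close>, so the difference of the chosen weak derivatives of these two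
  functions is a weak derivative of \<open>\<psi> - \<eta>\<close> and by uniqueness agrees with the classical one. The operator
  \<open>D\<close> stands for the identity or for a partial derivative.\<close>

lemma smooth_difference_le_sobolev_norm:
  fixes \<Omega> :: "(real^'n::finite) set"
  assumes \<Omega>: "open \<Omega>" "bounded \<Omega>" and w: "w \<in> sobolev \<Omega> 1"
    and sm: "smooth_fun \<psi>" "smooth_fun \<eta>"
    and \<alpha>: "\<alpha> \<in> multi_indices 1" "\<forall>j. count_list js j = \<alpha> j"
    and D: "\<And>f. smooth_fun f \<Longrightarrow> smooth_fun (D f) \<and> has_weak_deriv \<Omega> \<alpha> f (D f)"
    and D_diff: "D (\<lambda>x. \<psi> x - \<eta> x) = (\<lambda>x. D \<psi> x - D \<eta> x)"
  shows "(LINT x|lebesgue_on \<Omega>. (D (\<lambda>x. \<psi> x - \<eta> x) x)\<^sup>2)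
    \<le> 2 * ((sobolev_norm \<Omega> 1 (w - \<psi>))\<^sup>2 + (sobolev_norm \<Omega> 1 (w - \<eta>))\<^sup>2)"
proof -
  let ?L = "L2_space (lebesgue_on \<Omega>)"
  define p where "p = weak_deriv \<Omega> \<alpha> (w - \<psi>)"
  define q where "q = weak_deriv \<Omega> \<alpha> (w - \<eta>)"
  have p: "p \<in> ?L" "has_weak_deriv \<Omega> \<alpha> (w - \<psi>) p"
    unfolding p_def using weak_deriv_of_difference[OF \<Omega> w \<alpha>(1) sm(1)] D[OF sm(1)] by blast+
  have q: "q \<in> ?L" "has_weak_deriv \<Omega> \<alpha> (w - \<eta>) q"
    unfolding q_def using weak_deriv_of_difference[OF \<Omega> w \<alpha>(1) sm(2)] D[OF sm(2)] by blast+
  have wL2: "w \<in> ?L" using w by (simp add: sobolev_def)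
  have sL2: "\<psi> \<in> ?L" "\<eta> \<in> ?L" "D \<psi> \<in> ?L" "D \<eta> \<in> ?L"
    using sm D smooth_L2[OF _ \<Omega>(2,1)] by auto
  have "has_weak_deriv \<Omega> \<alpha> (\<lambda>x. (w - \<eta>) x - (w - \<psi>) x) (\<lambda>x. q x - p x)"
    using \<Omega> wL2 sL2 p q by (intro has_weak_deriv_diff) (auto simp: fun_diff_def intro: L2_space_diff)
  then have 1: "has_weak_deriv \<Omega> \<alpha> (\<lambda>x. \<psi> x - \<eta> x) (\<lambda>x. q x - p x)" by simp
  have 2: "has_weak_deriv \<Omega> \<alpha> (\<lambda>x. \<psi> x - \<eta> x) (\<lambda>x. D \<psi> x - D \<eta> x)"
    using \<Omega> sL2 sm D by (intro has_weak_deriv_diff) auto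
  have ae: "AE x in lebesgue_on \<Omega>. q x - p x = D \<psi> x - D \<eta> x"
    by (rule weak_deriv_unique[OF \<Omega> \<alpha>(2) _ _ 1 2]) (use p q sL2 in \<open>auto intro: L2_space_diff\<close>)
  have "(LINT x|lebesgue_on \<Omega>. (D (\<lambda>x. \<psi> x - \<eta> x) x)\<^sup>2) = (LINT x|lebesgue_on \<Omega>. (q x - p x)\<^sup>2)"
    unfolding D_diff using ae p q sL2
    by (intro integral_cong_AE) (auto simp: L2_space_def elim!: eventually_mono)
  also have "\<dots> \<le> (LINT x|lebesgue_on \<Omega>. 2 * ((q x)\<^sup>2 + (p x)\<^sup>2))"
  proof (rule integral_mono)
    show "integrable (lebesgue_on \<Omega>) (\<lambda>x. (q x - p x)\<^sup>2)"
      using L2_space_diff[OF q(1) p(1)] by (simp add: L2_space_def)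
    show "integrable (lebesgue_on \<Omega>) (\<lambda>x. 2 * ((q x)\<^sup>2 + (p x)\<^sup>2))"
      using p q by (intro integrable_mult_right Bochner_Integration.integrable_add) (auto simp: L2_space_def)
  qed (rule power2_diff_le)
  also have "\<dots> = 2 * ((LINT x|lebesgue_on \<Omega>. (q x)\<^sup>2) + (LINT x|lebesgue_on \<Omega>. (p x)\<^sup>2))"
    using p q by (simp add: L2_space_def)
  also have "\<dots> \<le> 2 * ((sobolev_norm \<Omega> 1 (w - \<eta>))\<^sup>2 + (sobolev_norm \<Omega> 1 (w - \<psi>))\<^sup>2)"
    unfolding p_def q_def using \<alpha>(1) by (intro mult_left_mono add_mono weak_deriv_L2_le_sobolev_norm) auto
  finally show ?thesis by (simp add: add.commute)
qed

corollary smooth_difference_L2_le_sobolev_norm: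
  fixes \<Omega> :: "(real^'n::finite) set"
  assumes "open \<Omega>" "bounded \<Omega>" "w \<in> sobolev \<Omega> 1" "smooth_fun \<psi>" "smooth_fun \<eta>"
  shows "(LINT x|lebesgue_on \<Omega>. (\<psi> x - \<eta> x)\<^sup>2)
      \<le> 2 * ((sobolev_norm \<Omega> 1 (w - \<psi>))\<^sup>2 + (sobolev_norm \<Omega> 1 (w - \<eta>))\<^sup>2)"
    and "(LINT x|lebesgue_on \<Omega>. (partial (\<lambda>x. \<psi> x - \<eta> x) i x)\<^sup>2)
      \<le> 2 * ((sobolev_norm \<Omega> 1 (w - \<psi>))\<^sup>2 + (sobolev_norm \<Omega> 1 (w - \<eta>))\<^sup>2)"
proof -
  show "(LINT x|lebesgue_on \<Omega>. (\<psi> x - \<eta> x)\<^sup>2)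
      \<le> 2 * ((sobolev_norm \<Omega> 1 (w - \<psi>))\<^sup>2 + (sobolev_norm \<Omega> 1 (w - \<eta>))\<^sup>2)"
    by (rule smooth_difference_le_sobolev_norm[where D="\<lambda>f. f" and \<alpha>="\<lambda>_. 0" and js="[]"])
      (use assms in \<open>auto simp: multi_indices_def has_weak_deriv_0\<close>)
  have "(\<Sum>j\<in>UNIV. unit_index i j) = 1" by (simp add: unit_index_def)
  then have u: "unit_index i \<in> multi_indices 1" by (simp add: multi_indices_def del: of_nat_sum)
  show "(LINT x|lebesgue_on \<Omega>. (partial (\<lambda>x. \<psi> x - \<eta> x) i x)\<^sup>2)
      \<le> 2 * ((sobolev_norm \<Omega> 1 (w - \<psi>))\<^sup>2 + (sobolev_norm \<Omega> 1 (w - \<eta>))\<^sup>2)"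
    by (rule smooth_difference_le_sobolev_norm[where D="\<lambda>f. partial f i" and \<alpha>="unit_index i" and js="[i]"])
      (use assms u in \<open>auto simp: unit_index_def[of i] smooth_fun_partial has_weak_deriv_partial[unfolded unit_index_def]
          partial_diff smooth_fun_differentiable\<close>)
qed

section \<open>Surface measure on a flat face\<close>

text \<open>Signed distance to the hyperplane \<open>{x. \<nu> \<bullet> x = b}\<close> and orthogonal projection onto it, for a unit
  vector \<open>\<nu>\<close>.\<close>

definition height :: "'a::real_inner \<Rightarrow> real \<Rightarrow> 'a \<Rightarrow> real"
  where "height \<nu> b x = \<nu> \<bullet> x - b"

definition foot :: "'a::real_inner \<Rightarrow> real \<Rightarrow> 'a \<Rightarrow> 'a"
  where "foot \<nu> b x = x - height \<nu> b x *\<^sub>R \<nu>"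

lemma height_translate: "norm \<nu> = 1 \<Longrightarrow> height \<nu> b (x + s *\<^sub>R \<nu>) = height \<nu> b x + s"
  by (simp add: height_def inner_add_right norm_eq_1)

lemma height_foot: "norm \<nu> = 1 \<Longrightarrow> height \<nu> b (foot \<nu> b x) = 0"
  by (simp add: height_def foot_def inner_diff_right norm_eq_1)

lemma foot_translate: "norm \<nu> = 1 \<Longrightarrow> foot \<nu> b (x + s *\<^sub>R \<nu>) = foot \<nu> b x"
  by (simp add: foot_def height_translate scaleR_add_left)

lemma foot_foot: "norm \<nu> = 1 \<Longrightarrow> foot \<nu> b (foot \<nu> b x) = foot \<nu> b x"
  using foot_translate[of \<nu> b x "- height \<nu> b x"] by (simp add: foot_def)

lemma foot_eq_self: "height \<nu> b x = 0 \<Longrightarrow> foot \<nu> b x = x"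
  by (simp add: foot_def)

lemma continuous_height [continuous_intros]: "continuous_on S (height \<nu> b)"
  unfolding height_def[abs_def] by (intro continuous_intros)

lemma continuous_foot [continuous_intros]: "continuous_on S (foot \<nu> b)"
  unfolding foot_def[abs_def] height_def by (intro continuous_intros)

lemma measurable_height [measurable]: "height \<nu> b \<in> borel_measurable borel"
  by (intro borel_measurable_continuous_onI continuous_height)

lemma measurable_foot [measurable]: "foot \<nu> b \<in> borel_measurable (borel :: 'a::euclidean_space measure)"
  by (intro borel_measurable_continuous_onI continuous_foot)

lemma
  fixes \<nu> :: "'a::euclidean_space"
  assumes \<nu>: "norm \<nu> = 1"
  shows closest_point_hyperplane: "closest_point {x. \<nu> \<bullet> x = b} x = foot \<nu> b x"
    and infdist_hyperplane: "infdist x {x. \<nu> \<bullet> x = b} = \<bar>height \<nu> b x\<bar>"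
proof -
  let ?H = "{x. \<nu> \<bullet> x = b}"
  have f: "foot \<nu> b x \<in> ?H" using height_foot[OF \<nu>, of b x] by (simp add: height_def)
  have d: "dist x (foot \<nu> b x) = \<bar>height \<nu> b x\<bar>"
    using \<nu> by (simp add: foot_def dist_norm)
  have "dist x (foot \<nu> b x) \<le> dist x z" if "z \<in> ?H" for z
  proof -
    have "height \<nu> b x = \<nu> \<bullet> (x - z)" using that by (simp add: height_def inner_diff_right)
    then show ?thesis unfolding d using Cauchy_Schwarz_ineq2[of \<nu> "x - z"] \<nu> by (simp add: dist_norm)
  qed
  then have "foot \<nu> b x = closest_point ?H x"
    using f by (intro closest_point_unique convex_hyperplane closed_hyperplane) auto
  then show 1: "closest_point ?H x = foot \<nu> b x" by simp
  have "?H \<noteq> {}" using f by blast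
  then show "infdist x ?H = \<bar>height \<nu> b x\<bar>"
    using setdist_closest_point[OF closed_hyperplane, of \<nu> b x]
    by (simp add: infdist_eq_setdist 1 d)
qed

lemma nn_integral_lborel_translate:
  fixes f :: "'a::euclidean_space \<Rightarrow> ennreal"
  assumes "f \<in> borel_measurable borel"
  shows "(\<integral>\<^sup>+x. f (x + c) \<partial>lborel) = (\<integral>\<^sup>+x. f x \<partial>lborel)"
proof -
  have d: "distr lborel borel ((+) c) = lborel" by (rule lborel_distr_plus)
  show ?thesis
    using assms by (subst d[symmetric], subst nn_integral_distr) (auto simp: add.commute)
qed

text \<open>The map \<open>(x, s) \<mapsto> (foot x + s \<nu>, - height x)\<close> rotates the plane spanned by \<open>\<nu>\<close> and the coordinate \<open>s\<close>
  by a right angle. It is the composition of the shears \<open>x \<mapsto> x + s \<nu>\<close>, \<open>s \<mapsto> s - height x\<close> and once more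
  \<open>x \<mapsto> x + s \<nu>\<close>; for fixed values of the other variable each of them is a translation.\<close>

lemma nn_integral_rotate:
  fixes f :: "'a::euclidean_space \<Rightarrow> real \<Rightarrow> ennreal"
  assumes \<nu>: "norm \<nu> = 1" and f: "(\<lambda>(x, s). f x s) \<in> borel_measurable borel"
  shows "(\<integral>\<^sup>+s. \<integral>\<^sup>+x. f x s \<partial>lborel \<partial>lborel) =
    (\<integral>\<^sup>+s. \<integral>\<^sup>+x. f (foot \<nu> b x + s *\<^sub>R \<nu>) (- height \<nu> b x) \<partial>lborel \<partial>lborel)"
proof -
  have f': "(\<lambda>x. f (g x) (h x)) \<in> borel_measurable borel"
    if "g \<in> borel_measurable borel" "h \<in> borel_measurable borel"
    for g :: "'c::topological_space \<Rightarrow> 'a" and h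
  proof -
    have "(\<lambda>x. (g x, h x)) \<in> borel \<rightarrow>\<^sub>M borel"
      using that by (rule borel_measurable_Pair)
    from measurable_comp[OF this f] show ?thesis by (simp add: comp_def)
  qed
  have fub: "(\<integral>\<^sup>+s. \<integral>\<^sup>+x. F x s \<partial>lborel \<partial>lborel) = (\<integral>\<^sup>+x. \<integral>\<^sup>+s. F x s \<partial>lborel \<partial>lborel)"
    if "(\<lambda>(x, s). F x s) \<in> borel_measurable borel" for F :: "'a \<Rightarrow> real \<Rightarrow> ennreal"
    using that by (intro lborel_pair.Fubini') (simp add: borel_prod[symmetric] measurable_cong_sets[OF sets_pair_measure_cong[OF sets_lborel sets_lborel] refl] split_beta')
  have "(\<integral>\<^sup>+s. \<integral>\<^sup>+x. f x s \<partial>lborel \<partial>lborel) = (\<integral>\<^sup>+s. \<integral>\<^sup>+x. f (x + s *\<^sub>R \<nu>) s \<partial>lborel \<partial>lborel)"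
    by (intro nn_integral_cong nn_integral_lborel_translate[symmetric]) (rule f'; simp)
  also have "\<dots> = (\<integral>\<^sup>+x. \<integral>\<^sup>+s. f (x + s *\<^sub>R \<nu>) s \<partial>lborel \<partial>lborel)"
    by (rule fub, unfold split_beta', rule f'; intro borel_measurable_continuous_onI continuous_intros)
  also have "\<dots> = (\<integral>\<^sup>+x. \<integral>\<^sup>+s. f (x + (s + (- height \<nu> b x)) *\<^sub>R \<nu>) (s + (- height \<nu> b x)) \<partial>lborel \<partial>lborel)"
    by (intro nn_integral_cong nn_integral_lborel_translate[symmetric])
      (rule f'; intro borel_measurable_continuous_onI continuous_intros)
  also have "\<dots> = (\<integral>\<^sup>+s. \<integral>\<^sup>+x. f (x + (s + (- height \<nu> b x)) *\<^sub>R \<nu>) (s + (- height \<nu> b x)) \<partial>lborel \<partial>lborel)"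
    by (rule fub[symmetric], unfold split_beta' height_def, rule f';
        intro borel_measurable_continuous_onI continuous_intros)
  also have "\<dots> = (\<integral>\<^sup>+s. \<integral>\<^sup>+x. f (foot \<nu> b x + s *\<^sub>R \<nu>) (- height \<nu> b x) \<partial>lborel \<partial>lborel)"
  proof (rule nn_integral_cong)
    fix s
    have "(\<integral>\<^sup>+x. f (x + (s + (- height \<nu> b x)) *\<^sub>R \<nu>) (s + (- height \<nu> b x)) \<partial>lborel) =
      (\<integral>\<^sup>+x. f ((x + s *\<^sub>R \<nu>) + (s + (- height \<nu> b (x + s *\<^sub>R \<nu>))) *\<^sub>R \<nu>) (s + (- height \<nu> b (x + s *\<^sub>R \<nu>))) \<partial>lborel)"
      by (rule nn_integral_lborel_translate[symmetric], unfold height_def, rule f';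
          intro borel_measurable_continuous_onI continuous_intros)
    then show "(\<integral>\<^sup>+x. f (x + (s + (- height \<nu> b x)) *\<^sub>R \<nu>) (s + (- height \<nu> b x)) \<partial>lborel) =
      (\<integral>\<^sup>+x. f (foot \<nu> b x + s *\<^sub>R \<nu>) (- height \<nu> b x) \<partial>lborel)"
      using \<nu> by (simp add: height_translate foot_def algebra_simps)
  qed
  finally show ?thesis .
qed

locale flat_face =
  fixes e :: "(real^'n::finite) set" and \<nu> b
  assumes shape: "face_shape e" and normal: "norm \<nu> = 1" and hull: "affine hull e = {x. \<nu> \<bullet> x = b}"
begin

lemma compact_face: "compact e"
  using shape unfolding face_shape_def polytope_union_def
  by (metis compact_Union polytope_imp_compact)

lemma borel_face [measurable]: "e \<in> sets borel"
  using compact_face by (simp add: borel_closed compact_imp_closed)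

lemma height_face: "x \<in> e \<Longrightarrow> height \<nu> b x = 0"
  using hull hull_subset[of e affine] by (auto simp: height_def)

lemma slab_face: "slab e = {x. foot \<nu> b x \<in> e \<and> \<bar>height \<nu> b x\<bar> \<le> 1 / 2}"
  unfolding slab_def hull closest_point_hyperplane[OF normal] infdist_hyperplane[OF normal] ..

lemma closed_slab: "closed (slab e)"
proof -
  have "slab e = foot \<nu> b -` e \<inter> {x. \<bar>height \<nu> b x\<bar> \<le> 1 / 2}"
    unfolding slab_face by auto
  moreover have "closed (foot \<nu> b -` e)"
    using compact_face by (intro closed_vimage compact_imp_closed continuous_foot)
  moreover have "closed {x. \<bar>height \<nu> b x\<bar> \<le> 1 / 2}"
    by (intro closed_Collect_le continuous_intros)
  ultimately show ?thesis by auto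
qed

lemma bounded_slab: "bounded (slab e)"
proof -
  obtain r where r: "\<And>x. x \<in> e \<Longrightarrow> norm x \<le> r"
    using compact_imp_bounded[OF compact_face] by (auto simp: bounded_iff)
  have "norm x \<le> r + 1" if "x \<in> slab e" for x
  proof -
    have "x = foot \<nu> b x + height \<nu> b x *\<^sub>R \<nu>" by (simp add: foot_def)
    then have "norm x \<le> norm (foot \<nu> b x) + \<bar>height \<nu> b x\<bar>"
      using normal by (metis mult.right_neutral norm_scaleR norm_triangle_ineq)
    then show ?thesis using that r by (fastforce simp: slab_face)
  qed
  then show ?thesis unfolding bounded_iff by blast
qed

lemma borel_slab [measurable]: "slab e \<in> sets borel"
  using closed_slab by simp

lemma lebesgue_slab: "slab e \<in> sets lebesgue"
  by simp

lemma face_measure_eq: "face_measure e = distr (lebesgue_on (slab e)) (restrict_space borel e) (foot \<nu> b)"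
  unfolding face_measure_def hull closest_point_hyperplane[OF normal] ..

lemma measurable_foot_slab: "foot \<nu> b \<in> lebesgue_on (slab e) \<rightarrow>\<^sub>M restrict_space borel e"
proof (rule measurable_restrict_space2)
  show "foot \<nu> b \<in> space (lebesgue_on (slab e)) \<rightarrow> e" by (auto simp: slab_face)
  show "foot \<nu> b \<in> lebesgue_on (slab e) \<rightarrow>\<^sub>M borel"
    by (intro measurable_restrict_space1 measurable_completion) simp
qed

lemma space_face_measure [simp]: "space (face_measure e) = e"
  by (simp add: face_measure_eq space_restrict_space)

lemma sets_face_measure [measurable_cong]: "sets (face_measure e) = sets (restrict_space borel e)"
  by (simp add: face_measure_eq)

lemma measurable_face: "f \<in> borel_measurable borel \<Longrightarrow> f \<in> borel_measurable (face_measure e)"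
  using measurable_restrict_space1[of f borel borel e]
    measurable_cong_sets[OF sets_face_measure refl] by blast

lemma finite_face_measure: "finite_measure (face_measure e)"
  unfolding face_measure_eq
  by (intro finite_measure.finite_measure_distr finite_measure_lebesgue_on measurable_foot_slab
      bounded_set_imp_lmeasurable bounded_slab lebesgue_slab)

lemma nn_integral_face_measure:
  assumes [measurable]: "g \<in> borel_measurable borel"
  shows "(\<integral>\<^sup>+y. g y \<partial>face_measure e) = (\<integral>\<^sup>+x. g (foot \<nu> b x) * indicator (slab e) x \<partial>lborel)"
proof -
  have "(\<integral>\<^sup>+y. g y \<partial>face_measure e) = (\<integral>\<^sup>+x. g (foot \<nu> b x) \<partial>lebesgue_on (slab e))"
    unfolding face_measure_eq
    by (intro nn_integral_distr measurable_foot_slab) (simp add: measurable_restrict_space1)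
  also have "\<dots> = (\<integral>\<^sup>+x. g (foot \<nu> b x) * indicator (slab e) x \<partial>lebesgue)"
    using lebesgue_slab by (simp add: nn_integral_restrict_space)
  also have "\<dots> = (\<integral>\<^sup>+x. g (foot \<nu> b x) * indicator (slab e) x \<partial>lborel)"
    by (rule nn_integral_completion)
  finally show ?thesis .
qed

text \<open>The surface integral is by definition a volume integral over a slab of height 1. Rotating the product
  of the cylinder over \<open>e\<close> with an interval of length 1 exchanges the height in the cylinder with the
  height in the slab.\<close>

lemma face_measure_Fubini:
  fixes h :: "real^'n \<Rightarrow> ennreal"
  assumes [measurable]: "h \<in> borel_measurable borel"
  shows "(\<integral>\<^sup>+y. \<integral>\<^sup>+s. h (y + s *\<^sub>R \<nu>) \<partial>lborel \<partial>face_measure e) =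
    (\<integral>\<^sup>+x. h x * indicator {x. foot \<nu> b x \<in> e} x \<partial>lborel)"
proof -
  let ?C = "{x. foot \<nu> b x \<in> e}"
  have "foot \<nu> b -` e \<inter> space borel \<in> sets borel"
    by (rule measurable_sets[OF measurable_foot borel_face])
  then have [measurable]: "?C \<in> sets borel" by (simp add: vimage_def)
  have "(\<integral>\<^sup>+y. \<integral>\<^sup>+s. h (y + s *\<^sub>R \<nu>) \<partial>lborel \<partial>face_measure e)
    = (\<integral>\<^sup>+x. (\<integral>\<^sup>+s. h (foot \<nu> b x + s *\<^sub>R \<nu>) \<partial>lborel) * indicator (slab e) x \<partial>lborel)"
    by (rule nn_integral_face_measure) measurable
  also have "\<dots> = (\<integral>\<^sup>+x. \<integral>\<^sup>+s. h (foot \<nu> b x + s *\<^sub>R \<nu>) * indicator (slab e) x \<partial>lborel \<partial>lborel)"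
    by (intro nn_integral_cong nn_integral_multc[symmetric]) measurable
  also have "\<dots> = (\<integral>\<^sup>+s. \<integral>\<^sup>+x. h (foot \<nu> b x + s *\<^sub>R \<nu>) * indicator (slab e) x \<partial>lborel \<partial>lborel)"
    by (rule lborel_pair.Fubini'[symmetric]) measurable
  also have "\<dots> = (\<integral>\<^sup>+s. \<integral>\<^sup>+x. (h x * indicator ?C x) * indicator {- (1/2)..1/2} (s::real) \<partial>lborel \<partial>lborel)"
  proof -
    let ?f = "\<lambda>x s. h x * indicator ?C x * indicator {- (1/2)..1/2} (s::real)"
    have "(\<integral>\<^sup>+s. \<integral>\<^sup>+x. ?f x s \<partial>lborel \<partial>lborel) =
      (\<integral>\<^sup>+s. \<integral>\<^sup>+x. ?f (foot \<nu> b x + s *\<^sub>R \<nu>) (- height \<nu> b x) \<partial>lborel \<partial>lborel)"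
    proof (rule nn_integral_rotate[OF normal])
      show "(\<lambda>(x, s). ?f x s) \<in> borel_measurable borel"
        unfolding borel_prod[symmetric] by measurable
    qed
    also have "\<dots> = (\<integral>\<^sup>+s. \<integral>\<^sup>+x. h (foot \<nu> b x + s *\<^sub>R \<nu>) * indicator (slab e) x \<partial>lborel \<partial>lborel)"
      using normal by (intro nn_integral_cong)
        (auto simp: slab_face indicator_def foot_translate foot_foot abs_le_iff)
    finally show ?thesis by (rule sym)
  qed
  also have "\<dots> = (\<integral>\<^sup>+s. (\<integral>\<^sup>+x. h x * indicator ?C x \<partial>lborel) * indicator {- (1/2)..1/2} (s::real) \<partial>lborel)"
    by (intro nn_integral_cong nn_integral_multc) measurable
  also have "\<dots> = (\<integral>\<^sup>+x. h x * indicator ?C x \<partial>lborel)"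
    by (simp add: nn_integral_cmult)
  finally show ?thesis .
qed

end

section \<open>The trace inequality\<close>

lemma frechet_derivative_eq_sum_partial:
  fixes f :: "real^'n::finite \<Rightarrow> real"
  assumes "f differentiable (at x)"
  shows "frechet_derivative f (at x) v = (\<Sum>i\<in>UNIV. v $ i * partial f i x)"
proof -
  have l: "linear (frechet_derivative f (at x))"
    using assms by (simp add: linear_frechet_derivative)
  have "frechet_derivative f (at x) v = frechet_derivative f (at x) (\<Sum>i\<in>UNIV. v $ i *\<^sub>R axis i 1)"
    using basis_expansion[of v] by (simp add: scalar_mult_eq_scaleR)
  also have "\<dots> = (\<Sum>i\<in>UNIV. v $ i * partial f i x)"
    by (simp add: linear_sum[OF l] linear_scale[OF l])
  finally show ?thesis .
qed

lemma directional_derivative_le: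
  fixes f :: "real^'n::finite \<Rightarrow> real"
  assumes "f differentiable (at x)" "norm v = 1"
  shows "(frechet_derivative f (at x) v)\<^sup>2 \<le> (\<Sum>i\<in>UNIV. (partial f i x)\<^sup>2)"
proof -
  let ?g = "\<chi> i. partial f i x"
  have "frechet_derivative f (at x) v = v \<bullet> ?g"
    by (subst frechet_derivative_eq_sum_partial[OF assms(1)]) (simp add: inner_vec_def)
  moreover have "(v \<bullet> ?g)\<^sup>2 \<le> (v \<bullet> v) * (?g \<bullet> ?g)" by (rule Cauchy_Schwarz_ineq)
  moreover have "v \<bullet> v = 1" using assms(2) by (simp add: norm_eq_1)
  moreover have "?g \<bullet> ?g = (\<Sum>i\<in>UNIV. (partial f i x)\<^sup>2)"
    unfolding inner_vec_def by (simp add: power2_eq_square)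
  ultimately show ?thesis by simp
qed

text \<open>The integrand in the bound for the trace; \<open>\<delta>\<close> is the height of the cylinder over the face.\<close>

definition trace_density :: "real \<Rightarrow> (real^'n::finite \<Rightarrow> real) \<Rightarrow> real^'n \<Rightarrow> real"
  where "trace_density \<delta> \<eta> x = (1 + \<delta>) * (\<eta> x)\<^sup>2 + \<delta> * (\<Sum>i\<in>UNIV. (partial \<eta> i x)\<^sup>2)"

lemma trace_density_nonneg: "0 \<le> \<delta> \<Longrightarrow> 0 \<le> trace_density \<delta> \<eta> x"
  unfolding trace_density_def by (intro add_nonneg_nonneg mult_nonneg_nonneg sum_nonneg) auto

lemma continuous_trace_density: "smooth_fun \<eta> \<Longrightarrow> continuous_on S (trace_density \<delta> \<eta>)"
  unfolding trace_density_def[abs_def]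
  by (intro continuous_intros continuous_on_subset[OF smooth_fun_continuous] smooth_fun_partial) auto

text \<open>With \<open>g(s) = \<eta>(y + s \<nu>)\<close>, the function \<open>(s + \<delta>) g(s)\<^sup>2\<close> vanishes at \<open>s = -\<delta>\<close> and equals
  \<open>\<delta> \<eta>(y)\<^sup>2\<close> at \<open>s = 0\<close>. Its derivative is \<open>g\<^sup>2 + 2 (s + \<delta>) g g'\<close>, which is at most
  \<open>(1 + \<delta>) g\<^sup>2 + \<delta> g'\<^sup>2\<close> on the interval.\<close>

lemma line_trace_inequality:
  fixes \<eta> :: "real^'n::finite \<Rightarrow> real"
  assumes \<eta>: "smooth_fun \<eta>" and \<delta>: "0 < \<delta>" and \<nu>: "norm \<nu> = 1"
  shows "ennreal (\<delta> * (\<eta> y)\<^sup>2) \<le>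
    (\<integral>\<^sup>+s. ennreal (trace_density \<delta> \<eta> (y + s *\<^sub>R \<nu>)) * indicator {-\<delta><..<0} s \<partial>lborel)"
proof -
  have diff: "\<eta> differentiable (at x)" for x using \<eta> by (rule smooth_fun_differentiable)
  define g where "g s = \<eta> (y + s *\<^sub>R \<nu>)" for s
  define g' where "g' s = frechet_derivative \<eta> (at (y + s *\<^sub>R \<nu>)) \<nu>" for s
  define H where "H s = trace_density \<delta> \<eta> (y + s *\<^sub>R \<nu>)" for s
  have line: "continuous_on UNIV (\<lambda>s. y + s *\<^sub>R \<nu>)" by (intro continuous_intros)
  have g: "(g has_real_derivative g' s) (at s)" for s
    unfolding g_def[abs_def] g'_def using diff by (rule has_derivative_along_line)
  have cg: "continuous_on UNIV g"
    unfolding g_def[abs_def] using continuous_on_compose2[OF smooth_fun_continuous[OF \<eta>] line] by simp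
  have "g' = (\<lambda>s. \<Sum>i\<in>UNIV. \<nu> $ i * partial \<eta> i (y + s *\<^sub>R \<nu>))"
    unfolding g'_def[abs_def] by (rule ext, rule frechet_derivative_eq_sum_partial[OF diff])
  then have cg': "continuous_on UNIV g'"
    by (simp only:) (intro continuous_intros continuous_on_compose2[OF smooth_fun_continuous[OF smooth_fun_partial[OF \<eta>]] line] subset_UNIV)
  have cH: "continuous_on UNIV H"
    unfolding H_def[abs_def] using continuous_on_compose2[OF continuous_trace_density[OF \<eta>, of UNIV] line] by simp
  define k where "k s = (g s)\<^sup>2 + 2 * (s + \<delta>) * (g s * g' s)" for s
  have ck: "continuous_on UNIV k"
    unfolding k_def[abs_def] by (intro continuous_intros cg cg')
  have der: "((\<lambda>s. (s + \<delta>) * (g s)\<^sup>2) has_real_derivative k s) (at s)" for s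
    unfolding k_def by (auto intro!: derivative_eq_intros g simp: algebra_simps)
  have kH: "k s \<le> H s" if "s \<in> {-\<delta>..0}" for s
  proof -
    have "2 * (g s * g' s) \<le> (g s)\<^sup>2 + (g' s)\<^sup>2"
      using sum_squares_bound[of "g s" "g' s"] by (simp add: mult.assoc)
    then have "(s + \<delta>) * (2 * (g s * g' s)) \<le> (s + \<delta>) * ((g s)\<^sup>2 + (g' s)\<^sup>2)"
      by (rule mult_left_mono) (use that in auto)
    then have "2 * (s + \<delta>) * (g s * g' s) \<le> (s + \<delta>) * ((g s)\<^sup>2 + (g' s)\<^sup>2)"
      by (simp only: mult.assoc mult.left_commute[of "s + \<delta>" 2])
    also have "\<dots> \<le> \<delta> * ((g s)\<^sup>2 + (g' s)\<^sup>2)"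
      using that by (intro mult_right_mono) auto
    also have "\<dots> \<le> \<delta> * ((g s)\<^sup>2 + (\<Sum>i\<in>UNIV. (partial \<eta> i (y + s *\<^sub>R \<nu>))\<^sup>2))"
      unfolding g'_def using \<delta> directional_derivative_le[OF diff \<nu>] by (intro mult_left_mono add_left_mono) auto
    finally show ?thesis
      unfolding k_def H_def trace_density_def g_def by (simp add: algebra_simps)
  qed
  have "\<delta> * (\<eta> y)\<^sup>2 = (0 + \<delta>) * (g 0)\<^sup>2 - (-\<delta> + \<delta>) * (g (-\<delta>))\<^sup>2" by (simp add: g_def)
  also have "\<dots> = (LINT s|lborel. k s * indicator {-\<delta>..0} s)"
    using \<delta> by (intro integral_FTC_Icc_real[symmetric] der)
      (auto intro: continuous_on_interior[OF ck] simp: continuous_on_eq_continuous_at ck[unfolded continuous_on_eq_continuous_at[OF open_UNIV]])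
  also have "\<dots> \<le> (LINT s|lborel. H s * indicator {-\<delta>..0} s)"
  proof (rule integral_mono)
    have "set_integrable lborel {-\<delta>..0} f" if "continuous_on UNIV f" for f :: "real \<Rightarrow> real"
      using that by (intro borel_integrable_atLeastAtMost') (auto intro: continuous_on_subset)
    from this[OF ck] this[OF cH]
    show "integrable lborel (\<lambda>s. k s * indicator {-\<delta>..0} s)" "integrable lborel (\<lambda>s. H s * indicator {-\<delta>..0} s)"
      by (simp_all add: set_integrable_def mult.commute)
  qed (auto simp: indicator_def kH)
  finally have "ennreal (\<delta> * (\<eta> y)\<^sup>2) \<le> ennreal (LINT s|lborel. H s * indicator {-\<delta>..0} s)"
    by (rule ennreal_leI)
  also have "\<dots> = (\<integral>\<^sup>+s. ennreal (H s * indicator {-\<delta>..0} s) \<partial>lborel)"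
  proof (rule nn_integral_eq_integral[symmetric])
    show "integrable lborel (\<lambda>s. H s * indicator {-\<delta>..0} s)"
      using borel_integrable_atLeastAtMost'[OF continuous_on_subset[OF cH subset_UNIV], of "-\<delta>" 0]
      by (simp add: set_integrable_def mult.commute)
  qed (use \<delta> in \<open>simp add: H_def trace_density_nonneg\<close>)
  also have "\<dots> = (\<integral>\<^sup>+s. ennreal (H s) * indicator {-\<delta><..<0} s \<partial>lborel)"
  proof (rule nn_integral_cong_AE)
    \<comment> \<open>The open interval keeps the cylinder inside the open domain; the end points are a null set.\<close>
    have "AE s in lborel. s \<noteq> -\<delta>" "AE s in lborel. s \<noteq> (0::real)" by (rule AE_lborel_singleton)+
    then show "AE s in lborel. ennreal (H s * indicator {-\<delta>..0} s) = ennreal (H s) * indicator {-\<delta><..<0} s"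
      by eventually_elim (auto simp: indicator_def)
  qed
  finally show ?thesis by (simp add: H_def)
qed

context flat_face
begin

text \<open>Integration of \<open>line_trace_inequality\<close> over the part of the face in \<open>U\<close>; by \<open>face_measure_Fubini\<close> the
  iterated integral is an integral over the cylinder.\<close>

lemma trace_inequality:
  assumes \<eta>: "smooth_fun \<eta>" and \<delta>: "0 < \<delta>" and U: "U \<in> sets borel"
  shows "(\<integral>\<^sup>+y. ennreal (\<delta> * (\<eta> y)\<^sup>2) * indicator U y \<partial>face_measure e) \<le>
    (\<integral>\<^sup>+x. ennreal (trace_density \<delta> \<eta> x) *
      indicator {x. foot \<nu> b x \<in> e \<inter> U \<and> -\<delta> < height \<nu> b x \<and> height \<nu> b x < 0} x \<partial>lborel)"
proof -
  let ?H = "trace_density \<delta> \<eta>"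
  let ?D = "{x. foot \<nu> b x \<in> U \<and> -\<delta> < height \<nu> b x \<and> height \<nu> b x < 0}"
  have [measurable]: "?H \<in> borel_measurable borel"
    using continuous_trace_density[OF \<eta>] by (rule borel_measurable_continuous_onI)
  have [measurable]: "?D \<in> sets borel"
  proof -
    have "foot \<nu> b -` U \<inter> space borel \<in> sets borel" using U by (rule measurable_sets[OF measurable_foot])
    moreover have "{x. -\<delta> < height \<nu> b x \<and> height \<nu> b x < 0} \<in> sets borel" by measurable
    moreover have "?D = (foot \<nu> b -` U \<inter> space borel) \<inter> {x. -\<delta> < height \<nu> b x \<and> height \<nu> b x < 0}"
      by auto
    ultimately show ?thesis by (metis sets.Int)
  qed
  have "(\<integral>\<^sup>+y. ennreal (\<delta> * (\<eta> y)\<^sup>2) * indicator U y \<partial>face_measure e) \<le>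
    (\<integral>\<^sup>+y. (\<integral>\<^sup>+s. ennreal (?H (y + s *\<^sub>R \<nu>)) * indicator {-\<delta><..<0} s \<partial>lborel) * indicator U y \<partial>face_measure e)"
    by (intro nn_integral_mono mult_right_mono line_trace_inequality \<eta> \<delta> normal) auto
  also have "\<dots> = (\<integral>\<^sup>+y. \<integral>\<^sup>+s. ennreal (?H (y + s *\<^sub>R \<nu>)) * indicator ?D (y + s *\<^sub>R \<nu>) \<partial>lborel \<partial>face_measure e)"
  proof (rule nn_integral_cong)
    fix y assume "y \<in> space (face_measure e)"
    then have y: "height \<nu> b y = 0" "foot \<nu> b y = y" using height_face foot_eq_self by auto
    have "(\<lambda>s. ennreal (?H (y + s *\<^sub>R \<nu>)) * indicator {-\<delta><..<0} s) \<in> borel_measurable lborel"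
      by measurable
    then have "(\<integral>\<^sup>+s. ennreal (?H (y + s *\<^sub>R \<nu>)) * indicator {-\<delta><..<0} s \<partial>lborel) * indicator U y
      = (\<integral>\<^sup>+s. ennreal (?H (y + s *\<^sub>R \<nu>)) * indicator {-\<delta><..<0} s * indicator U y \<partial>lborel)"
      by (rule nn_integral_multc[symmetric])
    also have "\<dots> = (\<integral>\<^sup>+s. ennreal (?H (y + s *\<^sub>R \<nu>)) * indicator ?D (y + s *\<^sub>R \<nu>) \<partial>lborel)"
      using y normal by (intro nn_integral_cong) (auto simp: indicator_def height_translate foot_translate)
    finally show "(\<integral>\<^sup>+s. ennreal (?H (y + s *\<^sub>R \<nu>)) * indicator {-\<delta><..<0} s \<partial>lborel) * indicator U y
      = (\<integral>\<^sup>+s. ennreal (?H (y + s *\<^sub>R \<nu>)) * indicator ?D (y + s *\<^sub>R \<nu>) \<partial>lborel)" .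
  qed
  also have "\<dots> = (\<integral>\<^sup>+x. ennreal (?H x) * indicator ?D x * indicator {x. foot \<nu> b x \<in> e} x \<partial>lborel)"
    by (rule face_measure_Fubini) measurable
  also have "\<dots> = (\<integral>\<^sup>+x. ennreal (?H x) *
      indicator {x. foot \<nu> b x \<in> e \<inter> U \<and> -\<delta> < height \<nu> b x \<and> height \<nu> b x < 0} x \<partial>lborel)"
    by (intro nn_integral_cong) (auto simp: indicator_def)
  finally show ?thesis .
qed

lemma continuous_L2_face:
  assumes "continuous_on UNIV f"
  shows "f \<in> L2_space (face_measure e)"
proof -
  have m: "f \<in> borel_measurable (face_measure e)"
    using assms by (intro measurable_face borel_measurable_continuous_onI)
  have "compact (f ` e)"
    using assms compact_face by (intro compact_continuous_image) (auto intro: continuous_on_subset)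
  then obtain B where B: "\<forall>x\<in>e. \<bar>f x\<bar> \<le> B"
    by (fastforce dest!: compact_imp_bounded simp: bounded_iff)
  have "integrable (face_measure e) (\<lambda>x. (f x)\<^sup>2)"
  proof (rule finite_measure.integrable_const_bound[OF finite_face_measure, where B="B\<^sup>2"])
    show "AE x in face_measure e. norm ((f x)\<^sup>2) \<le> B\<^sup>2"
    proof (rule AE_I2)
      fix x assume "x \<in> space (face_measure e)"
      then have "\<bar>f x\<bar>\<^sup>2 \<le> B\<^sup>2" using B by (intro power_mono) auto
      then show "norm ((f x)\<^sup>2) \<le> B\<^sup>2" by simp
    qed
  qed (intro borel_measurable_power m)
  then show ?thesis using m by (simp add: L2_space_def)
qed

lemma integrable_square_indicator:
  assumes U: "U \<in> sets borel" and f: "f \<in> L2_space (face_measure e)"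
  shows "integrable (face_measure e) (\<lambda>y. (f y)\<^sup>2 * indicator U y)"
proof -
  let ?M = "face_measure e"
  have "U \<inter> space ?M \<in> sets ?M"
    using U by (auto simp: sets_face_measure sets_restrict_space)
  moreover have "integrable ?M (\<lambda>y. (f y)\<^sup>2)" using f by (simp add: L2_space_def)
  ultimately have "integrable ?M (\<lambda>y. indicator (U \<inter> space ?M) y *\<^sub>R (f y)\<^sup>2)"
    by (rule integrable_mult_indicator)
  moreover have "integrable ?M (\<lambda>y. indicator (U \<inter> space ?M) y *\<^sub>R (f y)\<^sup>2)
      \<longleftrightarrow> integrable ?M (\<lambda>y. (f y)\<^sup>2 * indicator U y)"
    by (intro Bochner_Integration.integrable_cong refl) (auto simp: indicator_def)
  ultimately show ?thesis by blast
qed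

lemma trace_inequality_domain:
  assumes \<eta>: "smooth_fun \<eta>" and \<delta>: "0 < \<delta>" and U: "U \<in> sets borel"
    and \<Omega>: "open \<Omega>" "bounded \<Omega>"
    and cyl: "{x. foot \<nu> b x \<in> e \<inter> U \<and> -\<delta> < height \<nu> b x \<and> height \<nu> b x < 0} \<subseteq> \<Omega>"
  shows "\<delta> * (LINT y|face_measure e. (\<eta> y)\<^sup>2 * indicator U y) \<le>
    (1 + \<delta>) * (LINT x|lebesgue_on \<Omega>. (\<eta> x)\<^sup>2) + \<delta> * (\<Sum>i\<in>UNIV. LINT x|lebesgue_on \<Omega>. (partial \<eta> i x)\<^sup>2)"
proof -
  have \<Omega>m: "\<Omega> \<in> sets borel" using \<Omega> by auto
  have L2: "\<eta> \<in> L2_space (lebesgue_on \<Omega>)" "partial \<eta> i \<in> L2_space (lebesgue_on \<Omega>)" for i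
    using \<eta> \<Omega> smooth_L2 smooth_fun_partial by blast+
  have int: "integrable (face_measure e) (\<lambda>y. (\<eta> y)\<^sup>2 * indicator U y)"
    using U continuous_L2_face[OF smooth_fun_continuous[OF \<eta>]] by (rule integrable_square_indicator)
  have intD: "integrable (lebesgue_on \<Omega>) (trace_density \<delta> \<eta>)"
    unfolding trace_density_def[abs_def] using L2
    by (intro Bochner_Integration.integrable_add integrable_mult_right Bochner_Integration.integrable_sum)
      (auto simp: L2_space_def)
  have "ennreal (\<delta> * (LINT y|face_measure e. (\<eta> y)\<^sup>2 * indicator U y))
      = ennreal (LINT y|face_measure e. \<delta> * ((\<eta> y)\<^sup>2 * indicator U y))" by simp
  also have "\<dots> = (\<integral>\<^sup>+y. ennreal (\<delta> * ((\<eta> y)\<^sup>2 * indicator U y)) \<partial>face_measure e)"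
    using int \<delta> by (intro nn_integral_eq_integral[symmetric] integrable_mult_right) auto
  also have "\<dots> = (\<integral>\<^sup>+y. ennreal (\<delta> * (\<eta> y)\<^sup>2) * indicator U y \<partial>face_measure e)"
    by (intro nn_integral_cong) (auto simp: indicator_def)
  also have "\<dots> \<le> (\<integral>\<^sup>+x. ennreal (trace_density \<delta> \<eta> x) *
      indicator {x. foot \<nu> b x \<in> e \<inter> U \<and> -\<delta> < height \<nu> b x \<and> height \<nu> b x < 0} x \<partial>lborel)"
    using \<eta> \<delta> U by (rule trace_inequality)
  also have "\<dots> \<le> (\<integral>\<^sup>+x. ennreal (trace_density \<delta> \<eta> x) * indicator \<Omega> x \<partial>lborel)"
    using cyl by (intro nn_integral_mono mult_left_mono) (auto simp: indicator_def)
  also have "\<dots> = (\<integral>\<^sup>+x. ennreal (trace_density \<delta> \<eta> x) * indicator \<Omega> x \<partial>lebesgue)"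
    by (rule nn_integral_completion[symmetric])
  also have "\<dots> = (\<integral>\<^sup>+x. ennreal (trace_density \<delta> \<eta> x) \<partial>lebesgue_on \<Omega>)"
    using \<Omega>m by (simp add: nn_integral_restrict_space)
  also have "\<dots> = ennreal (LINT x|lebesgue_on \<Omega>. trace_density \<delta> \<eta> x)"
    using intD \<delta> by (intro nn_integral_eq_integral) (auto simp: trace_density_nonneg)
  finally have "\<delta> * (LINT y|face_measure e. (\<eta> y)\<^sup>2 * indicator U y) \<le> (LINT x|lebesgue_on \<Omega>. trace_density \<delta> \<eta> x)"
    using \<delta> by (subst (asm) ennreal_le_iff) (auto intro!: integral_nonneg_AE simp: trace_density_nonneg)
  also have "\<dots> = (1 + \<delta>) * (LINT x|lebesgue_on \<Omega>. (\<eta> x)\<^sup>2) + \<delta> * (\<Sum>i\<in>UNIV. LINT x|lebesgue_on \<Omega>. (partial \<eta> i x)\<^sup>2)"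
    unfolding trace_density_def using L2
    by (subst Bochner_Integration.integral_add) (auto simp: L2_space_def Bochner_Integration.integral_sum)
  finally show ?thesis .
qed

text \<open>The functions \<open>\<eta> j\<close> tend to 0 in the \<open>H\<^sup>1\<close> norm of \<open>\<Omega>\<close>, hence in \<open>L\<^sup>2\<close> of the part of the face in
  \<open>U\<close>, while on the face they also tend to \<open>g\<close>.\<close>

lemma limit_trace_vanishes_locally:
  assumes \<eta>: "\<And>j. smooth_fun (\<eta> j)" and \<delta>: "0 < \<delta>" and U: "U \<in> sets borel"
    and \<Omega>: "open \<Omega>" "bounded \<Omega>"
    and cyl: "{x. foot \<nu> b x \<in> e \<inter> U \<and> -\<delta> < height \<nu> b x \<and> height \<nu> b x < 0} \<subseteq> \<Omega>"
    and lim0: "(\<lambda>j. LINT x|lebesgue_on \<Omega>. (\<eta> j x)\<^sup>2) \<longlonglongrightarrow> 0"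
    and lim1: "\<And>i. (\<lambda>j. LINT x|lebesgue_on \<Omega>. (partial (\<eta> j) i x)\<^sup>2) \<longlonglongrightarrow> 0"
    and g: "g \<in> L2_space (face_measure e)"
    and limg: "(\<lambda>j. LINT y|face_measure e. (g y - \<eta> j y)\<^sup>2) \<longlonglongrightarrow> 0"
  shows "AE y in face_measure e. y \<in> U \<longrightarrow> g y = 0"
proof -
  let ?M = "face_measure e"
  note int = integrable_square_indicator[OF U]
  have \<eta>L2: "\<eta> j \<in> L2_space ?M" for j
    by (intro continuous_L2_face smooth_fun_continuous \<eta>)
  define c where "c j = (1 + \<delta>) * (LINT x|lebesgue_on \<Omega>. (\<eta> j x)\<^sup>2)
    + \<delta> * (\<Sum>i\<in>UNIV. LINT x|lebesgue_on \<Omega>. (partial (\<eta> j) i x)\<^sup>2)" for j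
  have "c \<longlonglongrightarrow> (1 + \<delta>) * 0 + \<delta> * (\<Sum>i\<in>(UNIV::'n set). 0)"
    unfolding c_def[abs_def] by (intro tendsto_intros lim0 lim1)
  then have c: "c \<longlonglongrightarrow> 0" by simp
  have bound: "(LINT y|?M. (g y)\<^sup>2 * indicator U y) \<le> 2 * (LINT y|?M. (g y - \<eta> j y)\<^sup>2) + 2 / \<delta> * c j" for j
  proof -
    have gj: "(\<lambda>y. g y - \<eta> j y) \<in> L2_space ?M" using g \<eta>L2 by (rule L2_space_diff)
    have "(LINT y|?M. (g y)\<^sup>2 * indicator U y)
      \<le> (LINT y|?M. 2 * (g y - \<eta> j y)\<^sup>2 + 2 * ((\<eta> j y)\<^sup>2 * indicator U y))"
    proof (rule integral_mono)
      show "integrable ?M (\<lambda>y. 2 * (g y - \<eta> j y)\<^sup>2 + 2 * ((\<eta> j y)\<^sup>2 * indicator U y))"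
        using gj int[OF \<eta>L2] by (auto simp: L2_space_def)
      show "(g y)\<^sup>2 * indicator U y \<le> 2 * (g y - \<eta> j y)\<^sup>2 + 2 * ((\<eta> j y)\<^sup>2 * indicator U y)" for y
        using power2_diff_le[of "g y - \<eta> j y" "- \<eta> j y"] by (auto simp: indicator_def)
    qed (rule int[OF g])
    also have "\<dots> = 2 * (LINT y|?M. (g y - \<eta> j y)\<^sup>2) + 2 * (LINT y|?M. (\<eta> j y)\<^sup>2 * indicator U y)"
      using gj int[OF \<eta>L2] by (subst Bochner_Integration.integral_add) (auto simp: L2_space_def)
    also have "(LINT y|?M. (\<eta> j y)\<^sup>2 * indicator U y) \<le> c j / \<delta>"
      using trace_inequality_domain[OF \<eta> \<delta> U \<Omega> cyl, of j] \<delta> by (simp add: c_def pos_le_divide_eq mult.commute)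
    finally show ?thesis by simp
  qed
  have "(\<lambda>j. 2 * (LINT y|?M. (g y - \<eta> j y)\<^sup>2) + 2 / \<delta> * c j) \<longlonglongrightarrow> 2 * 0 + 2 / \<delta> * 0"
    by (intro tendsto_intros limg c)
  then have "(LINT y|?M. (g y)\<^sup>2 * indicator U y) \<le> 2 * 0 + 2 / \<delta> * 0"
    using bound by (intro LIMSEQ_le_const) auto
  moreover have "0 \<le> (LINT y|?M. (g y)\<^sup>2 * indicator U y)" by (intro integral_nonneg_AE) auto
  ultimately have "(LINT y|?M. (g y)\<^sup>2 * indicator U y) = 0" by simp
  then have "AE y in ?M. (g y)\<^sup>2 * indicator U y = 0"
    by (subst (asm) integral_nonneg_eq_0_iff_AE[OF int[OF g]]) auto
  then show ?thesis by (auto simp: indicator_def elim!: eventually_mono)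
qed

end

section \<open>Uniqueness of traces on boundary faces\<close>

lemma flat_face_exists:
  fixes e :: "(real^'n::finite) set"
  assumes "face_shape e"
  obtains \<nu> b where "flat_face e \<nu> b"
proof -
  have "aff_dim e = int DIM(real^'n) - 1"
    using assms by (simp add: face_shape_def)
  then obtain a c where a: "a \<noteq> 0" "affine hull e = {x. a \<bullet> x = c}"
    using aff_dim_eq_hyperplane[of e] by auto
  have "flat_face e (a /\<^sub>R norm a) (c / norm a)"
  proof
    show "face_shape e" by fact
    show "norm (a /\<^sub>R norm a) = 1" using a(1) by simp
    have "a \<bullet> x = c \<longleftrightarrow> (a /\<^sub>R norm a) \<bullet> x = c / norm a" for x
      using a(1) by (simp add: field_simps)
    then show "affine hull e = {x. (a /\<^sub>R norm a) \<bullet> x = c / norm a}"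
      using a(2) by simp
  qed
  then show thesis by (rule that)
qed

lemma element_interior_subset_domain:
  assumes "polyhedral_domain \<Omega>" "partition_of \<Omega> Th Eh" "T \<in> Th"
  shows "interior T \<subseteq> \<Omega>"
proof -
  have "T \<subseteq> closure \<Omega>" using assms by (auto simp: partition_of_def)
  then have "interior T \<subseteq> interior (closure \<Omega>)" by (rule interior_mono)
  then show ?thesis using assms(1) by (simp add: polyhedral_domain_def)
qed

context flat_face
begin

lemma reversed_face: "flat_face e (- \<nu>) (- b)"
  using shape normal hull by unfold_locales auto

text \<open>Near a relatively interior point of \<open>e\<close> the boundary of \<open>T\<close> consists of \<open>e\<close> alone. The two halves of a
  small ball are connected and miss the boundary, so each lies inside or outside \<open>T\<close>; both cannot lie
  outside because the centre is a limit of interior points.\<close>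

lemma half_ball_in_element:
  assumes part: "partition_of \<Omega> Th Eh" and T: "T \<in> Th" and e: "e \<in> faces_of Eh T"
    and y: "y \<in> rel_interior e"
  obtains r where "0 < r"
    "(\<forall>x\<in>ball y r. height \<nu> b x < 0 \<longrightarrow> x \<in> interior T) \<or> (\<forall>x\<in>ball y r. 0 < height \<nu> b x \<longrightarrow> x \<in> interior T)"
proof -
  let ?O = "\<Union>(faces_of Eh T - {e})"
  have fin: "finite (faces_of Eh T)" using part by (simp add: partition_of_def faces_of_def)
  have "closed ?O"
  proof (rule closed_Union)
    show "finite (faces_of Eh T - {e})" using fin by simp
    show "\<forall>S\<in>faces_of Eh T - {e}. closed S"
    proof
      fix S assume "S \<in> faces_of Eh T - {e}"
      then have "face_shape S" using part by (auto simp: partition_of_def faces_of_def)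
      then obtain F where "finite F" "\<forall>P\<in>F. polytope P" "S = \<Union>F"
        unfolding face_shape_def polytope_union_def by blast
      then show "closed S" using closed_Union[of F] polytope_imp_closed by blast
    qed
  qed
  moreover have "y \<notin> ?O"
    using part e y unfolding partition_of_def faces_of_def by blast
  ultimately obtain r where "0 < r" "ball y r \<subseteq> - ?O"
    using openE[of "- ?O" y] by (metis Compl_iff open_Compl)
  then have r: "0 < r" "ball y r \<inter> ?O = {}" by blast+
  have "frontier T = \<Union>(faces_of Eh T)" using part T by (simp add: partition_of_def)
  then have fr: "x \<in> e" if "x \<in> frontier T" "x \<in> ball y r" for x
    using that r(2) by blast
  have half: "S \<subseteq> interior T" if "S \<subseteq> ball y r" "open S" "convex S" "S \<inter> {x. height \<nu> b x = 0} = {}" "S \<inter> T \<noteq> {}" for S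
  proof -
    have "S \<inter> frontier T = {}" using fr height_face that by blast
    then have "S \<subseteq> T"
      using connected_Int_frontier[OF convex_connected[OF that(3)], of T] that(5) by blast
    then show ?thesis using that(2) by (rule interior_maximal)
  qed
  have "y \<in> closure (interior T)"
  proof -
    have "y \<in> frontier T" using e y rel_interior_subset by (auto simp: faces_of_def)
    moreover have sh: "element_shape T" using part T by (simp add: partition_of_def)
    then have "closed T" by (metis closed_closure element_shape_def)
    ultimately have "y \<in> T" using frontier_subset_eq[of T] by blast
    then show ?thesis using sh by (simp add: element_shape_def)
  qed
  then have "interior T \<inter> ball y r \<noteq> {}"
    using r(1) open_Int_closure_eq_empty[OF open_ball, of y r "interior T"] centre_in_ball by blast
  then obtain z0 where "z0 \<in> interior T \<inter> ball y r" by blast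
  moreover have "open (interior T \<inter> ball y r)" by auto
  ultimately obtain \<epsilon> where \<epsilon>: "0 < \<epsilon>" "ball z0 \<epsilon> \<subseteq> interior T \<inter> ball y r"
    using open_contains_ball by blast
  \<comment> \<open>An interior point of \<open>T\<close> may lie on the hyperplane; moving it slightly along \<open>\<nu>\<close> puts it into one of
    the halves.\<close>
  have "\<exists>z\<in>ball z0 \<epsilon>. height \<nu> b z \<noteq> 0"
  proof (cases "height \<nu> b z0 = 0")
    case True
    then have "height \<nu> b (z0 + (\<epsilon> / 2) *\<^sub>R \<nu>) \<noteq> 0"
      using \<epsilon>(1) normal by (simp add: height_translate)
    moreover have "z0 + (\<epsilon> / 2) *\<^sub>R \<nu> \<in> ball z0 \<epsilon>"
      using \<epsilon>(1) normal by (simp add: dist_norm)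
    ultimately show ?thesis by blast
  qed (use \<epsilon>(1) centre_in_ball in blast)
  then obtain z where z: "z \<in> interior T" "z \<in> ball y r" "height \<nu> b z \<noteq> 0" using \<epsilon>(2) by blast
  then have zT: "z \<in> T" using interior_subset by blast
  have half_spaces: "{x. height \<nu> b x < 0} = {x. \<nu> \<bullet> x < b}" "{x. 0 < height \<nu> b x} = {x. \<nu> \<bullet> x > b}"
    by (auto simp: height_def)
  let ?L = "ball y r \<inter> {x. height \<nu> b x < 0}" and ?R = "ball y r \<inter> {x. 0 < height \<nu> b x}"
  have "?L \<subseteq> interior T \<or> ?R \<subseteq> interior T"
  proof (cases "height \<nu> b z < 0")
    case True
    have "?L \<inter> T \<noteq> {}" using z(2) zT True by blast
    moreover have "open ?L" "convex ?L"
      unfolding half_spaces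
      by (intro open_Int convex_Int open_ball convex_ball open_halfspace_lt convex_halfspace_lt)+
    moreover have "?L \<inter> {x. height \<nu> b x = 0} = {}" by auto
    ultimately have "?L \<subseteq> interior T" by (intro half) auto
    then show ?thesis ..
  next
    case False
    have "?R \<inter> T \<noteq> {}" using False z zT by auto
    moreover have "open ?R" "convex ?R"
      unfolding half_spaces
      by (intro open_Int convex_Int open_ball convex_ball open_halfspace_gt convex_halfspace_gt)+
    moreover have "?R \<inter> {x. height \<nu> b x = 0} = {}" by auto
    ultimately have "?R \<subseteq> interior T" by (intro half) auto
    then show ?thesis ..
  qed
  then show thesis by (intro that[OF r(1)]) auto
qed

text \<open>Points of the slab over the relative boundary of \<open>e\<close> are boundary points of the slab. The slab is a
  finite union of convex sets, so its boundary is negligible.\<close>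

lemma AE_rel_interior: "AE y in face_measure e. y \<in> rel_interior e"
proof -
  obtain F where F: "finite F" "\<forall>P\<in>F. polytope P" "e = \<Union>F"
    using shape unfolding face_shape_def polytope_union_def by blast
  let ?S = "\<lambda>P. {x. foot \<nu> b x \<in> P \<and> \<bar>height \<nu> b x\<bar> \<le> 1 / 2}"
  have conv: "convex (?S P)" if "P \<in> F" for P
  proof (rule convexI)
    fix x y and u v :: real
    assume x: "x \<in> ?S P" and y: "y \<in> ?S P" and uv: "0 \<le> u" "0 \<le> v" "u + v = 1"
    have h: "height \<nu> b (u *\<^sub>R x + v *\<^sub>R y) = u * height \<nu> b x + v * height \<nu> b y"
      using uv(3) by (simp add: height_def inner_add_right algebra_simps) (metis distrib_left mult.right_neutral)
    have f: "foot \<nu> b (u *\<^sub>R x + v *\<^sub>R y) = u *\<^sub>R foot \<nu> b x + v *\<^sub>R foot \<nu> b y"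
      unfolding foot_def h by (simp add: algebra_simps)
    have "foot \<nu> b (u *\<^sub>R x + v *\<^sub>R y) \<in> P"
      unfolding f using x y uv F(2) that polytope_imp_convex by (auto intro!: convexD)
    moreover have "\<bar>height \<nu> b (u *\<^sub>R x + v *\<^sub>R y)\<bar> \<le> u * (1/2) + v * (1/2)"
    proof -
      have "\<bar>u * height \<nu> b x + v * height \<nu> b y\<bar> \<le> u * \<bar>height \<nu> b x\<bar> + v * \<bar>height \<nu> b y\<bar>"
        using abs_triangle_ineq[of "u * height \<nu> b x" "v * height \<nu> b y"] uv by (simp add: abs_mult)
      also have "\<dots> \<le> u * (1/2) + v * (1/2)"
        using x y uv by (intro add_mono mult_left_mono) auto
      finally show ?thesis unfolding h .
    qed
    ultimately show "u *\<^sub>R x + v *\<^sub>R y \<in> ?S P" using uv(3) by (simp flip: distrib_right)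
  qed
  have sl: "slab e = \<Union>(?S ` F)" unfolding slab_face by (subst F(3)) auto
  have "negligible (frontier (slab e))"
  proof (rule negligible_subset)
    show "frontier (slab e) \<subseteq> \<Union>(frontier ` ?S ` F)"
      unfolding sl using F(1) by (intro frontier_Union_subset) auto
    show "negligible (\<Union>(frontier ` ?S ` F))"
      using F(1) conv by (intro negligible_Union) (auto intro: negligible_convex_frontier)
  qed
  then have "AE x in lebesgue. x \<notin> frontier (slab e)"
    by (intro AE_not_in) (simp add: negligible_iff_null_sets)
  then have ae: "AE x in lebesgue_on (slab e). x \<notin> frontier (slab e)"
    by (auto simp: AE_restrict_space_iff elim!: eventually_mono)
  have rel: "foot \<nu> b x \<in> rel_interior e" if x: "x \<in> slab e" "x \<notin> frontier (slab e)" for x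
  proof -
    have "x \<in> interior (slab e)" using x closure_subset by (auto simp: frontier_def)
    then obtain \<epsilon> where \<epsilon>: "0 < \<epsilon>" "ball x \<epsilon> \<subseteq> slab e" by (meson mem_interior)
    have "z \<in> e" if z: "z \<in> ball (foot \<nu> b x) \<epsilon>" "z \<in> affine hull e" for z
    proof -
      have "height \<nu> b z = 0" using z(2) hull by (simp add: height_def)
      then have "foot \<nu> b (z + height \<nu> b x *\<^sub>R \<nu>) = z"
        using normal by (simp add: foot_translate foot_eq_self)
      moreover have "dist x (z + height \<nu> b x *\<^sub>R \<nu>) = dist (foot \<nu> b x) z"
        by (simp add: dist_norm foot_def algebra_simps)
      ultimately have "z + height \<nu> b x *\<^sub>R \<nu> \<in> slab e" using z(1) \<epsilon>(2) by auto
      then show ?thesis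
        using \<open>foot \<nu> b (z + height \<nu> b x *\<^sub>R \<nu>) = z\<close> by (simp add: slab_face)
    qed
    moreover have "foot \<nu> b x \<in> e" using x by (simp add: slab_face)
    ultimately show ?thesis unfolding mem_rel_interior_ball using \<epsilon>(1) by blast
  qed
  have "rel_interior e \<in> sets (restrict_space borel e)"
  proof -
    obtain V where "open V" "rel_interior e = affine hull e \<inter> V"
      using openin_rel_interior[of e] by (auto simp: openin_open)
    then have "rel_interior e \<in> sets borel"
      by (auto intro!: sets.Int borel_closed closed_affine_hull)
    then show ?thesis using rel_interior_subset by (auto simp: sets_restrict_space image_iff)
  qed
  then have m: "{y \<in> space (restrict_space borel e). y \<in> rel_interior e} \<in> sets (restrict_space borel e)"
    using rel_interior_subset[of e] by (auto simp: space_restrict_space Collect_conj_eq Int_absorb1)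
  show ?thesis
    unfolding face_measure_eq AE_distr_iff[OF measurable_foot_slab m]
    using ae by (rule AE_mp) (auto intro!: AE_I2 rel)
qed

end

text \<open>Globalisation of \<open>limit_trace_vanishes_locally\<close>: the balls on which it applies cover the relative
  interior of \<open>e\<close>, and by Lindelof's theorem countably many of them suffice.\<close>

lemma limit_trace_vanishes:
  fixes \<Omega> :: "(real^'n::finite) set"
  assumes dom: "polyhedral_domain \<Omega>" and part: "partition_of \<Omega> Th Eh" and e: "e \<in> Eh"
    and \<eta>: "\<And>j. smooth_fun (\<eta> j)"
    and lim0: "(\<lambda>j. LINT x|lebesgue_on \<Omega>. (\<eta> j x)\<^sup>2) \<longlonglongrightarrow> 0"
    and lim1: "\<And>i. (\<lambda>j. LINT x|lebesgue_on \<Omega>. (partial (\<eta> j) i x)\<^sup>2) \<longlonglongrightarrow> 0"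
    and g: "g \<in> L2_space (face_measure e)"
    and limg: "(\<lambda>j. LINT y|face_measure e. (g y - \<eta> j y)\<^sup>2) \<longlonglongrightarrow> 0"
  shows "AE y in face_measure e. g y = 0"
proof -
  have \<Omega>: "open \<Omega>" "bounded \<Omega>" using dom by (auto simp: polyhedral_domain_def)
  obtain T where T: "T \<in> Th" "e \<in> faces_of Eh T" using part e by (auto simp: partition_of_def)
  have shape: "face_shape e" using part e by (auto simp: partition_of_def)
  obtain \<nu> b where "flat_face e \<nu> b" using flat_face_exists[OF shape] .
  then interpret flat_face e \<nu> b .
  define \<U> where "\<U> = {U. open U \<and> (AE y in face_measure e. y \<in> U \<longrightarrow> g y = 0)}"
  have cover: "rel_interior e \<subseteq> \<Union>\<U>"
  proof
    fix y assume y: "y \<in> rel_interior e"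
    obtain r where r: "0 < r" "(\<forall>x\<in>ball y r. height \<nu> b x < 0 \<longrightarrow> x \<in> interior T) \<or>
        (\<forall>x\<in>ball y r. 0 < height \<nu> b x \<longrightarrow> x \<in> interior T)"
      using half_ball_in_element[OF part T y] .
    have sub: "interior T \<subseteq> \<Omega>" using dom part T(1) by (rule element_interior_subset_domain)
    \<comment> \<open>A cylinder of radius and height \<open>r / 2\<close> fits into the half ball of radius \<open>r\<close>. The normal is a
      parameter because it has to point away from the half ball.\<close>
    have key: "AE y' in face_measure e. y' \<in> ball y (r/2) \<longrightarrow> g y' = 0"
      if ff: "flat_face e \<nu>' b'" and below: "\<forall>x\<in>ball y r. height \<nu>' b' x < 0 \<longrightarrow> x \<in> interior T" for \<nu>' b'
    proof -
      interpret f: flat_face e \<nu>' b' by (rule ff)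
      show ?thesis
      proof (rule f.limit_trace_vanishes_locally[OF \<eta> _ _ \<Omega> _ lim0 lim1 g limg])
        show "0 < r/2" using r(1) by simp
        show "ball y (r/2) \<in> sets borel" by simp
        show "{x. foot \<nu>' b' x \<in> e \<inter> ball y (r/2) \<and> - (r/2) < height \<nu>' b' x \<and> height \<nu>' b' x < 0} \<subseteq> \<Omega>"
        proof (safe, rule subsetD[OF sub])
          fix x assume x: "foot \<nu>' b' x \<in> ball y (r/2)" "- (r/2) < height \<nu>' b' x" "height \<nu>' b' x < 0"
          have "dist y x \<le> dist y (foot \<nu>' b' x) + dist (foot \<nu>' b' x) x" by (rule dist_triangle)
          also have "dist (foot \<nu>' b' x) x = \<bar>height \<nu>' b' x\<bar>"
            using f.normal by (simp add: foot_def dist_norm)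
          finally have "x \<in> ball y r" using x by simp
          then show "x \<in> interior T" using below x(3) by blast
        qed
      qed
    qed
    have "AE y' in face_measure e. y' \<in> ball y (r/2) \<longrightarrow> g y' = 0"
      using r(2)
    proof
      assume "\<forall>x\<in>ball y r. height \<nu> b x < 0 \<longrightarrow> x \<in> interior T"
      then show ?thesis by (intro key[of \<nu> b]) unfold_locales
    next
      assume "\<forall>x\<in>ball y r. 0 < height \<nu> b x \<longrightarrow> x \<in> interior T"
      then have "\<forall>x\<in>ball y r. height (- \<nu>) (- b) x < 0 \<longrightarrow> x \<in> interior T" by (simp add: height_def)
      then show ?thesis by (intro key[OF reversed_face])
    qed
    then show "y \<in> \<Union>\<U>" using r(1) unfolding \<U>_def by (intro UnionI[of "ball y (r/2)"]) auto
  qed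
  obtain \<V> where \<V>: "\<V> \<subseteq> \<U>" "countable \<V>" "\<Union>\<V> = \<Union>\<U>"
    using Lindelof[of \<U>] unfolding \<U>_def by blast
  have "AE y in face_measure e. \<forall>U\<in>\<V>. y \<in> U \<longrightarrow> g y = 0"
    using \<V>(1) by (subst AE_ball_countable[OF \<V>(2)]) (auto simp: \<U>_def)
  with AE_rel_interior show ?thesis
    by eventually_elim (use cover \<V>(3) in blast)
qed

text \<open>The difference of a sequence defining the trace \<open>g\<close> and a sequence of test functions tends to 0 in
  \<open>H\<^sup>1(\<Omega>)\<close>, and its restriction to the face tends to \<open>g\<close>, since test functions vanish on the
  boundary.\<close>

lemma trace_on_boundary_face:
  fixes \<Omega> :: "(real^'n::finite) set"
  assumes dom: "polyhedral_domain \<Omega>" and part: "partition_of \<Omega> Th Eh" and e: "e \<in> Eh"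
    and bd: "e \<subseteq> frontier \<Omega>" and w: "w \<in> H10 \<Omega>" and tr: "has_trace \<Omega> e w g"
  shows "AE y in face_measure e. g y = 0"
proof -
  have \<Omega>: "open \<Omega>" "bounded \<Omega>" using dom by (auto simp: polyhedral_domain_def)
  have ws: "w \<in> sobolev \<Omega> 1" using w by (simp add: H10_def)
  have g: "g \<in> L2_space (face_measure e)" using tr by (simp add: has_trace_def)
  have shape: "face_shape e" using part e by (auto simp: partition_of_def)
  obtain \<nu> b where "flat_face e \<nu> b" using flat_face_exists[OF shape] .
  then interpret flat_face e \<nu> b .
  obtain \<psi> :: "nat \<Rightarrow> real^'n \<Rightarrow> real" where \<psi>: "\<And>j. smooth_fun (\<psi> j)"
    "(\<lambda>j. sobolev_norm \<Omega> 1 (w - \<psi> j)) \<longlonglongrightarrow> 0"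
    "(\<lambda>j. LINT x|face_measure e. (g x - \<psi> j x)\<^sup>2) \<longlonglongrightarrow> 0"
    using tr by (auto simp: has_trace_def)
  have "\<forall>j. \<exists>\<zeta>. \<zeta> \<in> test_functions \<Omega> \<and> sobolev_norm \<Omega> 1 (w - \<zeta>) < inverse (real (Suc j))"
  proof
    fix j
    have "0 < inverse (real (Suc j))" by simp
    then show "\<exists>\<zeta>. \<zeta> \<in> test_functions \<Omega> \<and> sobolev_norm \<Omega> 1 (w - \<zeta>) < inverse (real (Suc j))"
      using w unfolding H10_def by blast
  qed
  then obtain \<zeta> where \<zeta>: "\<And>j. \<zeta> j \<in> test_functions \<Omega>"
    "\<And>j. sobolev_norm \<Omega> 1 (w - \<zeta> j) < inverse (real (Suc j))" by metis
  have \<zeta>s: "smooth_fun (\<zeta> j)" for j using test_functionD(1)[OF \<zeta>(1)] .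
  have nonneg: "0 \<le> sobolev_norm \<Omega> 1 v" for v
    unfolding sobolev_norm_def by (intro real_sqrt_ge_zero sum_nonneg) auto
  have small: "\<forall>\<^sub>F j in sequentially. sobolev_norm \<Omega> 1 (w - \<zeta> j) \<le> inverse (real (Suc j))"
    by (intro always_eventually allI less_imp_le \<zeta>(2))
  have \<zeta>lim: "(\<lambda>j. sobolev_norm \<Omega> 1 (w - \<zeta> j)) \<longlonglongrightarrow> 0"
    by (rule tendsto_sandwich[OF _ small tendsto_const LIMSEQ_inverse_real_of_nat])
      (intro always_eventually allI nonneg)
  have bl: "(\<lambda>j. 2 * ((sobolev_norm \<Omega> 1 (w - \<psi> j))\<^sup>2 + (sobolev_norm \<Omega> 1 (w - \<zeta> j))\<^sup>2)) \<longlonglongrightarrow> 2 * (0\<^sup>2 + 0\<^sup>2)"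
    by (intro tendsto_intros \<psi>(2) \<zeta>lim)
  note le = smooth_difference_L2_le_sobolev_norm[OF \<Omega> ws \<psi>(1) \<zeta>s]
  have 0: "\<zeta> j y = 0" if "y \<in> e" for j y
    using that bd \<Omega>(1) test_functionD(3)[OF \<zeta>(1)] by (auto simp: frontier_def interior_open)
  show ?thesis
  proof (rule limit_trace_vanishes[OF dom part e _ _ _ g])
    show "smooth_fun (\<lambda>x. \<psi> j x - \<zeta> j x)" for j
      by (intro smooth_fun_diff \<psi>(1) \<zeta>s)
    show "(\<lambda>j. LINT x|lebesgue_on \<Omega>. (\<psi> j x - \<zeta> j x)\<^sup>2) \<longlonglongrightarrow> 0"
      by (rule tendsto_sandwich[OF _ _ tendsto_const bl[simplified]]) (use le(1) in auto)
    show "(\<lambda>j. LINT x|lebesgue_on \<Omega>. (partial (\<lambda>x. \<psi> j x - \<zeta> j x) i x)\<^sup>2) \<longlonglongrightarrow> 0" for i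
      by (rule tendsto_sandwich[OF _ _ tendsto_const bl[simplified]]) (use le(2) in auto)
    have "(LINT y|face_measure e. (g y - (\<psi> j y - \<zeta> j y))\<^sup>2) = (LINT y|face_measure e. (g y - \<psi> j y)\<^sup>2)" for j
      by (intro Bochner_Integration.integral_cong) (auto simp: 0)
    then show "(\<lambda>j. LINT y|face_measure e. (g y - (\<psi> j y - \<zeta> j y))\<^sup>2) \<longlonglongrightarrow> 0"
      using \<psi>(3) by simp
  qed
qed

section \<open>Polynomials\<close>

lemma polys_0: "(\<lambda>_. 0) \<in> polys j"
  using span_zero[of "(\<lambda>\<alpha> x. \<Prod>i\<in>UNIV. (x $ i) ^ \<alpha> i) ` multi_indices j"]
  by (simp add: polys_def zero_fun_def)

lemma polys_add: "p \<in> polys j \<Longrightarrow> q \<in> polys j \<Longrightarrow> (\<lambda>x. p x + q x) \<in> polys j"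
  using span_add[of p _ q] by (simp add: polys_def plus_fun_def)

lemma polys_scale: "p \<in> polys j \<Longrightarrow> (\<lambda>x. c * p x) \<in> polys j"
  using span_scale[of p _ c] by (simp add: polys_def scaleR_fun_def)

lemma polys_diff: "p \<in> polys j \<Longrightarrow> q \<in> polys j \<Longrightarrow> (\<lambda>x. p x - q x) \<in> polys j"
  using polys_add[OF _ polys_scale[of q j "-1"], of p] by simp

lemma polys_induct [consumes 1, case_names monomial zero add scale]:
  assumes "p \<in> polys j"
    and "\<And>\<alpha>. P (\<lambda>x. \<Prod>i\<in>UNIV. (x $ i) ^ \<alpha> i)" "P (\<lambda>_. 0)"
    and "\<And>p q. P p \<Longrightarrow> P q \<Longrightarrow> P (\<lambda>x. p x + q x)" "\<And>c p. P p \<Longrightarrow> P (\<lambda>x. c * p x)"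
  shows "P p"
  using assms(1) unfolding polys_def
proof (induction rule: span_induct_alt)
  case base
  then show ?case using assms(3) by (simp add: zero_fun_def)
next
  case (step c x y)
  then obtain \<alpha> where "x = (\<lambda>x. \<Prod>i\<in>UNIV. (x $ i) ^ \<alpha> i)" by auto
  then show ?case
    using assms(4)[OF assms(5)[OF assms(2)] step(2)] by (simp add: plus_fun_def scaleR_fun_def)
qed

lemma polys_smooth:
  assumes "p \<in> polys j"
  shows "smooth_fun p"
proof -
  have "p \<in> smooth_algebra"
    using assms
  proof (induction rule: polys_induct)
    case (monomial \<alpha>)
    show ?case by (intro smooth_algebra_prod smooth_algebra_power smooth_algebra.coord finite)
  next
    case zero
    show ?case by (rule smooth_algebra.const)
  next
    case (add p q)
    then show ?case by (rule smooth_algebra.add)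
  next
    case (scale c p)
    then show ?case by (rule smooth_algebra.mult[OF smooth_algebra.const])
  qed
  then show ?thesis by (rule smooth_algebra_smooth)
qed

lemma polys_continuous: "p \<in> polys j \<Longrightarrow> continuous_on UNIV p"
  using polys_smooth smooth_fun_continuous by blast

text \<open>Along the line from a point of \<open>S\<close> to \<open>y\<close> the polynomial is a univariate one with infinitely many
  zeros.\<close>

lemma polys_eq_0:
  fixes p :: "real^'n::finite \<Rightarrow> real"
  assumes p: "p \<in> polys j" and S: "open S" "S \<noteq> {}" "\<And>x. x \<in> S \<Longrightarrow> p x = 0"
  shows "p y = 0"
proof -
  have rp: "real_polynomial_function p"
    using p
  proof (induction rule: polys_induct)
    case (monomial \<alpha>)
    show ?case
      by (intro real_polynomial_function_prod real_polynomial_function_power real_polynomial_function.intros(1)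
          bounded_linear_vec_nth finite)
  next
    case zero
    show ?case by (rule real_polynomial_function.intros(2))
  next
    case (add p q)
    then show ?case by (rule real_polynomial_function.intros(3))
  next
    case (scale c p)
    then show ?case by (rule real_polynomial_function.intros(4)[OF real_polynomial_function.intros(2)])
  qed
  obtain x where x: "x \<in> S" using S(2) by blast
  obtain \<epsilon> where \<epsilon>: "0 < \<epsilon>" "ball x \<epsilon> \<subseteq> S" using S(1) x openE by blast
  let ?l = "\<lambda>t. x + t *\<^sub>R (y - x)"
  have "polynomial_function ?l"
    by (intro polynomial_function_add polynomial_function_const polynomial_function_mult
        polynomial_function_id[unfolded id_def])
  then have "real_polynomial_function (p \<circ> ?l)"
    using rp by (intro real_polynomial_function_compose)
  then obtain a n where an: "p \<circ> ?l = (\<lambda>t. \<Sum>i\<le>n. a i * t ^ i)"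
    using real_polynomial_function_iff_sum by blast
  define d where "d = \<epsilon> / (norm (y - x) + 1)"
  have nz: "0 < norm (y - x) + 1" by (simp add: add_nonneg_pos)
  have d: "0 < d" using \<epsilon>(1) nz by (simp add: d_def)
  have "{0<..<d} \<subseteq> {t. (\<Sum>i\<le>n. a i * t ^ i) = 0}"
  proof
    fix t assume t: "t \<in> {0<..<d}"
    have "\<bar>t\<bar> * norm (y - x) \<le> t * (norm (y - x) + 1)" using t by (simp add: mult_left_mono)
    also have "\<dots> < d * (norm (y - x) + 1)" using t nz by (intro mult_strict_right_mono) auto
    also have "\<dots> = \<epsilon>" using nz by (simp add: d_def)
    finally have "?l t \<in> S" using \<epsilon>(2) by (auto simp: dist_norm)
    then show "t \<in> {t. (\<Sum>i\<le>n. a i * t ^ i) = 0}"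
      using S(3) fun_cong[OF an, of t] by simp
  qed
  moreover have "infinite {0<..<d}" using d by (rule infinite_Ioo)
  ultimately have "infinite {t. (\<Sum>i\<le>n. a i * t ^ i) = 0}" using infinite_super by blast
  then have "\<forall>i\<le>n. a i = 0" using polyfun_finite_roots[of a n] by blast
  then have "(p \<circ> ?l) 1 = 0" unfolding an by simp
  then show ?thesis by simp
qed

section \<open>Riesz representation on polynomials\<close>

text \<open>Riesz representation for a semidefinite form \<open>B\<close> on a finite-dimensional space. The functional has to
  vanish on the null vectors of \<open>B\<close>; for the surface measure of a face such vectors are the polynomials
  vanishing on its hyperplane. The proof is Gram--Schmidt orthogonalisation, one generator at a time.\<close>

lemma finite_span_representation:
  fixes V :: "'v::real_vector set" and B :: "'v \<Rightarrow> 'v \<Rightarrow> real"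
  assumes V: "subspace V"
    and add: "\<And>u v w. u \<in> V \<Longrightarrow> v \<in> V \<Longrightarrow> w \<in> V \<Longrightarrow> B (u + v) w = B u w + B v w"
    and scale: "\<And>c u w. u \<in> V \<Longrightarrow> w \<in> V \<Longrightarrow> B (c *\<^sub>R u) w = c * B u w"
    and sym: "\<And>u w. u \<in> V \<Longrightarrow> w \<in> V \<Longrightarrow> B u w = B w u"
    and nonneg: "\<And>u. u \<in> V \<Longrightarrow> 0 \<le> B u u"
    and S: "finite S" "S \<subseteq> V"
    and F: "\<And>u v. u \<in> V \<Longrightarrow> v \<in> V \<Longrightarrow> F (u + v) = F u + F v"
      "\<And>c u. u \<in> V \<Longrightarrow> F (c *\<^sub>R u) = c * F u"
      "\<And>u. u \<in> V \<Longrightarrow> B u u = 0 \<Longrightarrow> F u = 0"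
  shows "\<exists>p\<in>span S. \<forall>q\<in>span S. B p q = F q"
  using S F
proof (induction S arbitrary: F rule: finite_induct)
  case empty
  have "0 \<in> V" using V by (rule subspace_0)
  then show ?case using scale[of 0 0 0] empty(3)[of 0 0] by simp
next
  case (insert s S)
  have SV: "span S \<subseteq> V" using insert.prems(1) V by (simp add: span_minimal)
  have s: "s \<in> V" using insert.prems by blast
  \<comment> \<open>A null vector is orthogonal to everything: \<open>B (s + t u) (s + t u)\<close> is affine in \<open>t\<close> and bounded below.\<close>
  have null: "B s u = 0" if u: "u \<in> V" "B u u = 0" for u
  proof -
    have "0 \<le> B s s + 2 * t * B s u" for t
    proof -
      have tu: "t *\<^sub>R u \<in> V" "s + t *\<^sub>R u \<in> V" using V s u by (auto intro: subspace_add subspace_scale)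
      have "B (s + t *\<^sub>R u) (s + t *\<^sub>R u) = B s (s + t *\<^sub>R u) + t * B u (s + t *\<^sub>R u)"
        using add[OF s tu(1) tu(2)] scale[OF u(1) tu(2)] by simp
      also have "B s (s + t *\<^sub>R u) = B s s + t * B s u"
        using sym[OF s tu(2)] add[OF s tu(1) s] scale[OF u(1) s] sym[OF u(1) s] by simp
      also have "B u (s + t *\<^sub>R u) = B s u"
        using sym[OF u(1) tu(2)] add[OF s tu(1) u(1)] scale[OF u(1) u(1)] u(2) by simp
      finally show ?thesis using nonneg[OF tu(2)] by simp
    qed
    note t = this
    show ?thesis
    proof (rule ccontr)
      assume "B s u \<noteq> 0"
      \<comment> \<open>This value of \<open>t\<close> makes the affine function equal to \<open>-1\<close>.\<close>
      then show False using t[of "- (B s s + 1) / (2 * B s u)"] by (simp add: field_simps)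
    qed
  qed
  have ex: "\<exists>p\<in>span S. \<forall>q\<in>span S. B p q = G q"
    if "\<And>u v. u \<in> V \<Longrightarrow> v \<in> V \<Longrightarrow> G (u + v) = G u + G v"
      "\<And>c u. u \<in> V \<Longrightarrow> G (c *\<^sub>R u) = c * G u"
      "\<And>u. u \<in> V \<Longrightarrow> B u u = 0 \<Longrightarrow> G u = 0" for G
    using insert.IH[OF _ that] insert.prems(1) by blast
  have "\<exists>r\<in>span S. \<forall>q\<in>span S. B r q = B s q"
  proof (rule ex)
    show "B s (u + v) = B s u + B s v" if "u \<in> V" "v \<in> V" for u v
      using that s V add[OF that s] sym[of s] by (simp add: subspace_add)
    show "B s (c *\<^sub>R u) = c * B s u" if "u \<in> V" for c u
      using that s V scale[OF that s] sym[of s] by (simp add: subspace_scale)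
  qed (rule null)
  then obtain r where r: "r \<in> span S" "\<And>q. q \<in> span S \<Longrightarrow> B r q = B s q" by blast
  obtain p where p: "p \<in> span S" "\<And>q. q \<in> span S \<Longrightarrow> B p q = F q"
    using ex[OF insert.prems(2,3,4)] by blast
  \<comment> \<open>\<open>r\<close> represents the projection of \<open>s\<close> onto the span of \<open>S\<close>, so \<open>z\<close> is orthogonal to that span.\<close>
  define z where "z = s - r"
  have rV: "r \<in> V" and pV: "p \<in> V" using r p SV by auto
  have zV: "z \<in> V" unfolding z_def using V s rV by (rule subspace_diff)
  have z0: "B z q = 0" if "q \<in> span S" for q
  proof -
    have "q \<in> V" using that SV by blast
    have "B (z + r) q = B z q + B r q" using zV rV \<open>q \<in> V\<close> by (rule add)
    then show ?thesis using r(2)[OF that] by (simp add: z_def)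
  qed
  \<comment> \<open>If \<open>z\<close> is a null vector, then \<open>F z = 0\<close>, and \<open>p\<close> represents \<open>F\<close> on the larger span as well.\<close>
  define c where "c = (if B z z = 0 then 0 else F z / B z z)"
  have c: "c * B z z = F z" using insert.prems(4)[OF zV] by (simp add: c_def)
  show ?case
  proof (intro bexI ballI)
    have sS: "span S \<subseteq> span (insert s S)" by (rule span_mono) blast
    have "z \<in> span (insert s S)"
      unfolding z_def using span_base[of s "insert s S"] subsetD[OF sS r(1)] by (intro span_diff) auto
    then show "p + c *\<^sub>R z \<in> span (insert s S)"
      using p(1) sS by (intro span_add span_scale) auto
    fix q assume "q \<in> span (insert s S)"
    then obtain k where k: "q - k *\<^sub>R s \<in> span S" by (auto simp: span_breakdown_eq)
    define w where "w = (q - k *\<^sub>R s) + k *\<^sub>R r"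
    have w: "w \<in> span S" unfolding w_def using k r(1) by (intro span_add span_scale)
    have q: "q = w + k *\<^sub>R z" by (simp add: w_def z_def algebra_simps)
    have wV: "w \<in> V" using w SV by blast
    have kz: "k *\<^sub>R z \<in> V" "c *\<^sub>R z \<in> V" using V zV by (auto intro: subspace_scale)
    have qV: "q \<in> V" unfolding q using V wV kz(1) by (rule subspace_add)
    have "B (p + c *\<^sub>R z) q = B q p + c * B q z"
      using add[OF pV kz(2) qV] scale[OF zV qV] sym[OF qV pV] sym[OF qV zV] by simp
    also have "B q p = F w"
      unfolding q using add[OF wV kz(1) pV] scale[OF zV pV] z0[OF p(1)] sym[OF wV pV] p(2)[OF w] by simp
    also have "B q z = k * B z z"
      unfolding q using add[OF wV kz(1) zV] scale[OF zV zV] z0[OF w] sym[OF wV zV] by simp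
    also have "F w + c * (k * B z z) = F q"
      unfolding q using insert.prems(2)[OF wV kz(1)] insert.prems(3)[OF zV] c by (simp add: mult.left_commute)
    finally show "B (p + c *\<^sub>R z) q = F q" .
  qed
qed

lemma polys_representation:
  fixes F :: "(real^'n::finite \<Rightarrow> real) \<Rightarrow> real"
  assumes L2: "\<And>p. p \<in> polys j \<Longrightarrow> p \<in> L2_space M"
    and F: "\<And>p q. p \<in> polys j \<Longrightarrow> q \<in> polys j \<Longrightarrow> F (\<lambda>x. p x + q x) = F p + F q"
      "\<And>c p. p \<in> polys j \<Longrightarrow> F (\<lambda>x. c * p x) = c * F p"
      "\<And>p. p \<in> polys j \<Longrightarrow> (AE x in M. p x = 0) \<Longrightarrow> F p = 0"
  shows "\<exists>p\<in>polys j. \<forall>q\<in>polys j. (LINT x|M. p x * q x) = F q"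
proof -
  note int = integrable_mult_L2[OF L2 L2]
  have P: "polys j = span ((\<lambda>\<alpha> x. \<Prod>i\<in>UNIV. (x $ i) ^ \<alpha> i) ` multi_indices j)" by (simp add: polys_def)
  show ?thesis
    unfolding P
  proof (rule finite_span_representation[where V="polys j" and B="\<lambda>p q. LINT x|M. p x * q x"])
    show "subspace (polys j)" unfolding P by (rule subspace_span)
    show "finite ((\<lambda>\<alpha> x. \<Prod>i\<in>UNIV. (x $ i) ^ \<alpha> i) ` multi_indices j)"
      by (intro finite_imageI finite_multi_indices)
    show "(\<lambda>\<alpha> x. \<Prod>i\<in>UNIV. (x $ i) ^ \<alpha> i) ` multi_indices j \<subseteq> polys j"
      unfolding P by (rule span_superset)
    show "(LINT x|M. (u + v) x * w x) = (LINT x|M. u x * w x) + (LINT x|M. v x * w x)"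
      if "u \<in> polys j" "v \<in> polys j" "w \<in> polys j" for u v w
      using int[OF that(1,3)] int[OF that(2,3)] by (simp add: distrib_right)
    show "(LINT x|M. (c *\<^sub>R u) x * w x) = c * (LINT x|M. u x * w x)" for c u w
      by (simp add: scaleR_fun_def mult.assoc)
    show "(LINT x|M. u x * w x) = (LINT x|M. w x * u x)" for u w :: "real^'n \<Rightarrow> real" by (simp add: mult.commute)
    show "0 \<le> (LINT x|M. u x * u x)" for u :: "real^'n \<Rightarrow> real" by (intro integral_nonneg_AE) auto
    show "F (u + v) = F u + F v" if "u \<in> polys j" "v \<in> polys j" for u v
      using F(1)[OF that] by (simp add: plus_fun_def)
    show "F (c *\<^sub>R u) = c * F u" if "u \<in> polys j" for c u
      using F(2)[OF that] by (simp add: scaleR_fun_def)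
    show "F u = 0" if u: "u \<in> polys j" "(LINT x|M. u x * u x) = 0" for u
    proof (rule F(3)[OF u(1)])
      have "AE x in M. u x * u x = 0"
        using u(2) by (subst (asm) integral_nonneg_eq_0_iff_AE[OF int[OF u(1) u(1)]]) auto
      then show "AE x in M. u x = 0" by simp
    qed
  qed
qed

lemma L2_proj:
  fixes w :: "real^'n::finite \<Rightarrow> real"
  assumes L2: "\<And>p :: real^'n \<Rightarrow> real. p \<in> polys (int k) \<Longrightarrow> p \<in> L2_space M" and w: "w \<in> L2_space M"
  shows "L2_proj M k w \<in> polys (int k)"
    "q \<in> polys (int k) \<Longrightarrow> (LINT x|M. L2_proj M k w x * q x) = (LINT x|M. w x * q x)"
proof -
  note int = integrable_mult_L2[OF w L2]
  have "\<exists>p\<in>polys (int k). \<forall>q\<in>polys (int k). (LINT x|M. p x * q x) = (LINT x|M. w x * q x)"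
  proof (rule polys_representation[OF L2])
    show "(LINT x|M. w x * (p x + q x)) = (LINT x|M. w x * p x) + (LINT x|M. w x * q x)"
      if "p \<in> polys (int k)" "q \<in> polys (int k)" for p q
      using int[OF that(1)] int[OF that(2)] by (simp add: distrib_left)
    show "(LINT x|M. w x * (c * p x)) = c * (LINT x|M. w x * p x)" for c p
      by (simp add: mult.left_commute)
    show "(LINT x|M. w x * p x) = 0" if "AE x in M. p x = 0" for p
      using that by (intro integral_eq_zero_AE) (auto elim!: eventually_mono)
  qed
  then have "\<exists>p. p \<in> polys (int k) \<and> (\<forall>q\<in>polys (int k). (LINT x|M. p x * q x) = (LINT x|M. w x * q x))"
    by blast
  from someI_ex[OF this] show "L2_proj M k w \<in> polys (int k)"
    "q \<in> polys (int k) \<Longrightarrow> (LINT x|M. L2_proj M k w x * q x) = (LINT x|M. w x * q x)"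
    unfolding L2_proj_def by blast+
qed

section \<open>Projections of functions with zero boundary values\<close>

lemma polytope_union_compact: "polytope_union S \<Longrightarrow> compact S"
  unfolding polytope_union_def by (metis compact_Union polytope_imp_compact)

lemma borel_measurable_lebesgue_on_AE:
  fixes f g :: "'a::euclidean_space \<Rightarrow> real"
  assumes S: "S \<in> sets lebesgue" and f: "f \<in> borel_measurable (lebesgue_on S)"
    and ae: "AE x in lebesgue_on S. f x = g x"
  shows "g \<in> borel_measurable (lebesgue_on S)"
proof -
  have "(\<lambda>x. indicator S x * f x) \<in> borel_measurable lebesgue"
    using f S by (simp add: borel_measurable_restrict_space_iff)
  moreover have "AE x in lebesgue. indicator S x * f x = indicator S x * g x"
    using ae S by (auto simp: AE_restrict_space_iff indicator_def elim!: eventually_mono)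
  ultimately have "(\<lambda>x. indicator S x * g x) \<in> borel_measurable lebesgue"
    by (rule borel_measurable_AE)
  then show ?thesis using S by (simp add: borel_measurable_restrict_space_iff)
qed

locale mesh =
  fixes \<Omega> :: "(real^'n::finite) set" and Th Eh
  assumes dom: "polyhedral_domain \<Omega>" and part: "partition_of \<Omega> Th Eh"
begin

lemma element_compact: "T \<in> Th \<Longrightarrow> compact T"
  using part by (auto simp: partition_of_def element_shape_def intro: polytope_union_compact)

lemma element_interior_nonempty: "T \<in> Th \<Longrightarrow> interior T \<noteq> {}"
  using part by (fastforce simp: partition_of_def element_shape_def)

lemma element_lebesgue: "T \<in> Th \<Longrightarrow> T \<in> sets lebesgue"
  using element_compact by (simp add: borel_closed compact_imp_closed)

lemma element_face_subset: "T \<in> Th \<Longrightarrow> e \<in> faces_of Eh T \<Longrightarrow> e \<subseteq> T"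
  using frontier_subset_eq[of T] element_compact compact_imp_closed by (fastforce simp: faces_of_def)

lemma mesh_face_shape: "e \<in> Eh \<Longrightarrow> face_shape e"
  using part by (simp add: partition_of_def)

lemma negligible_frontier_element:
  assumes T: "T \<in> Th"
  shows "negligible (frontier T)"
proof -
  have "frontier T = \<Union>(faces_of Eh T)" using part T by (simp add: partition_of_def)
  moreover have "finite (faces_of Eh T)" using part by (simp add: partition_of_def faces_of_def)
  moreover have "negligible e" if "e \<in> faces_of Eh T" for e
  proof -
    have "face_shape e" using that by (intro mesh_face_shape) (simp add: faces_of_def)
    then obtain \<nu> b where "flat_face e \<nu> b" by (rule flat_face_exists)
    then interpret flat_face e \<nu> b .
    have "negligible {x. \<nu> \<bullet> x = b}" using normal by (intro negligible_hyperplane) auto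
    then show ?thesis using hull hull_subset[of e affine] negligible_subset by metis
  qed
  ultimately show ?thesis by (simp add: negligible_Union)
qed

lemma AE_interior:
  assumes T: "T \<in> Th"
  shows "AE x in lebesgue_on T. x \<in> interior T"
proof -
  have "AE x in lebesgue. x \<notin> frontier T"
    using negligible_frontier_element[OF T] by (intro AE_not_in) (simp add: negligible_iff_null_sets)
  then have "AE x in lebesgue_on T. x \<notin> frontier T"
    using element_lebesgue[OF T] by (auto simp: AE_restrict_space_iff elim!: eventually_mono)
  moreover have "AE x in lebesgue_on T. x \<in> T" by (rule AE_I2) simp
  ultimately show ?thesis by eventually_elim (use closure_subset in \<open>auto simp: frontier_def\<close>)
qed

lemma polys_L2_element: "T \<in> Th \<Longrightarrow> p \<in> polys j \<Longrightarrow> p \<in> L2_space (lebesgue_on T)"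
  using element_compact element_lebesgue
  by (intro continuous_L2_lebesgue_on polys_continuous compact_imp_bounded)

lemma polys_L2_face:
  assumes "e \<in> Eh" "p \<in> polys j"
  shows "p \<in> L2_space (face_measure e)"
proof -
  obtain \<nu> b where "flat_face e \<nu> b" using flat_face_exists[OF mesh_face_shape[OF assms(1)]] .
  then interpret flat_face e \<nu> b .
  show ?thesis using assms(2) by (intro continuous_L2_face polys_continuous)
qed

text \<open>An element may contain points of the boundary of \<open>\<Omega>\<close>, where \<open>w\<close> is arbitrary; they lie on the boundary
  of the element, which is negligible.\<close>

lemma L2_domain_imp_element:
  assumes T: "T \<in> Th" and w: "w \<in> L2_space (lebesgue_on \<Omega>)"
  shows "w \<in> L2_space (lebesgue_on T)"
proof -
  have \<Omega>: "\<Omega> \<in> sets lebesgue" using dom by (simp add: polyhedral_domain_def)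
  have I: "interior T \<in> sets lebesgue" by simp
  have sub: "interior T \<subseteq> \<Omega>" using dom part T by (rule element_interior_subset_domain)
  have ae: "AE x in lebesgue. indicator (interior T) x * f x = indicator T x * f x" for f :: "real^'n \<Rightarrow> real"
    using AE_interior[OF T] interior_subset[of T] element_lebesgue[OF T]
    by (auto simp: AE_restrict_space_iff indicator_def elim!: eventually_mono)
  have ii: "(\<lambda>x. indicator (interior T) x * f x) = (\<lambda>x. indicator (interior T) x * (indicator \<Omega> x * f x))" for f :: "real^'n \<Rightarrow> real"
    using sub by (auto simp: indicator_def fun_eq_iff)
  have meas: "(\<lambda>x. indicator T x * f x) \<in> borel_measurable lebesgue"
    if "f \<in> borel_measurable (lebesgue_on \<Omega>)" for f :: "real^'n \<Rightarrow> real"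
  proof -
    have "(\<lambda>x. indicator \<Omega> x * f x) \<in> borel_measurable lebesgue"
      using that \<Omega> by (simp add: borel_measurable_restrict_space_iff)
    with I have "(\<lambda>x. indicator (interior T) x * f x) \<in> borel_measurable lebesgue"
      unfolding ii[of f] by (rule borel_measurable_times[OF borel_measurable_indicator])
    then show ?thesis using ae by (rule borel_measurable_AE)
  qed
  have wm: "w \<in> borel_measurable (lebesgue_on \<Omega>)" using w by (simp add: L2_space_def)
  have "integrable lebesgue (\<lambda>x. indicator \<Omega> x * (w x)\<^sup>2)"
    using w \<Omega> by (simp add: L2_space_def integral_lebesgue_on_indicator(2))
  from integrable_mult_indicator[OF I this]
  have i: "integrable lebesgue (\<lambda>x. indicator (interior T) x * (w x)\<^sup>2)"
    unfolding ii[of "\<lambda>x. (w x)\<^sup>2"] by simp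
  have "integrable lebesgue (\<lambda>x. indicator T x * (w x)\<^sup>2)"
    by (rule integrable_cong_AE_imp[OF i meas[OF borel_measurable_power[OF wm]] ae])
  moreover have "w \<in> borel_measurable (lebesgue_on T)"
    using meas[OF wm] element_lebesgue[OF T] by (simp add: borel_measurable_restrict_space_iff)
  ultimately show ?thesis
    using element_lebesgue[OF T] by (simp add: L2_space_def integral_lebesgue_on_indicator(2))
qed

lemma trace_on_L2:
  assumes "e \<in> Eh"
  shows "trace_on \<Omega> e w \<in> L2_space (face_measure e)"
proof (cases "\<exists>g. has_trace \<Omega> e w g")
  case True
  then have "has_trace \<Omega> e w (trace_on \<Omega> e w)" unfolding trace_on_def by (simp add: someI_ex)
  then show ?thesis unfolding has_trace_def by blast
next
  case False
  then show ?thesis by (simp add: trace_on_def L2_space_def zero_fun_def)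
qed

lemma Qh_in_Vh:
  assumes w: "w \<in> L2_space (lebesgue_on \<Omega>)"
  shows "Qh k \<Omega> w \<in> Vh k Th Eh"
proof -
  have "L2_proj (lebesgue_on T) k w \<in> polys (int k)" if "T \<in> Th" for T
    by (rule L2_proj(1)[OF polys_L2_element[OF that] L2_domain_imp_element[OF that w]])
  moreover have "L2_proj (face_measure e) k (trace_on \<Omega> e w) \<in> polys (int k)" if "e \<in> Eh" for e
    by (rule L2_proj(1)[OF polys_L2_face[OF that] trace_on_L2[OF that]])
  ultimately show ?thesis unfolding Vh_def Qh_def by auto
qed

text \<open>Every relatively interior point of \<open>e\<close> has a neighbourhood inside the slab, so a point with
  \<open>f y \<noteq> 0\<close> would lead to an open set of positive measure in the slab where \<open>f\<close>, extended constantly in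
  normal direction, does not vanish.\<close>

lemma continuous_AE_0_on_face:
  assumes e: "e \<in> Eh" and f: "continuous_on UNIV f" and ae: "AE y in face_measure e. f y = (0::real)" and y: "y \<in> e"
  shows "f y = 0"
proof -
  obtain \<nu> b where "flat_face e \<nu> b" using flat_face_exists[OF mesh_face_shape[OF e]] .
  then interpret flat_face e \<nu> b .
  have aes: "AE x in lebesgue_on (slab e). f (foot \<nu> b x) = 0"
    using ae unfolding face_measure_eq by (rule AE_distrD[OF measurable_foot_slab])
  have rel: "f z = 0" if z: "z \<in> rel_interior e" for z
  proof (rule ccontr)
    assume fz: "f z \<noteq> 0"
    obtain V where V: "open V" "rel_interior e = affine hull e \<inter> V"
      using openin_rel_interior[of e] by (auto simp: openin_open)
    let ?G = "{x. \<bar>height \<nu> b x\<bar> < 1/2} \<inter> (foot \<nu> b -` V \<inter> (\<lambda>x. f (foot \<nu> b x)) -` (- {0}))"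
    have "open ?G"
    proof (intro open_Int)
      show "open {x. \<bar>height \<nu> b x\<bar> < 1/2}" by (intro open_Collect_less continuous_intros)
      show "open (foot \<nu> b -` V)" using V(1) by (intro open_vimage continuous_foot)
      have "continuous_on UNIV (\<lambda>x. f (foot \<nu> b x))"
        by (rule continuous_on_compose2[OF f continuous_foot]) auto
      then show "open ((\<lambda>x. f (foot \<nu> b x)) -` (- {0}))" by (intro open_vimage) auto
    qed
    moreover have "z \<in> ?G"
    proof -
      have "height \<nu> b z = 0" using z rel_interior_subset height_face by blast
      then show ?thesis using z V(2) fz by (simp add: foot_eq_self)
    qed
    moreover have "negligible ?G"
    proof -
      have "x \<in> slab e" if "x \<in> ?G" for x
      proof -
        have "foot \<nu> b x \<in> affine hull e"
          unfolding hull using height_foot[OF normal, of b x] by (simp add: height_def)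
        then have "foot \<nu> b x \<in> e" using that V(2) rel_interior_subset by blast
        then show ?thesis using that by (simp add: slab_face)
      qed
      moreover have "AE x in lebesgue. x \<in> slab e \<longrightarrow> f (foot \<nu> b x) = 0"
        using aes by (simp add: AE_restrict_space_iff)
      ultimately have "AE x in lebesgue. x \<notin> ?G"
        by (auto elim!: eventually_mono)
      moreover have "?G \<in> sets lebesgue" using \<open>open ?G\<close> by simp
      ultimately have "?G \<in> null_sets lebesgue" by (simp only: AE_iff_null_sets)
      then show ?thesis by (simp add: negligible_iff_null_sets)
    qed
    ultimately show False using open_not_negligible by blast
  qed
  have "closure (rel_interior e) = e" using shape by (simp add: face_shape_def)
  then show ?thesis
    using continuous_constant_on_closure[of "rel_interior e" f 0 y] continuous_on_subset[OF f subset_UNIV] rel y by simp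
qed

text \<open>Testing the projection \<open>p\<close> of a vanishing trace with \<open>p\<close> itself shows that \<open>p = 0\<close> almost everywhere
  on the face, hence everywhere on it by continuity.\<close>

lemma Qh_in_Vh0:
  assumes w: "w \<in> H10 \<Omega>"
  shows "Qh k \<Omega> w \<in> Vh0 k \<Omega> Th Eh"
proof -
  have "w \<in> L2_space (lebesgue_on \<Omega>)" using w by (simp add: H10_def sobolev_def)
  moreover have "snd (Qh k \<Omega> w) e x = 0" if e: "e \<in> Eh" "e \<subseteq> frontier \<Omega>" "x \<in> e" for e x
  proof -
    let ?M = "face_measure e" and ?g = "trace_on \<Omega> e w"
    let ?p = "L2_proj ?M k ?g"
    \<comment> \<open>If \<open>w\<close> had no trace on \<open>e\<close>, then \<open>trace_on\<close> would be its default value 0.\<close>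
    have "AE y in ?M. ?g y = 0"
    proof (cases "\<exists>g. has_trace \<Omega> e w g")
      case True
      then have "has_trace \<Omega> e w ?g" unfolding trace_on_def by (simp add: someI_ex)
      then show ?thesis by (rule trace_on_boundary_face[OF dom part e(1,2) w])
    qed (simp add: trace_on_def)
    then have "(LINT y|?M. ?g y * ?p y) = 0"
      by (intro integral_eq_zero_AE) (auto elim!: eventually_mono)
    have p: "?p \<in> polys (int k)"
      by (rule L2_proj(1)[OF polys_L2_face[OF e(1)] trace_on_L2[OF e(1)]])
    have "(LINT y|?M. ?p y * ?p y) = 0"
      using L2_proj(2)[OF polys_L2_face[OF e(1)] trace_on_L2[OF e(1)] p] \<open>(LINT y|?M. ?g y * ?p y) = 0\<close> by simp
    then have "AE y in ?M. ?p y * ?p y = 0"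
      using integrable_mult_L2[OF polys_L2_face[OF e(1) p] polys_L2_face[OF e(1) p]]
      by (subst (asm) integral_nonneg_eq_0_iff_AE) auto
    then have "AE y in ?M. ?p y = 0" by simp
    then show ?thesis
      unfolding Qh_def using continuous_AE_0_on_face[OF e(1) polys_continuous[OF p] _ e(3)] by simp
  qed
  ultimately show ?thesis using Qh_in_Vh unfolding Vh0_def by blast
qed

end

section \<open>Weak functions and their weak gradient\<close>

definition agrees_with_poly :: "int \<Rightarrow> (real^'n::finite) set \<Rightarrow> (real^'n \<Rightarrow> real) \<Rightarrow> bool"
  where "agrees_with_poly j S f \<longleftrightarrow> (\<exists>p\<in>polys j. \<forall>x\<in>S. f x = p x)"

lemma agrees_with_polyI: "p \<in> polys j \<Longrightarrow> (\<And>x. x \<in> S \<Longrightarrow> f x = p x) \<Longrightarrow> agrees_with_poly j S f"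
  by (auto simp: agrees_with_poly_def)

lemma agrees_with_poly_combine:
  assumes "agrees_with_poly j S f" "agrees_with_poly j S g"
  shows "agrees_with_poly j S (\<lambda>x. f x + c * g x)"
proof -
  obtain p where p: "p \<in> polys j" "\<And>x. x \<in> S \<Longrightarrow> f x = p x"
    using assms(1) unfolding agrees_with_poly_def by auto
  obtain q where q: "q \<in> polys j" "\<And>x. x \<in> S \<Longrightarrow> g x = q x"
    using assms(2) unfolding agrees_with_poly_def by auto
  show ?thesis
    by (rule agrees_with_polyI[OF polys_add[OF p(1) polys_scale[OF q(1), of c]]]) (simp add: p(2) q(2))
qed

lemma Vh_iff: "v \<in> Vh k Th Eh \<longleftrightarrow>
    (\<forall>T\<in>Th. agrees_with_poly (int k) T (fst v T)) \<and> (\<forall>e\<in>Eh. agrees_with_poly (int k) e (snd v e))"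
  by (simp add: Vh_def agrees_with_poly_def)

lemma Vh_combine:
  assumes "v \<in> Vh k Th Eh" "w \<in> Vh k Th Eh"
  shows "v + c *\<^sub>R w \<in> Vh k Th Eh"
  using assms unfolding Vh_iff
  by (simp add: plus_fun_def scaleR_fun_def agrees_with_poly_combine)

lemma Vh_0: "0 \<in> Vh k Th Eh"
  unfolding Vh_iff by (simp add: zero_fun_def agrees_with_polyI[OF polys_0])

lemma Vh_diff: "v \<in> Vh k Th Eh \<Longrightarrow> w \<in> Vh k Th Eh \<Longrightarrow> v - w \<in> Vh k Th Eh"
  using Vh_combine[of v k Th Eh w "-1"] by simp

lemma subspace_Vh0: "subspace (Vh0 k \<Omega> Th Eh)"
proof (rule subspaceI)
  show "0 \<in> Vh0 k \<Omega> Th Eh" by (simp add: Vh0_def Vh_0)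
  show "v + w \<in> Vh0 k \<Omega> Th Eh" if "v \<in> Vh0 k \<Omega> Th Eh" "w \<in> Vh0 k \<Omega> Th Eh" for v w
    using that Vh_combine[of v k Th Eh w 1] by (simp add: Vh0_def)
  show "c *\<^sub>R v \<in> Vh0 k \<Omega> Th Eh" if "v \<in> Vh0 k \<Omega> Th Eh" for c v
    using that Vh_combine[OF Vh_0, of v k Th Eh c] by (simp add: Vh0_def scaleR_fun_def)
qed

text \<open>The right-hand side of the defining equation of the weak gradient for the field \<open>p e\<^sub>i\<close>, where
  \<open>e\<^sub>i\<close> is the \<open>i\<close>-th coordinate vector.\<close>

definition wgrad_moment ::
    "(real^'n::finite) set set \<Rightarrow> 'n weak_fun \<Rightarrow> (real^'n) set \<Rightarrow> 'n \<Rightarrow> (real^'n \<Rightarrow> real) \<Rightarrow> real"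
  where "wgrad_moment Eh v T i p = - (LINT x|lebesgue_on T. fst v T x * partial p i x) +
    (\<Sum>e\<in>faces_of Eh T. LINT x|face_measure e. snd v e x * (p x * outward_normal T e $ i))"

text \<open>The defining equation of \<open>wgrad\<close> with its right-hand side split into components, so that scalar
  representation of functionals applies to each of them.\<close>

definition wgrad_equation ::
    "nat \<Rightarrow> (real^'n::finite) set set \<Rightarrow> 'n weak_fun \<Rightarrow> (real^'n) set \<Rightarrow> (real^'n \<Rightarrow> real^'n) \<Rightarrow> bool"
  where "wgrad_equation k Eh v T g \<longleftrightarrow> g \<in> vector_polys (int k - 1) \<and>
    (\<forall>q\<in>vector_polys (int k - 1). (LINT x|lebesgue_on T. g x \<bullet> q x) =
      (\<Sum>i\<in>UNIV. wgrad_moment Eh v T i (\<lambda>x. q x $ i)))"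

lemma vector_polys_component: "q \<in> vector_polys j \<Longrightarrow> (\<lambda>x. q x $ i) \<in> polys j"
  by (simp add: vector_polys_def)

lemma vector_polys_diff: "g \<in> vector_polys j \<Longrightarrow> h \<in> vector_polys j \<Longrightarrow> (\<lambda>x. g x - h x) \<in> vector_polys j"
  by (simp add: vector_polys_def polys_diff)

context mesh
begin

lemma Vh_L2_element:
  assumes "v \<in> Vh k Th Eh" "T \<in> Th"
  shows "fst v T \<in> L2_space (lebesgue_on T)"
proof -
  obtain p where "p \<in> polys (int k)" "\<forall>x\<in>T. fst v T x = p x" using assms by (auto simp: Vh_def)
  then show ?thesis using assms(2) by (intro L2_space_cong[OF _ polys_L2_element[of T p]]) auto
qed

lemma face_space:
  assumes "e \<in> Eh" shows "space (face_measure e) = e"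
proof -
  obtain \<nu> b where "flat_face e \<nu> b" using flat_face_exists[OF mesh_face_shape[OF assms(1)]] .
  then interpret flat_face e \<nu> b .
  show ?thesis by simp
qed

lemma Vh_L2_face:
  assumes "v \<in> Vh k Th Eh" "e \<in> Eh"
  shows "snd v e \<in> L2_space (face_measure e)"
proof -
  obtain p where "p \<in> polys (int k)" "\<forall>x\<in>e. snd v e x = p x" using assms by (auto simp: Vh_def)
  then show ?thesis using assms(2)
    by (intro L2_space_cong[OF _ polys_L2_face[of e p]]) (auto simp: face_space)
qed

lemma Vh_fst_L2_face:
  assumes "v \<in> Vh k Th Eh" "T \<in> Th" "e \<in> faces_of Eh T"
  shows "fst v T \<in> L2_space (face_measure e)"
proof -
  have e: "e \<in> Eh" using assms(3) by (simp add: faces_of_def)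
  obtain p where "p \<in> polys (int k)" "\<forall>x\<in>T. fst v T x = p x" using assms by (auto simp: Vh_def)
  then show ?thesis using e element_face_subset[OF assms(2,3)]
    by (intro L2_space_cong[OF _ polys_L2_face[of e p]]) (auto simp: face_space)
qed

lemma polys_partial_L2:
  "T \<in> Th \<Longrightarrow> p \<in> polys j \<Longrightarrow> partial p i \<in> L2_space (lebesgue_on T)"
  using element_compact element_lebesgue
  by (intro continuous_L2_lebesgue_on smooth_fun_continuous smooth_fun_partial polys_smooth compact_imp_bounded)

text \<open>An almost everywhere vanishing continuous function vanishes on the interior of \<open>T\<close>, which is a
  nonempty open set.\<close>

lemma polys_AE_0:
  assumes T: "T \<in> Th" and p: "p \<in> polys j" and ae: "AE x in lebesgue_on T. p x = 0"
  shows "p y = 0"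
proof (rule polys_eq_0[OF p open_interior element_interior_nonempty[OF T]])
  fix z assume z: "z \<in> interior T"
  show "p z = 0"
  proof (rule ccontr)
    assume pz: "p z \<noteq> 0"
    let ?G = "interior T \<inter> p -` (- {0})"
    have G: "open ?G"
      using polys_continuous[OF p] by (intro open_Int open_interior open_vimage) auto
    have "AE x in lebesgue. x \<in> T \<longrightarrow> p x = 0"
      using ae element_lebesgue[OF T] by (simp add: AE_restrict_space_iff)
    then have "AE x in lebesgue. x \<notin> ?G"
      using interior_subset[of T] by (auto elim!: eventually_mono)
    moreover have "?G \<in> sets lebesgue" using G by simp
    ultimately have "?G \<in> null_sets lebesgue" by (simp only: AE_iff_null_sets)
    then have "negligible ?G" by (simp add: negligible_iff_null_sets)
    moreover have "z \<in> ?G" using z pz by simp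
    ultimately show False using G open_not_negligible by blast
  qed
qed

lemma wgrad_moments:
  assumes v: "v \<in> Vh k Th Eh" and T: "T \<in> Th" and q: "q \<in> vector_polys j"
  shows "- (LINT x|lebesgue_on T. fst v T x * divergence q x) +
        (\<Sum>e\<in>faces_of Eh T. LINT x|face_measure e. snd v e x * (q x \<bullet> outward_normal T e))
    = (\<Sum>i\<in>UNIV. wgrad_moment Eh v T i (\<lambda>x. q x $ i))"
proof -
  have "(LINT x|lebesgue_on T. fst v T x * divergence q x)
      = (LINT x|lebesgue_on T. (\<Sum>i\<in>UNIV. fst v T x * partial (\<lambda>x. q x $ i) i x))"
    by (simp add: divergence_def sum_distrib_left)
  also have "\<dots> = (\<Sum>i\<in>UNIV. LINT x|lebesgue_on T. fst v T x * partial (\<lambda>x. q x $ i) i x)"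
    using q by (intro Bochner_Integration.integral_sum integrable_mult_L2 Vh_L2_element[OF v T]
        polys_partial_L2[OF T] vector_polys_component)
  finally have 1: "(LINT x|lebesgue_on T. fst v T x * divergence q x)
      = (\<Sum>i\<in>UNIV. LINT x|lebesgue_on T. fst v T x * partial (\<lambda>x. q x $ i) i x)" .
  have 2: "(LINT x|face_measure e. snd v e x * (q x \<bullet> outward_normal T e)) =
      (\<Sum>i\<in>UNIV. LINT x|face_measure e. snd v e x * (q x $ i * outward_normal T e $ i))"
    if "e \<in> faces_of Eh T" for e
  proof -
    have e: "e \<in> Eh" using that by (simp add: faces_of_def)
    have "integrable (face_measure e) (\<lambda>x. outward_normal T e $ i * (snd v e x * (q x $ i)))" for i
      using q e v by (intro integrable_mult_right integrable_mult_L2 Vh_L2_face polys_L2_face vector_polys_component)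
    then have i: "integrable (face_measure e) (\<lambda>x. snd v e x * (q x $ i * outward_normal T e $ i))" for i
      by (simp add: mult_ac)
    have "(LINT x|face_measure e. snd v e x * (q x \<bullet> outward_normal T e)) =
      (LINT x|face_measure e. (\<Sum>i\<in>UNIV. snd v e x * (q x $ i * outward_normal T e $ i)))"
      by (simp add: inner_vec_def sum_distrib_left)
    also have "\<dots> = (\<Sum>i\<in>UNIV. LINT x|face_measure e. snd v e x * (q x $ i * outward_normal T e $ i))"
      using i by (rule Bochner_Integration.integral_sum)
    finally show ?thesis .
  qed
  have "(\<Sum>e\<in>faces_of Eh T. LINT x|face_measure e. snd v e x * (q x \<bullet> outward_normal T e)) =
    (\<Sum>i\<in>UNIV. \<Sum>e\<in>faces_of Eh T. LINT x|face_measure e. snd v e x * (q x $ i * outward_normal T e $ i))"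
    using 2 by (subst sum.swap) (rule sum.cong[OF refl])
  then show ?thesis unfolding 1 wgrad_moment_def by (simp add: sum.distrib sum_negf sum_subtractf)
qed

lemma wgrad_moment_add:
  assumes v: "v \<in> Vh k Th Eh" and T: "T \<in> Th" and p: "p \<in> polys j" "q \<in> polys j"
  shows "wgrad_moment Eh v T i (\<lambda>x. p x + q x) = wgrad_moment Eh v T i p + wgrad_moment Eh v T i q"
proof -
  have "partial (\<lambda>x. p x + q x) i x = partial p i x + partial q i x" for x
    using p by (intro partial_add smooth_fun_differentiable polys_smooth)
  then have 1: "(LINT x|lebesgue_on T. fst v T x * partial (\<lambda>x. p x + q x) i x) =
      (LINT x|lebesgue_on T. fst v T x * partial p i x) + (LINT x|lebesgue_on T. fst v T x * partial q i x)"
    using integrable_mult_L2[OF Vh_L2_element[OF v T] polys_partial_L2[OF T p(1), of i]]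
      integrable_mult_L2[OF Vh_L2_element[OF v T] polys_partial_L2[OF T p(2), of i]]
    by (simp add: distrib_left)
  have 2: "(LINT x|face_measure e. snd v e x * ((p x + q x) * c)) =
      (LINT x|face_measure e. snd v e x * (p x * c)) + (LINT x|face_measure e. snd v e x * (q x * c))"
    if "e \<in> faces_of Eh T" for e c
  proof -
    have e: "e \<in> Eh" using that by (simp add: faces_of_def)
    have "integrable (face_measure e) (\<lambda>x. c * (snd v e x * p x))" "integrable (face_measure e) (\<lambda>x. c * (snd v e x * q x))"
      using integrable_mult_L2[OF Vh_L2_face[OF v e] polys_L2_face[OF e p(1)]]
        integrable_mult_L2[OF Vh_L2_face[OF v e] polys_L2_face[OF e p(2)]] by auto
    then have "integrable (face_measure e) (\<lambda>x. snd v e x * (p x * c))" "integrable (face_measure e) (\<lambda>x. snd v e x * (q x * c))"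
      by (simp_all add: mult_ac)
    then show ?thesis by (simp add: distrib_left distrib_right)
  qed
  show ?thesis unfolding wgrad_moment_def 1 using 2 by (simp add: sum.distrib)
qed

lemma wgrad_moment_scale:
  assumes p: "p \<in> polys j"
  shows "wgrad_moment Eh v T i (\<lambda>x. c * p x) = c * wgrad_moment Eh v T i p"
proof -
  have "partial (\<lambda>x. c * p x) i x = c * partial p i x" for x
    using p by (intro partial_scale smooth_fun_differentiable polys_smooth)
  then have "(LINT x|lebesgue_on T. fst v T x * partial (\<lambda>x. c * p x) i x) = c * (LINT x|lebesgue_on T. fst v T x * partial p i x)"
    by (simp add: mult.left_commute)
  moreover have "(LINT x|face_measure e. snd v e x * (c * p x * d)) = c * (LINT x|face_measure e. snd v e x * (p x * d))" for e d
    by (simp add: mult.left_commute mult.assoc)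
  ultimately show ?thesis unfolding wgrad_moment_def by (simp add: sum_distrib_left algebra_simps)
qed

lemma wgrad_moment_diff:
  assumes v: "v \<in> Vh k Th Eh" and w: "w \<in> Vh k Th Eh" and T: "T \<in> Th" and p: "p \<in> polys j"
  shows "wgrad_moment Eh (v - w) T i p = wgrad_moment Eh v T i p - wgrad_moment Eh w T i p"
proof -
  have 1: "(LINT x|lebesgue_on T. fst (v - w) T x * partial p i x) =
      (LINT x|lebesgue_on T. fst v T x * partial p i x) - (LINT x|lebesgue_on T. fst w T x * partial p i x)"
    using integrable_mult_L2[OF Vh_L2_element[OF v T] polys_partial_L2[OF T p, of i]]
      integrable_mult_L2[OF Vh_L2_element[OF w T] polys_partial_L2[OF T p, of i]]
    by (simp add: left_diff_distrib)
  have 2: "(LINT x|face_measure e. snd (v - w) e x * (p x * c)) =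
      (LINT x|face_measure e. snd v e x * (p x * c)) - (LINT x|face_measure e. snd w e x * (p x * c))"
    if "e \<in> faces_of Eh T" for e c
  proof -
    have e: "e \<in> Eh" using that by (simp add: faces_of_def)
    have "integrable (face_measure e) (\<lambda>x. c * (snd v e x * p x))" "integrable (face_measure e) (\<lambda>x. c * (snd w e x * p x))"
      using integrable_mult_L2[OF Vh_L2_face[OF v e] polys_L2_face[OF e p]]
        integrable_mult_L2[OF Vh_L2_face[OF w e] polys_L2_face[OF e p]] by auto
    then have "integrable (face_measure e) (\<lambda>x. snd v e x * (p x * c))" "integrable (face_measure e) (\<lambda>x. snd w e x * (p x * c))"
      by (simp_all add: mult_ac)
    then show ?thesis by (simp add: left_diff_distrib)
  qed
  show ?thesis unfolding wgrad_moment_def 1 using 2 by (simp add: sum_subtractf)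
qed

lemma integrable_vector_polys:
  assumes "T \<in> Th" "g \<in> vector_polys j" "q \<in> vector_polys j"
  shows "integrable (lebesgue_on T) (\<lambda>x. g x $ i * q x $ i)"
  using assms by (intro integrable_mult_L2 polys_L2_element vector_polys_component)

lemma integral_inner_vector_polys:
  assumes "T \<in> Th" "g \<in> vector_polys j" "q \<in> vector_polys j"
  shows "integrable (lebesgue_on T) (\<lambda>x. g x \<bullet> q x)"
    and "(LINT x|lebesgue_on T. g x \<bullet> q x) = (\<Sum>i\<in>UNIV. LINT x|lebesgue_on T. g x $ i * q x $ i)"
  using integrable_vector_polys[OF assms]
  by (simp_all add: inner_vec_def Bochner_Integration.integral_sum Bochner_Integration.integrable_sum)

lemma wgrad_equation_exists:
  assumes v: "v \<in> Vh k Th Eh" and T: "T \<in> Th"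
  shows "\<exists>g. wgrad_equation k Eh v T g"
proof -
  have "\<exists>p\<in>polys (int k - 1). \<forall>q\<in>polys (int k - 1). (LINT x|lebesgue_on T. p x * q x) = wgrad_moment Eh v T i q" for i
  proof (rule polys_representation[OF polys_L2_element[OF T]])
    fix p assume p: "p \<in> polys (int k - 1)" "AE x in lebesgue_on T. p x = 0"
    then have "p = (\<lambda>_. 0)" using polys_AE_0[OF T] by blast
    then show "wgrad_moment Eh v T i p = 0"
      using wgrad_moment_scale[OF p(1), of v T i 0] by simp
  qed (use wgrad_moment_add[OF v T] wgrad_moment_scale in auto)
  then obtain g where g: "\<And>i. g i \<in> polys (int k - 1)"
    "\<And>i q. q \<in> polys (int k - 1) \<Longrightarrow> (LINT x|lebesgue_on T. g i x * q x) = wgrad_moment Eh v T i q"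
    by metis
  let ?g = "\<lambda>x. \<chi> i. g i x"
  have gv: "?g \<in> vector_polys (int k - 1)" using g(1) by (simp add: vector_polys_def)
  have "wgrad_equation k Eh v T ?g"
    unfolding wgrad_equation_def
    using gv by (auto simp: integral_inner_vector_polys(2)[OF T gv] g(2) vector_polys_component)
  then show ?thesis by blast
qed

lemma wgrad_equation_unique:
  assumes T: "T \<in> Th" and g: "wgrad_equation k Eh v T g" and h: "wgrad_equation k Eh v T h"
  shows "g = h"
proof -
  let ?d = "\<lambda>x. g x - h x"
  have vp: "g \<in> vector_polys (int k - 1)" "h \<in> vector_polys (int k - 1)"
    using g h by (auto simp: wgrad_equation_def)
  have d: "?d \<in> vector_polys (int k - 1)" using vp by (rule vector_polys_diff)
  have "(LINT x|lebesgue_on T. g x \<bullet> ?d x) = (LINT x|lebesgue_on T. h x \<bullet> ?d x)"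
    using g h d by (simp add: wgrad_equation_def)
  then have "(LINT x|lebesgue_on T. ?d x \<bullet> ?d x) = 0"
    using integral_inner_vector_polys(1)[OF T vp(1) d] integral_inner_vector_polys(1)[OF T vp(2) d]
    by (simp add: inner_diff_left)
  then have "AE x in lebesgue_on T. ?d x \<bullet> ?d x = 0"
    using integral_inner_vector_polys(1)[OF T d d]
    by (subst (asm) integral_nonneg_eq_0_iff_AE) auto
  then have ae: "AE x in lebesgue_on T. ?d x $ i = 0" for i
    by (auto elim!: eventually_mono)
  have "?d x $ i = 0" for x i
    by (rule polys_AE_0[OF T vector_polys_component[OF d] ae])
  then show ?thesis by (simp add: fun_eq_iff vec_eq_iff)
qed

lemma wgrad_wgrad_equation:
  assumes v: "v \<in> Vh k Th Eh" and T: "T \<in> Th"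
  shows "wgrad_equation k Eh v T (wgrad k Eh v T)"
proof -
  have "wgrad k Eh v T = (THE g. wgrad_equation k Eh v T g)"
    unfolding wgrad_def wgrad_equation_def using wgrad_moments[OF v T, where j="int k - 1"] by (simp cong: conj_cong ball_cong)
  moreover have "\<exists>!g. wgrad_equation k Eh v T g"
    using wgrad_equation_exists[OF v T] wgrad_equation_unique[OF T] by blast
  ultimately show ?thesis by (simp add: theI')
qed

lemma wgrad_vector_polys: "v \<in> Vh k Th Eh \<Longrightarrow> T \<in> Th \<Longrightarrow> wgrad k Eh v T \<in> vector_polys (int k - 1)"
  using wgrad_wgrad_equation by (simp add: wgrad_equation_def)

lemma wgrad_diff:
  assumes v: "v \<in> Vh k Th Eh" and w: "w \<in> Vh k Th Eh" and T: "T \<in> Th"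
  shows "wgrad k Eh (v - w) T = (\<lambda>x. wgrad k Eh v T x - wgrad k Eh w T x)"
proof (rule wgrad_equation_unique[OF T wgrad_wgrad_equation[OF Vh_diff[OF v w] T]])
  note eq = wgrad_wgrad_equation[OF v T] wgrad_wgrad_equation[OF w T]
  note vp = wgrad_vector_polys[OF v T] wgrad_vector_polys[OF w T]
  show "wgrad_equation k Eh (v - w) T (\<lambda>x. wgrad k Eh v T x - wgrad k Eh w T x)"
    unfolding wgrad_equation_def
  proof (intro conjI ballI)
    show "(\<lambda>x. wgrad k Eh v T x - wgrad k Eh w T x) \<in> vector_polys (int k - 1)"
      using vp by (rule vector_polys_diff)
    fix q :: "real^'n \<Rightarrow> real^'n" assume q: "q \<in> vector_polys (int k - 1)"
    have "(LINT x|lebesgue_on T. (wgrad k Eh v T x - wgrad k Eh w T x) \<bullet> q x) =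
      (LINT x|lebesgue_on T. wgrad k Eh v T x \<bullet> q x) - (LINT x|lebesgue_on T. wgrad k Eh w T x \<bullet> q x)"
      using integral_inner_vector_polys(1)[OF T vp(1) q] integral_inner_vector_polys(1)[OF T vp(2) q]
      by (simp add: inner_diff_left)
    also have "\<dots> = (\<Sum>i\<in>UNIV. wgrad_moment Eh (v - w) T i (\<lambda>x. q x $ i))"
      using eq q by (simp add: wgrad_equation_def wgrad_moment_diff[OF v w T vector_polys_component[OF q]] sum_subtractf)
    finally show "(LINT x|lebesgue_on T. (wgrad k Eh v T x - wgrad k Eh w T x) \<bullet> q x) =
      (\<Sum>i\<in>UNIV. wgrad_moment Eh (v - w) T i (\<lambda>x. q x $ i))" .
  qed
qed

section \<open>The energy estimate\<close>

text \<open>On the interior of \<open>T\<close> the coefficient is constant and the integrand is continuous. The values of \<open>a\<close>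
  on the boundary are arbitrary, and completeness of the measure is what makes the integrand measurable.\<close>

lemma integrable_coefficient:
  assumes pc: "piecewise_constant Th a" and T: "T \<in> Th" and g: "g \<in> vector_polys j" and h: "h \<in> vector_polys j"
  shows "integrable (lebesgue_on T) (\<lambda>x. (a x *v g x) \<bullet> h x)"
proof -
  obtain y where y: "y \<in> interior T" using element_interior_nonempty[OF T] by blast
  let ?f = "\<lambda>x. (a y *v g x) \<bullet> h x"
  have c: "continuous_on UNIV (\<lambda>x. g x $ i)" "continuous_on UNIV (\<lambda>x. h x $ i)" for i
    using g h vector_polys_component polys_continuous by blast+
  have "continuous_on UNIV ?f"
    unfolding matrix_vector_mult_def inner_vec_def vec_lambda_beta inner_real_def
    by (intro continuous_on_sum continuous_on_mult continuous_on_const c)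
  then have f: "?f \<in> L2_space (lebesgue_on T)"
    using element_compact[OF T] element_lebesgue[OF T]
    by (intro continuous_L2_lebesgue_on compact_imp_bounded)
  have fin: "finite_measure (lebesgue_on T)"
    using element_compact[OF T] by (intro finite_measure_lebesgue_on lmeasurable_compact)
  have ae: "AE x in lebesgue_on T. ?f x = (a x *v g x) \<bullet> h x"
    using AE_interior[OF T]
  proof eventually_elim
    case (elim x)
    then have "a y = a x" using pc T y unfolding piecewise_constant_def by blast
    then show ?case by simp
  qed
  show ?thesis
    by (rule integrable_cong_AE_imp[OF integrable_L2[OF fin f] borel_measurable_lebesgue_on_AE[OF element_lebesgue[OF T] _ ae] ae])
      (use f in \<open>simp add: L2_space_def\<close>)
qed

lemma jump_form_diff:
  assumes v: "v \<in> Vh k Th Eh" and w: "w \<in> Vh k Th Eh" and z: "z \<in> Vh k Th Eh" and T: "T \<in> Th"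
  shows "jump_form Eh (v - w) z T = jump_form Eh v z T - jump_form Eh w z T"
proof -
  have L2: "(\<lambda>x. fst u T x - snd u e x) \<in> L2_space (face_measure e)"
    if "e \<in> faces_of Eh T" "u \<in> Vh k Th Eh" for e u
    using that T by (intro L2_space_diff Vh_fst_L2_face Vh_L2_face) (auto simp: faces_of_def)
  have "(LINT x|face_measure e. (fst (v - w) T x - snd (v - w) e x) * (fst z T x - snd z e x)) =
      (LINT x|face_measure e. (fst v T x - snd v e x) * (fst z T x - snd z e x)) -
      (LINT x|face_measure e. (fst w T x - snd w e x) * (fst z T x - snd z e x))"
    if e: "e \<in> faces_of Eh T" for e
  proof -
    have "(LINT x|face_measure e. (fst (v - w) T x - snd (v - w) e x) * (fst z T x - snd z e x)) =
      (LINT x|face_measure e. (fst v T x - snd v e x) * (fst z T x - snd z e x) -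
        (fst w T x - snd w e x) * (fst z T x - snd z e x))"
      by (intro Bochner_Integration.integral_cong) (auto simp: algebra_simps)
    also have "\<dots> = (LINT x|face_measure e. (fst v T x - snd v e x) * (fst z T x - snd z e x)) -
      (LINT x|face_measure e. (fst w T x - snd w e x) * (fst z T x - snd z e x))"
      by (rule Bochner_Integration.integral_diff[OF integrable_mult_L2[OF L2[OF e v] L2[OF e z]]
            integrable_mult_L2[OF L2[OF e w] L2[OF e z]]])
    finally show ?thesis .
  qed
  then show ?thesis unfolding jump_form_def by (simp add: sum_subtractf)
qed

lemma aw_diff:
  assumes pc: "piecewise_constant Th a"
    and v: "v \<in> Vh k Th Eh" and w: "w \<in> Vh k Th Eh" and z: "z \<in> Vh k Th Eh"
  shows "aw k a Th Eh (v - w) z = aw k a Th Eh v z - aw k a Th Eh w z"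
proof -
  have 1: "(LINT x|lebesgue_on T. (a x *v wgrad k Eh (v - w) T x) \<bullet> wgrad k Eh z T x) =
    (LINT x|lebesgue_on T. (a x *v wgrad k Eh v T x) \<bullet> wgrad k Eh z T x) -
    (LINT x|lebesgue_on T. (a x *v wgrad k Eh w T x) \<bullet> wgrad k Eh z T x)" if T: "T \<in> Th" for T
    using integrable_coefficient[OF pc T wgrad_vector_polys[OF v T] wgrad_vector_polys[OF z T]]
      integrable_coefficient[OF pc T wgrad_vector_polys[OF w T] wgrad_vector_polys[OF z T]]
    by (simp add: wgrad_diff[OF v w T] matrix_vector_mult_diff_distrib inner_diff_left)
  have 2: "stabilizer Th Eh (v - w) z = stabilizer Th Eh v z - stabilizer Th Eh w z"
    unfolding stabilizer_def using jump_form_diff[OF v w z]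
    by (simp add: right_diff_distrib sum_subtractf)
  show ?thesis unfolding aw_def 2 using 1 by (simp add: sum_subtractf)
qed

lemma jump_form_nonneg: "0 \<le> jump_form Eh v v T"
  unfolding jump_form_def by (intro sum_nonneg integral_nonneg_AE) auto

lemma diameter_nonneg: "T \<in> Th \<Longrightarrow> 0 \<le> diameter T"
  using element_compact compact_imp_bounded diameter_ge_0 by blast

lemma coefficient_lower_bound:
  assumes "T \<in> Th" and a0: "\<forall>x\<in>\<Omega>. \<forall>\<xi>. a0 * (\<xi> \<bullet> \<xi>) \<le> (a x *v \<xi>) \<bullet> \<xi>"
  shows "AE x in lebesgue_on T. a0 * (g x \<bullet> g x) \<le> (a x *v g x) \<bullet> g x"
  using AE_interior[OF assms(1)]
proof eventually_elim
  case (elim x)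
  then have "x \<in> \<Omega>" using element_interior_subset_domain[OF dom part assms(1)] by blast
  then show ?case using a0 by simp
qed

text \<open>Holds for arbitrary pairs of functions: should an integral not exist, it is 0 by convention.\<close>

lemma aw_nonneg:
  assumes a0: "0 \<le> a0" "\<forall>x\<in>\<Omega>. \<forall>\<xi>. a0 * (\<xi> \<bullet> \<xi>) \<le> (a x *v \<xi>) \<bullet> \<xi>"
  shows "0 \<le> aw k a Th Eh v v"
proof -
  have "0 \<le> (LINT x|lebesgue_on T. (a x *v wgrad k Eh v T x) \<bullet> wgrad k Eh v T x)" if "T \<in> Th" for T
  proof (rule integral_nonneg_AE)
    show "AE x in lebesgue_on T. 0 \<le> (a x *v wgrad k Eh v T x) \<bullet> wgrad k Eh v T x"
      using coefficient_lower_bound[OF that a0(2), of "wgrad k Eh v T"]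
    proof eventually_elim
      case (elim x)
      have "0 \<le> a0 * (wgrad k Eh v T x \<bullet> wgrad k Eh v T x)" using a0(1) by simp
      then show ?case using elim by (rule order_trans)
    qed
  qed
  moreover have "0 \<le> stabilizer Th Eh v v"
    unfolding stabilizer_def using jump_form_nonneg diameter_nonneg by (intro sum_nonneg mult_nonneg_nonneg) auto
  ultimately show ?thesis unfolding aw_def by (intro add_nonneg_nonneg sum_nonneg)
qed

lemma norm1h_le_aw:
  assumes pc: "piecewise_constant Th a" and v: "v \<in> Vh k Th Eh"
    and a0: "0 < a0" "\<forall>x\<in>\<Omega>. \<forall>\<xi>. a0 * (\<xi> \<bullet> \<xi>) \<le> (a x *v \<xi>) \<bullet> \<xi>"
  shows "min a0 1 * (norm1h k Th Eh v)\<^sup>2 \<le> aw k a Th Eh v v"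
proof -
  let ?I = "\<lambda>T. LINT x|lebesgue_on T. wgrad k Eh v T x \<bullet> wgrad k Eh v T x"
  let ?J = "\<lambda>T. inverse (diameter T) * jump_form Eh v v T"
  let ?A = "\<lambda>T. LINT x|lebesgue_on T. (a x *v wgrad k Eh v T x) \<bullet> wgrad k Eh v T x"
  have J: "0 \<le> ?J T" if "T \<in> Th" for T
    using diameter_nonneg[OF that] jump_form_nonneg by simp
  have I: "0 \<le> ?I T" for T by (intro integral_nonneg_AE) auto
  have IA: "min a0 1 * ?I T \<le> ?A T" if T: "T \<in> Th" for T
  proof -
    note g = wgrad_vector_polys[OF v T]
    have "min a0 1 * ?I T \<le> a0 * ?I T" using I by (intro mult_right_mono) auto
    also have "\<dots> = (LINT x|lebesgue_on T. a0 * (wgrad k Eh v T x \<bullet> wgrad k Eh v T x))" by simp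
    also have "\<dots> \<le> ?A T"
      using integral_inner_vector_polys(1)[OF T g g] integrable_coefficient[OF pc T g g]
        coefficient_lower_bound[OF T a0(2), of "wgrad k Eh v T"]
      by (intro integral_mono_AE) auto
    finally show ?thesis .
  qed
  have "(norm1h k Th Eh v)\<^sup>2 = (\<Sum>T\<in>Th. ?I T + ?J T)"
    unfolding norm1h_def using I J by (simp add: sum_nonneg)
  then have "min a0 1 * (norm1h k Th Eh v)\<^sup>2 = (\<Sum>T\<in>Th. min a0 1 * ?I T + min a0 1 * ?J T)"
    by (simp add: sum_distrib_left distrib_left)
  also have "\<dots> \<le> (\<Sum>T\<in>Th. ?A T + ?J T)"
  proof (intro sum_mono add_mono IA)
    fix T assume "T \<in> Th"
    show "min a0 1 * ?J T \<le> ?J T" using J[OF \<open>T \<in> Th\<close>] a0(1) by (intro mult_left_le_one_le) auto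
  qed
  also have "\<dots> = aw k a Th Eh v v" by (simp add: aw_def stabilizer_def sum.distrib)
  finally show ?thesis .
qed

lemma mesh_size_nonneg: "0 \<le> mesh_size Th"
proof -
  have "closure \<Omega> = \<Union>Th" using part by (simp add: partition_of_def)
  moreover have "closure \<Omega> \<noteq> {}" using dom by (simp add: polyhedral_domain_def)
  ultimately have "Th \<noteq> {}" by (intro notI) simp
  moreover have "finite Th" using part by (simp add: partition_of_def)
  ultimately have "mesh_size Th \<in> diameter ` Th"
    unfolding mesh_size_def by (intro Max_in) auto
  then show ?thesis using diameter_nonneg by auto
qed

text \<open>The projected networks already belong to \<open>V\<^sub>h\<^sup>0\<close>.\<close>

lemma Wh_eq_Vh0:
  assumes "\<forall>i\<in>{1..m}. n i \<in> H10 \<Omega>"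
  shows "Wh k \<Omega> Th Eh m n = Vh0 k \<Omega> Th Eh"
proof
  have "Zh k \<Omega> m n \<subseteq> Vh0 k \<Omega> Th Eh"
    unfolding Zh_def using assms Qh_in_Vh0 by (intro span_minimal subspace_Vh0) auto
  then show "Wh k \<Omega> Th Eh m n \<subseteq> Vh0 k \<Omega> Th Eh"
    unfolding Wh_def using subspace_add[OF subspace_Vh0] by blast
  have "v = v + 0" "0 \<in> Zh k \<Omega> m n" for v :: "'n weak_fun"
    by (simp_all add: Zh_def span_zero)
  then show "Vh0 k \<Omega> Th Eh \<subseteq> Wh k \<Omega> Th Eh m n" unfolding Wh_def by blast
qed

text \<open>The energy identity \<open>a\<^sub>w(E, E) = \<ell>\<^sub>u(E)\<close> for the error \<open>E\<close>, followed by coercivity.\<close>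

lemma enriched_error_estimate:
  assumes pc: "piecewise_constant Th a"
    and a0: "0 < a0" "\<forall>x\<in>\<Omega>. \<forall>\<xi>. a0 * (\<xi> \<bullet> \<xi>) \<le> (a x *v \<xi>) \<bullet> \<xi>"
    and u: "u \<in> H10 \<Omega>" and n: "\<forall>i\<in>{1..m}. n i \<in> H10 \<Omega>"
    and X: "0 \<le> X" "\<forall>v\<in>Vh0 k \<Omega> Th Eh. \<bar>consistency k \<Omega> a Th Eh f u v\<bar> \<le> C0 * X * norm1h k Th Eh v"
    and sol: "enriched_solution k \<Omega> a Th Eh f m n uh"
  shows "aw_norm k a Th Eh (Qh k \<Omega> u - uh) \<le> \<bar>C0\<bar> / sqrt (min a0 1) * X"
proof -
  let ?E = "Qh k \<Omega> u - uh"
  have W: "Wh k \<Omega> Th Eh m n = Vh0 k \<Omega> Th Eh" using n by (rule Wh_eq_Vh0)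
  have uh: "uh \<in> Vh0 k \<Omega> Th Eh" "\<And>v. v \<in> Vh0 k \<Omega> Th Eh \<Longrightarrow> aw k a Th Eh uh v = load Th f v"
    using sol unfolding enriched_solution_def W by auto
  have Q: "Qh k \<Omega> u \<in> Vh0 k \<Omega> Th Eh" using u by (rule Qh_in_Vh0)
  have E: "?E \<in> Vh0 k \<Omega> Th Eh" using subspace_Vh0 Q uh(1) by (rule subspace_diff)
  have sub: "Vh0 k \<Omega> Th Eh \<subseteq> Vh k Th Eh" by (auto simp: Vh0_def)
  have "aw k a Th Eh ?E ?E = aw k a Th Eh (Qh k \<Omega> u) ?E - aw k a Th Eh uh ?E"
    using pc Q uh(1) E sub by (intro aw_diff) auto
  also have "\<dots> = consistency k \<Omega> a Th Eh f u ?E"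
    using uh(2)[OF E] by (simp add: consistency_def)
  finally have en: "aw k a Th Eh ?E ?E \<le> C0 * X * norm1h k Th Eh ?E"
    using X(2) E by (metis abs_le_D1)
  let ?N = "norm1h k Th Eh ?E" and ?A = "aw_norm k a Th Eh ?E" and ?c = "sqrt (min a0 1)"
  have c: "0 < ?c" using a0(1) by simp
  have pos: "0 \<le> aw k a Th Eh ?E ?E" using a0 by (intro aw_nonneg[of a0]) auto
  then have A: "0 \<le> ?A" "?A\<^sup>2 = aw k a Th Eh ?E ?E" by (simp_all add: aw_norm_def)
  have N: "0 \<le> ?N"
    unfolding norm1h_def using diameter_nonneg jump_form_nonneg
    by (intro real_sqrt_ge_zero sum_nonneg add_nonneg_nonneg integral_nonneg_AE mult_nonneg_nonneg) auto
  have "(?c * ?N)\<^sup>2 \<le> ?A\<^sup>2"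
    using norm1h_le_aw[OF pc _ a0, of ?E k] E sub a0(1) A(2) by (auto simp: power_mult_distrib)
  then have "?c * ?N \<le> ?A" using A(1) by (rule power2_le_imp_le)
  then have NA: "?N \<le> ?A / ?c" using c by (simp add: pos_le_divide_eq mult.commute)
  have "C0 * X * ?N \<le> \<bar>C0\<bar> * X * ?N" using X(1) N by (intro mult_right_mono) auto
  then have "?A\<^sup>2 \<le> \<bar>C0\<bar> * X * ?N" using en A(2) by simp
  also have "\<dots> \<le> \<bar>C0\<bar> * X * (?A / ?c)" using NA X(1) by (intro mult_left_mono) auto
  finally have "?A * ?A \<le> (\<bar>C0\<bar> / ?c * X) * ?A" by (simp add: power2_eq_square mult_ac)
  moreover have "0 \<le> \<bar>C0\<bar> / ?c * X" using X(1) c by simp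
  ultimately show ?thesis
    using A(1) mult_right_le_imp_le[of ?A ?A "\<bar>C0\<bar> / ?c * X"] by (cases "?A = 0") auto
qed

end

theorem corollary4p4:
  fixes \<Omega> :: "(real^'n::finite) set"
    and a :: "real^'n \<Rightarrow> real^'n^'n"
    and \<rho> :: "real \<Rightarrow> real"
    and NN :: "(real^'n \<Rightarrow> real) set"
    and \<phi> :: "real^'n \<Rightarrow> real"
    and R :: regularity
    and k :: nat
    and C0 :: real
  assumes "CARD('n) = 2 \<or> CARD('n) = 3"
    and "polyhedral_domain \<Omega>"
    and "uniformly_spd \<Omega> a"
    and "admissible_constants R"
    and "NN \<subseteq> feedforward_networks \<rho>"
    and "\<phi> \<in> H10 \<Omega>"
    and "\<forall>x\<in>frontier \<Omega>. \<phi> x = 0"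
    and "neural_space \<phi> NN \<subseteq> H10 \<Omega>"
  shows "\<exists>C>0. \<forall>Th Eh f u ur us m n uh zm \<epsilon>.
    partition_of \<Omega> Th Eh \<longrightarrow>
    shape_regular R Th Eh \<longrightarrow>
    piecewise_constant Th a \<longrightarrow>
    f \<in> L2_space (lebesgue_on \<Omega>) \<longrightarrow>
    weak_solution \<Omega> a f u \<longrightarrow>
    (AE x in lebesgue_on \<Omega>. u x = ur x + us x) \<longrightarrow>
    ur \<in> sobolev \<Omega> (k + 2) \<longrightarrow>
    (\<forall>v\<in>Vh0 k \<Omega> Th Eh. \<bar>consistency k \<Omega> a Th Eh f u v\<bar>
      \<le> C0 * mesh_size Th ^ (k + 1) * sobolev_norm \<Omega> (k + 2) ur * norm1h k Th Eh v) \<longrightarrow>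
    (\<forall>i\<in>{1..m}. n i \<in> neural_space \<phi> NN) \<longrightarrow>
    enriched_solution k \<Omega> a Th Eh f m n uh \<longrightarrow>
    zm \<in> Zh k \<Omega> m n \<longrightarrow>
    aw_norm k a Th Eh (Qh k \<Omega> us - zm) \<le> \<epsilon> \<longrightarrow>
    aw_norm k a Th Eh (Qh k \<Omega> u - uh)
      \<le> C * (mesh_size Th ^ (k + 1) * sobolev_norm \<Omega> (k + 2) ur + \<epsilon>)"
proof -
  have "\<exists>a0. 0 < a0 \<and> (\<forall>x\<in>\<Omega>. \<forall>\<xi>. a0 * (\<xi> \<bullet> \<xi>) \<le> (a x *v \<xi>) \<bullet> \<xi>)"
    using assms(3) by (simp only: uniformly_spd_def)
  then obtain a0 where "0 < a0 \<and> (\<forall>x\<in>\<Omega>. \<forall>\<xi>. a0 * (\<xi> \<bullet> \<xi>) \<le> (a x *v \<xi>) \<bullet> \<xi>)"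
    by (rule exE)
  note a0 = conjunct1[OF this] conjunct2[OF this]
  let ?K = "\<bar>C0\<bar> / sqrt (min a0 1)"
  have K: "0 \<le> ?K" using a0(1) by simp
  show ?thesis
  \<comment> \<open>The summand 1 keeps the constant positive when \<open>C0 = 0\<close>.\<close>
  proof (intro exI[of _ "?K + 1"] conjI allI impI)
    show "0 < ?K + 1" using K by simp
    fix Th Eh f u ur us m n uh zm \<epsilon>
    assume part: "partition_of \<Omega> Th Eh" and pc: "piecewise_constant Th a"
      and u: "weak_solution \<Omega> a f u"
      and cons: "\<forall>v\<in>Vh0 k \<Omega> Th Eh. \<bar>consistency k \<Omega> a Th Eh f u v\<bar>
        \<le> C0 * mesh_size Th ^ (k + 1) * sobolev_norm \<Omega> (k + 2) ur * norm1h k Th Eh v"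
      and n: "\<forall>i\<in>{1..m}. n i \<in> neural_space \<phi> NN"
      and sol: "enriched_solution k \<Omega> a Th Eh f m n uh"
      and \<epsilon>: "aw_norm k a Th Eh (Qh k \<Omega> us - zm) \<le> \<epsilon>"
    interpret mesh \<Omega> Th Eh using assms(2) part by unfold_locales
    let ?X = "mesh_size Th ^ (k + 1) * sobolev_norm \<Omega> (k + 2) ur"
    have X: "0 \<le> ?X"
    proof (intro mult_nonneg_nonneg zero_le_power mesh_size_nonneg)
      show "0 \<le> sobolev_norm \<Omega> (k + 2) ur"
        unfolding sobolev_norm_def by (intro real_sqrt_ge_zero sum_nonneg integral_nonneg_AE) auto
    qed
    have "0 \<le> aw_norm k a Th Eh (Qh k \<Omega> us - zm)"
      unfolding aw_norm_def using a0 by (intro real_sqrt_ge_zero aw_nonneg[of a0]) auto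
    then have \<epsilon>0: "0 \<le> \<epsilon>" using \<epsilon> by simp
    have "aw_norm k a Th Eh (Qh k \<Omega> u - uh) \<le> ?K * ?X"
    proof (rule enriched_error_estimate[OF pc a0 _ _ X _ sol])
      show "u \<in> H10 \<Omega>" using u by (simp add: weak_solution_def)
      show "\<forall>i\<in>{1..m}. n i \<in> H10 \<Omega>" using n assms(8) by blast
    qed (use cons in \<open>simp add: mult.assoc\<close>)
    also have "\<dots> \<le> (?K + 1) * (?X + \<epsilon>)"
      using K X \<epsilon>0 by (intro mult_mono) auto
    finally show "aw_norm k a Th Eh (Qh k \<Omega> u - uh)
      \<le> (?K + 1) * (mesh_size Th ^ (k + 1) * sobolev_norm \<Omega> (k + 2) ur + \<epsilon>)" .
  qed
qed

end
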